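(* Let $(\mathcal{X},F_{\mathcal{X}})$ and $(\mathcal{Y},F_{\mathcal{Y}})$ be connected, second countable and forward complete Finsler manifolds. Then, for any map $T:\mathcal{A}(\mathcal{Y})\to\mathcal{A}(\mathcal{X})$, the following are equivalent: 1. $T$ is an extended asymmetric normed algebra isomorphism. 2. There exists a bi-semi-Lipschitz diffeomorphism $h:(\mathcal{X},d_{\mathcal{X}})\to(\mathcal{Y},d_{\mathcal{Y}})$ such that $Tf=f\circ h$ for all $f\in\mathcal{A}(\mathcal{Y})$, and the semi-Lipschitz constants of $h$ and $h^{-1}$ are bounded by $\|T|$ and $\|T^{-1}|$, respectively.
   Context: Minkowski norm: a function $F:E\to[0,\infty)$ on a finite-dimensional real vector space $E$ such that $F(\lambda v)=\lambda F(v)$ for $\lambda\ge 0$; $F$ is continuous on $E$ and $C^\infty$ on $E\setminus\{0\}$; and for each $v\neq 0$ the quadratic form $\tfrac12 d^2[F^2](v)$ is positive definite. $F$ need not be symmetric. Finsler manifold: a pair $(\mathcal{X},F)$ with $\mathcal{X}$ a finite-dimensional $C^\infty$-smooth manifold and $F:T\mathcal{X}\to[0,\infty)$ continuous, $C^\infty$-smooth off the zero section, with $F(x,\cdot)$ a Minkowski norm on $T_x\mathcal{X}$ for each $x$. Finsler distance (for connected $\mathcal{X}$): $d_{\mathcal{X}}(x,y)=\inf_\sigma\int_a^b F(\sigma(t),\dot\sigma(t))\,dt$ over piecewise $C^1$ paths $\sigma:[a,b]\to\mathcal{X}$ from $x$ to $y$. It satisfies the triangle inequality and $d_{\mathcal{X}}(x,y)=0\iff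 x=y$, but may be non-symmetric. Its forward topology, generated by the balls $\{y: d_{\mathcal{X}}(x,y)<r\}$, is the manifold topology. Forward complete: every sequence $(x_n)$ such that for all $\varepsilon>0$ there is $n_0$ with $d_{\mathcal{X}}(x_n,x_m)<\varepsilon$ whenever $n_0\le n\le m$ converges in the forward topology. Semi-Lipschitz maps: $h:(\mathcal{X},d_{\mathcal{X}})\to(\mathcal{Y},d_{\mathcal{Y}})$ is semi-Lipschitz if there is $L\ge0$ with $d_{\mathcal{Y}}(h(x),h(x'))\le L\,d_{\mathcal{X}}(x,x')$ for all $x,x'$; the infimum of such $L$ is its semi-Lipschitz constant. $h$ is bi-semi-Lipschitz if it is a bijection with $h$ and $h^{-1}$ semi-Lipschitz. A function $f:\mathcal{X}\to\mathbb{R}$ is semi-Lipschitz if there is $L\ge0$ with $f(y)-f(x)\le L\,d_{\mathcal{X}}(x,y)$ for all $x,y$; the infimum of such $L$ is $\|f|_S$ (and $\|f|_S=+\infty$ if there is none). $SC_b^1(\mathcal{X})_+$ is the set of $C^1$-smooth functions $f:\mathcal{X}\to[0,\infty)$ with $\|f\|_\infty<\infty$ and $\|f|_S<\infty$, where $\|f\|_\infty$ is the supremum norm. $\mathcal{A}(\mathcal{X})$ is the linear span of $SC_b^1(\mathcal{X})_+$ in $\mathbb{R}^{\mathcal{X}}$, an algebra under pointwise multiplication, endowed with the extended asymmetric hemi-norm $\|f|=\max\{\|f\|_\infty,\|f|_S\}$ if $f\in SC_b^1(\mathcal{X})_+$ and $\|f|=+\infty$ otherwise. A linear map $T:\mathcal{A}(\mathcal{Y})\to\mathcal{A}(\mathcal{X})$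 is continuous if there is $K\ge0$ with $\|Tf|\le K\|f|$ for all $f\in\mathcal{A}(\mathcal{Y})$; the least such $K$ is the norm $\|T|$ (and similarly for $T^{-1}$). An extended asymmetric normed algebra isomorphism is a linear bijection $T$ with $T$ and $T^{-1}$ continuous in this sense and $T(fg)=Tf\cdot Tg$ for all $f,g\in\mathcal{A}(\mathcal{Y})$.
   Formalization: "Diffeomorphism" is taken to mean C^1-diffeomorphism; with C^infinity the implication (1)⇒(2) fails, e.g. for X=Y=R and Tf=f∘h with h bi-Lipschitz and C^1 with C^1 inverse but not smooth. *)

theory Defs
  imports "HOL-Analysis.Analysis" "HOL-Library.Function_Algebras"
begin

section \<open>Differentiability classes on open sets\<close>

text \<open>
  On an open subset \<open>S\<close> of a finite-dimensional space this is the usual class \<open>C\<^sup>k\<close>: a differentiable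
  map is of class \<open>Suc k\<close> iff all its directional derivatives are of class \<open>k\<close>.  All uses below are on
  open sets.
\<close>

primrec Ck_on :: "nat \<Rightarrow> ('e::real_normed_vector \<Rightarrow> 'f::real_normed_vector) \<Rightarrow> 'e set \<Rightarrow> bool" where
  "Ck_on 0 f S \<longleftrightarrow> continuous_on S f"
| "Ck_on (Suc k) f S \<longleftrightarrow> (\<forall>x\<in>S. f differentiable (at x)) \<and>
     (\<forall>v. Ck_on k (\<lambda>x. frechet_derivative f (at x) v) S)"

definition smooth_on :: "('e::real_normed_vector \<Rightarrow> 'f::real_normed_vector) \<Rightarrow> 'e set \<Rightarrow> bool" where
  "smooth_on f S \<longleftrightarrow> (\<forall>k. Ck_on k f S)"


section \<open>Minkowski norms\<close>

definition minkowski_norm :: "('e::real_normed_vector \<Rightarrow> real) \<Rightarrow> bool" where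
  "minkowski_norm N \<longleftrightarrow>
     (\<forall>v. 0 \<le> N v) \<and>
     (\<forall>l\<ge>0. \<forall>v. N (l *\<^sub>R v) = l * N v) \<and>
     continuous_on UNIV N \<and>
     smooth_on N (- {0}) \<and>
     (\<forall>v u. v \<noteq> 0 \<longrightarrow> u \<noteq> 0 \<longrightarrow>
        1 / 2 * frechet_derivative (\<lambda>z. frechet_derivative (\<lambda>y. (N y)\<^sup>2) (at z) u) (at v) u > 0)"


section \<open>Smooth manifolds and their tangent spaces\<close>

text \<open>
  The underlying space of a manifold is a whole Hausdorff type.  The model space \<open>'e\<close> is a normed space
  that is required to be spanned by a finite set; unlike with the class \<open>euclidean_space\<close>, dimension
  zero is not excluded.  A chart is a pair of its domain and its coordinate map; the values of the
  coordinate map outside the domain are irrelevant.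
\<close>

type_synonym ('a, 'e) chart = "'a set \<times> ('a \<Rightarrow> 'e)"

definition chart_inv :: "('a, 'e) chart \<Rightarrow> 'e \<Rightarrow> 'a" where
  "chart_inv c = inv_into (fst c) (snd c)"

definition smooth_atlas :: "('a::t2_space, 'e::real_normed_vector) chart set \<Rightarrow> bool" where
  "smooth_atlas A \<longleftrightarrow>
     (\<exists>B::'e set. finite B \<and> span B = UNIV) \<and>
     (\<forall>c\<in>A. open (fst c) \<and> open (snd c ` fst c) \<and>
        homeomorphism (fst c) (snd c ` fst c) (snd c) (chart_inv c)) \<and>
     (\<Union>c\<in>A. fst c) = UNIV \<and>
     (\<forall>c\<in>A. \<forall>c'\<in>A. smooth_on (snd c' \<circ> chart_inv c) (snd c ` (fst c \<inter> fst c')))"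

text \<open>
  A tangent vector at \<open>x\<close> is represented by the family of its coordinate vectors in all charts of the
  atlas around \<open>x\<close>, related by the derivatives of the coordinate changes (and set to 0 at all other
  charts).  The vector space structure of the tangent space is pointwise.
\<close>

type_synonym ('a, 'e) tangent = "('a, 'e) chart \<Rightarrow> 'e"

definition coord_change :: "('a, 'e::real_normed_vector) chart \<Rightarrow> ('a, 'e) chart \<Rightarrow> 'a \<Rightarrow> 'e \<Rightarrow> 'e" where
  "coord_change c c' x = frechet_derivative (snd c' \<circ> chart_inv c) (at (snd c x))"

definition tangent_space ::
    "('a::t2_space, 'e::real_normed_vector) chart set \<Rightarrow> 'a \<Rightarrow> ('a, 'e) tangent set" where
  "tangent_space A x = {v.
     (\<forall>c. c \<notin> A \<or> x \<notin> fst c \<longrightarrow> v c = 0) \<and>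
     (\<forall>c\<in>A. \<forall>c'\<in>A. x \<in> fst c \<inter> fst c' \<longrightarrow> v c' = coord_change c c' x (v c))}"

text \<open>The tangent vector at \<open>x\<close> whose coordinate vector in the chart \<open>c\<close> is \<open>w\<close>.\<close>

definition tangent_of :: "('a::t2_space, 'e::real_normed_vector) chart set \<Rightarrow> ('a, 'e) chart \<Rightarrow>
    'a \<Rightarrow> 'e \<Rightarrow> ('a, 'e) tangent" where
  "tangent_of A c x w = (\<lambda>c'. if c' \<in> A \<and> x \<in> fst c' then coord_change c c' x w else 0)"

lemma smooth_atlasD:
  assumes "smooth_atlas A" "c \<in> A"
  shows "open (snd c ` fst c)" "open (fst c)" "continuous_on (snd c ` fst c) (chart_inv c)"
    and "x \<in> fst c \<Longrightarrow> chart_inv c (snd c x) = x"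
    and "c' \<in> A \<Longrightarrow> smooth_on (snd c' \<circ> chart_inv c) (snd c ` (fst c \<inter> fst c'))"
  using assms by (simp_all add: smooth_atlas_def homeomorphism_def)

lemma coord_change_cocycle:
  assumes A: "smooth_atlas A" and c: "c \<in> A" "c1 \<in> A" "c2 \<in> A"
    and x: "x \<in> fst c" "x \<in> fst c1" "x \<in> fst c2"
  shows "coord_change c1 c2 x (coord_change c c1 x w) = coord_change c c2 x w"
proof -
  have inv: "chart_inv c (snd c y) = y" if "c \<in> A" "y \<in> fst c" for c y
    by (rule smooth_atlasD(4)[OF A that])
  have diff: "(snd c' \<circ> chart_inv c) differentiable (at (snd c x))"
    if "c \<in> A" "c' \<in> A" "x \<in> fst c" "x \<in> fst c'" for c c'
  proof -
    have "Ck_on (Suc 0) (snd c' \<circ> chart_inv c) (snd c ` (fst c \<inter> fst c'))"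
      using smooth_atlasD(5)[OF A that(1,2)] by (simp only: smooth_on_def)
    then show ?thesis using that by (simp del: comp_apply)
  qed
  define W where "W = snd c ` fst c \<inter> chart_inv c -` (fst c1 \<inter> fst c2)"
  have "open W"
  proof -
    have "continuous_on (snd c ` fst c) (chart_inv c)" "open (snd c ` fst c)" "open (fst c1 \<inter> fst c2)"
      using smooth_atlasD[OF A] c by (simp_all add: open_Int)
    then show ?thesis unfolding W_def by (rule continuous_open_preimage)
  qed
  have D: "((snd c' \<circ> chart_inv c) has_derivative coord_change c c' x) (at (snd c x))"
    if "c \<in> A" "c' \<in> A" "x \<in> fst c" "x \<in> fst c'" for c c'
    using diff[OF that] unfolding coord_change_def by (simp add: frechet_derivative_works)
  have p: "(snd c1 \<circ> chart_inv c) (snd c x) = snd c1 x" using inv c x by simp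
  have "((snd c2 \<circ> chart_inv c1) \<circ> (snd c1 \<circ> chart_inv c) has_derivative
      coord_change c1 c2 x \<circ> coord_change c c1 x) (at (snd c x))"
    by (rule diff_chain_at[OF D]) (use D[of c1 c2] c x p in simp_all)
  moreover have "snd c x \<in> W" using c x inv by (auto simp: W_def)
  moreover have "((snd c2 \<circ> chart_inv c1) \<circ> (snd c1 \<circ> chart_inv c)) y = (snd c2 \<circ> chart_inv c) y" if "y \<in> W" for y
    using that inv c by (auto simp: W_def)
  ultimately have "((snd c2 \<circ> chart_inv c) has_derivative
      coord_change c1 c2 x \<circ> coord_change c c1 x) (at (snd c x))"
    by (rule has_derivative_transform_within_open[OF _ \<open>open W\<close>])
  then have "coord_change c1 c2 x \<circ> coord_change c c1 x = coord_change c c2 x"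
    by (rule has_derivative_unique) (rule D; use c x in simp)
  then show ?thesis by (metis comp_apply)
qed

lemma bij_betw_tangent_of:
  assumes A: "smooth_atlas A" and c: "c \<in> A" "x \<in> fst c"
  shows "bij_betw (tangent_of A c x) UNIV (tangent_space A x)"
proof (rule bij_betwI[where g = "\<lambda>v. v c"])
  show "tangent_of A c x \<in> UNIV \<rightarrow> tangent_space A x"
    using assms by (auto simp: tangent_of_def tangent_space_def coord_change_cocycle)
  have inv: "chart_inv c (snd c y) = y" if "y \<in> fst c" for y
    by (rule smooth_atlasD(4)[OF A c(1) that])
  have "open (snd c ` fst c)" by (rule smooth_atlasD(1)[OF A c(1)])
  then have "((snd c \<circ> chart_inv c) has_derivative id) (at (snd c x))"
    by (rule has_derivative_transform_within_open[OF has_derivative_id]) (use c inv in auto)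
  then have "coord_change c c x = id"
    unfolding coord_change_def by (metis frechet_derivative_at)
  then show "tangent_of A c x w c = w" for w
    using c by (simp add: tangent_of_def)
  show "tangent_of A c x (v c) = v" if v: "v \<in> tangent_space A x" for v
  proof
    fix c'
    show "tangent_of A c x (v c) c' = v c'"
    proof (cases "c' \<in> A \<and> x \<in> fst c'")
      case True
      then have "v c' = coord_change c c' x (v c)"
        using v c unfolding tangent_space_def by blast
      then show ?thesis using True unfolding tangent_of_def by presburger
    next
      case False
      then have "v c' = 0" using v unfolding tangent_space_def by blast
      then show ?thesis using False unfolding tangent_of_def by presburger
    qed
  qed
qed auto


section \<open>Finsler manifolds\<close>

text \<open>
  \<open>local_rep A F c\<close> is the Finsler structure read in the bundle chart of the tangent bundle induced by
  \<open>c\<close>; it lives on \<open>snd c ` fst c \<times> UNIV\<close>.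
\<close>

definition local_rep :: "('a::t2_space, 'e::real_normed_vector) chart set \<Rightarrow>
    ('a \<Rightarrow> ('a, 'e) tangent \<Rightarrow> real) \<Rightarrow> ('a, 'e) chart \<Rightarrow> 'e \<times> 'e \<Rightarrow> real" where
  "local_rep A F c = (\<lambda>(y, w). F (chart_inv c y) (tangent_of A c (chart_inv c y) w))"

text \<open>
  The values of \<open>F x\<close> outside \<open>tangent_space A x\<close> are irrelevant.  That \<open>F x\<close> is a Minkowski norm on
  the tangent space is expressed through the linear isomorphisms \<open>tangent_of A c x\<close>.
\<close>

definition finsler_manifold :: "('a::t2_space, 'e::real_normed_vector) chart set \<Rightarrow>
    ('a \<Rightarrow> ('a, 'e) tangent \<Rightarrow> real) \<Rightarrow> bool" where
  "finsler_manifold A F \<longleftrightarrow>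
     smooth_atlas A \<and>
     (\<forall>x. \<forall>v\<in>tangent_space A x. 0 \<le> F x v) \<and>
     (\<forall>c\<in>A. continuous_on (snd c ` fst c \<times> UNIV) (local_rep A F c) \<and>
        smooth_on (local_rep A F c) (snd c ` fst c \<times> (- {0}))) \<and>
     (\<forall>c\<in>A. \<forall>x\<in>fst c. minkowski_norm (\<lambda>w. F x (tangent_of A c x w)))"


section \<open>The Finsler distance\<close>

definition velocity :: "('a::t2_space, 'e::real_normed_vector) chart set \<Rightarrow> real set \<Rightarrow>
    (real \<Rightarrow> 'a) \<Rightarrow> real \<Rightarrow> ('a, 'e) tangent" where
  "velocity A S \<sigma> t = (\<lambda>c. if c \<in> A \<and> \<sigma> t \<in> fst c
     then vector_derivative (snd c \<circ> \<sigma>) (at t within S) else 0)"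

text \<open>Meant for nondegenerate compact intervals \<open>S\<close>, with one-sided derivatives at the end points.\<close>

definition C1_path_on :: "('a::t2_space, 'e::real_normed_vector) chart set \<Rightarrow> real set \<Rightarrow>
    (real \<Rightarrow> 'a) \<Rightarrow> bool" where
  "C1_path_on A S \<sigma> \<longleftrightarrow> continuous_on S \<sigma> \<and>
     (\<forall>c\<in>A. (\<forall>t \<in> S \<inter> \<sigma> -` fst c. (snd c \<circ> \<sigma>) differentiable (at t within S)) \<and>
        continuous_on (S \<inter> \<sigma> -` fst c) (\<lambda>t. velocity A S \<sigma> t c))"

text \<open>
  The library's \<open>piecewise_C1_differentiable_on\<close> is not suitable: it allows derivatives that are
  unbounded near the break points.
\<close>

definition piecewise_C1_path :: "('a::t2_space, 'e::real_normed_vector) chart set \<Rightarrow> real \<Rightarrow> real \<Rightarrow>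
    (real \<Rightarrow> 'a) \<Rightarrow> bool" where
  "piecewise_C1_path A a b \<sigma> \<longleftrightarrow>
     (\<exists>n s. s 0 = a \<and> s n = b \<and>
        (\<forall>i<n. s i < s (Suc i) \<and> C1_path_on A {s i..s (Suc i)} \<sigma>))"

text \<open>The values of the integrand at the finitely many break points do not affect the integral.\<close>

definition finsler_length :: "('a::t2_space, 'e::real_normed_vector) chart set \<Rightarrow>
    ('a \<Rightarrow> ('a, 'e) tangent \<Rightarrow> real) \<Rightarrow> real \<Rightarrow> real \<Rightarrow> (real \<Rightarrow> 'a) \<Rightarrow> real" where
  "finsler_length A F a b \<sigma> = integral {a..b} (\<lambda>t. F (\<sigma> t) (velocity A {a..b} \<sigma> t))"

definition finsler_dist :: "('a::t2_space, 'e::real_normed_vector) chart set \<Rightarrow>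
    ('a \<Rightarrow> ('a, 'e) tangent \<Rightarrow> real) \<Rightarrow> 'a \<Rightarrow> 'a \<Rightarrow> real" where
  "finsler_dist A F x y = Inf {finsler_length A F a b \<sigma> | a b \<sigma>.
     a < b \<and> piecewise_C1_path A a b \<sigma> \<and> \<sigma> a = x \<and> \<sigma> b = y}"

definition forward_topology :: "('a \<Rightarrow> 'a \<Rightarrow> real) \<Rightarrow> 'a topology" where
  "forward_topology d = topology_generated_by {{y. d x y < r} | x r. 0 < r}"

definition forward_complete :: "('a \<Rightarrow> 'a \<Rightarrow> real) \<Rightarrow> bool" where
  "forward_complete d \<longleftrightarrow>
     (\<forall>x::nat \<Rightarrow> 'a. (\<forall>\<epsilon>>0. \<exists>n0. \<forall>n m. n0 \<le> n \<and> n \<le> m \<longrightarrow> d (x n) (x m) < \<epsilon>) \<longrightarrow>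
        (\<exists>l. limitin (forward_topology d) x l sequentially))"


section \<open>Semi-Lipschitz maps and functions\<close>

definition semi_lipschitz_with :: "('a \<Rightarrow> 'a \<Rightarrow> real) \<Rightarrow> ('b \<Rightarrow> 'b \<Rightarrow> real) \<Rightarrow> ('a \<Rightarrow> 'b) \<Rightarrow> real \<Rightarrow> bool" where
  "semi_lipschitz_with d d' h L \<longleftrightarrow> 0 \<le> L \<and> (\<forall>x x'. d' (h x) (h x') \<le> L * d x x')"

definition semi_lipschitz :: "('a \<Rightarrow> 'a \<Rightarrow> real) \<Rightarrow> ('b \<Rightarrow> 'b \<Rightarrow> real) \<Rightarrow> ('a \<Rightarrow> 'b) \<Rightarrow> bool" where
  "semi_lipschitz d d' h \<longleftrightarrow> (\<exists>L. semi_lipschitz_with d d' h L)"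

definition semi_lip_const :: "('a \<Rightarrow> 'a \<Rightarrow> real) \<Rightarrow> ('b \<Rightarrow> 'b \<Rightarrow> real) \<Rightarrow> ('a \<Rightarrow> 'b) \<Rightarrow> ereal" where
  "semi_lip_const d d' h = Inf {ereal L | L. semi_lipschitz_with d d' h L}"

definition bi_semi_lipschitz :: "('a \<Rightarrow> 'a \<Rightarrow> real) \<Rightarrow> ('b \<Rightarrow> 'b \<Rightarrow> real) \<Rightarrow> ('a \<Rightarrow> 'b) \<Rightarrow> bool" where
  "bi_semi_lipschitz d d' h \<longleftrightarrow> bij h \<and> semi_lipschitz d d' h \<and> semi_lipschitz d' d (inv h)"

text \<open>\<open>Inf {} = \<infinity>\<close> in \<open>ereal\<close>, as required for functions that are not semi-Lipschitz.\<close>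

definition slip_norm :: "('a \<Rightarrow> 'a \<Rightarrow> real) \<Rightarrow> ('a \<Rightarrow> real) \<Rightarrow> ereal" where
  "slip_norm d f = Inf {ereal L | L. 0 \<le> L \<and> (\<forall>x y. f y - f x \<le> L * d x y)}"

definition sup_norm :: "('a \<Rightarrow> real) \<Rightarrow> ereal" where
  "sup_norm f = (SUP x. ereal \<bar>f x\<bar>)"


section \<open>\<open>C\<^sup>1\<close> maps and diffeomorphisms\<close>

definition C1_function :: "('a::t2_space, 'e::real_normed_vector) chart set \<Rightarrow> ('a \<Rightarrow> real) \<Rightarrow> bool" where
  "C1_function A f \<longleftrightarrow> (\<forall>c\<in>A. Ck_on 1 (f \<circ> chart_inv c) (snd c ` fst c))"

definition C1_map :: "('a::t2_space, 'e::real_normed_vector) chart set \<Rightarrow>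
    ('b::t2_space, 'f::real_normed_vector) chart set \<Rightarrow> ('a \<Rightarrow> 'b) \<Rightarrow> bool" where
  "C1_map A A' h \<longleftrightarrow> continuous_on UNIV h \<and>
     (\<forall>c\<in>A. \<forall>c'\<in>A'. Ck_on 1 (snd c' \<circ> h \<circ> chart_inv c) (snd c ` (fst c \<inter> h -` fst c')))"

text \<open>
  Diffeomorphisms are \<open>C\<^sup>1\<close>: the algebra of \<open>C\<^sup>1\<close> functions below determines no finer structure.
\<close>

definition C1_diffeomorphism :: "('a::t2_space, 'e::real_normed_vector) chart set \<Rightarrow>
    ('b::t2_space, 'f::real_normed_vector) chart set \<Rightarrow> ('a \<Rightarrow> 'b) \<Rightarrow> bool" where
  "C1_diffeomorphism A A' h \<longleftrightarrow> bij h \<and> C1_map A A' h \<and> C1_map A' A (inv h)"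


section \<open>The extended asymmetric normed algebra of a Finsler manifold\<close>

definition SCb1_plus :: "('a::t2_space, 'e::real_normed_vector) chart set \<Rightarrow>
    ('a \<Rightarrow> ('a, 'e) tangent \<Rightarrow> real) \<Rightarrow> ('a \<Rightarrow> real) set" where
  "SCb1_plus A F = {f. C1_function A f \<and> (\<forall>x. 0 \<le> f x) \<and>
     sup_norm f < \<infinity> \<and> slip_norm (finsler_dist A F) f < \<infinity>}"

definition fun_scale :: "real \<Rightarrow> ('a \<Rightarrow> real) \<Rightarrow> 'a \<Rightarrow> real" where
  "fun_scale k f = (\<lambda>x. k * f x)"

lemma vector_space_fun_scale: "vector_space fun_scale"
  by standard (auto simp: fun_scale_def fun_eq_iff algebra_simps)

definition finsler_algebra :: "('a::t2_space, 'e::real_normed_vector) chart set \<Rightarrow>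
    ('a \<Rightarrow> ('a, 'e) tangent \<Rightarrow> real) \<Rightarrow> ('a \<Rightarrow> real) set" where
  "finsler_algebra A F = module.span fun_scale (SCb1_plus A F)"

definition asym_norm :: "('a::t2_space, 'e::real_normed_vector) chart set \<Rightarrow>
    ('a \<Rightarrow> ('a, 'e) tangent \<Rightarrow> real) \<Rightarrow> ('a \<Rightarrow> real) \<Rightarrow> ereal" where
  "asym_norm A F f = (if f \<in> SCb1_plus A F
     then max (sup_norm f) (slip_norm (finsler_dist A F) f) else \<infinity>)"

text \<open>
  \<open>bounded_with V p q T K\<close>: on \<open>V\<close>, the constant \<open>K\<close> bounds \<open>T\<close> with respect to the extended hemi-norms
  \<open>p\<close> (source) and \<open>q\<close> (target).  In \<open>ereal\<close>, \<open>0 * \<infinity> = 0\<close>; this is immaterial for linear maps on a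
  space spanned by elements of finite hemi-norm, since \<open>K = 0\<close> forces \<open>T = 0\<close> with either convention.
\<close>

definition bounded_with :: "('b \<Rightarrow> real) set \<Rightarrow> (('b \<Rightarrow> real) \<Rightarrow> ereal) \<Rightarrow> (('a \<Rightarrow> real) \<Rightarrow> ereal) \<Rightarrow>
    (('b \<Rightarrow> real) \<Rightarrow> 'a \<Rightarrow> real) \<Rightarrow> real \<Rightarrow> bool" where
  "bounded_with V p q T K \<longleftrightarrow> 0 \<le> K \<and> (\<forall>f\<in>V. q (T f) \<le> ereal K * p f)"

definition op_norm :: "('b \<Rightarrow> real) set \<Rightarrow> (('b \<Rightarrow> real) \<Rightarrow> ereal) \<Rightarrow> (('a \<Rightarrow> real) \<Rightarrow> ereal) \<Rightarrow>
    (('b \<Rightarrow> real) \<Rightarrow> 'a \<Rightarrow> real) \<Rightarrow> ereal" where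
  "op_norm V p q T = Inf {ereal K | K. bounded_with V p q T K}"

definition normed_algebra_iso ::
    "('b \<Rightarrow> real) set \<Rightarrow> (('b \<Rightarrow> real) \<Rightarrow> ereal) \<Rightarrow> ('a \<Rightarrow> real) set \<Rightarrow> (('a \<Rightarrow> real) \<Rightarrow> ereal) \<Rightarrow>
    (('b \<Rightarrow> real) \<Rightarrow> 'a \<Rightarrow> real) \<Rightarrow> bool" where
  "normed_algebra_iso V p W q T \<longleftrightarrow>
     bij_betw T V W \<and>
     (\<forall>f\<in>V. \<forall>g\<in>V. T (f + g) = T f + T g) \<and>
     (\<forall>k. \<forall>f\<in>V. T (fun_scale k f) = fun_scale k (T f)) \<and>
     (\<forall>f\<in>V. \<forall>g\<in>V. T (f * g) = T f * T g) \<and>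
     (\<exists>K. bounded_with V p q T K) \<and>
     (\<exists>K. bounded_with W q p (inv_into V T) K)"

end

theory Submission
  imports Defs
begin

text \<open>
  Given an isomorphism \<open>T\<close> and a point \<open>x\<close>, the character \<open>f \<mapsto> T f x\<close> is a limit of evaluations at points
  \<open>y n\<close>, because an element of the algebra that is bounded below by a positive constant is invertible.
  The semi-Lipschitz bound for \<open>T\<close>, applied to \<open>C\<^sup>1\<close> approximations of the functions
  \<open>min (d (y n) z) 1\<close>, shows that \<open>y n\<close> can be chosen forward Cauchy; by completeness it converges, and the
  character is the evaluation at the limit \<open>h x\<close>.  The same approximations give the semi-Lipschitz
  constant of \<open>h\<close> locally, hence, along paths, globally; cut-off coordinate functions show that \<open>h\<close> is
  \<open>C\<^sup>1\<close>.

  The approximations are obtained by averaging over small translations in charts.  An average of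
  translates of \<open>f\<close> satisfies the same infinitesimal semi-Lipschitz condition as \<open>f\<close> up to a factor
  close to \<open>1\<close>, by uniform continuity of the Finsler structure, and the infinitesimal condition
  integrates along paths to the global one.
\<close>

section \<open>Normed spaces spanned by a finite set\<close>

text \<open>The asymmetry of the distance shapes the argument. An element \<open>f\<close> of the
  cone \<open>SC\<close> need not have \<open>- f\<close> semi-Lipschitz, so invertibility and
  characters are treated in differences of two cone elements, while quantitative estimates run
  through single cone elements, where the hemi-norm is finite. Boundedness of \<open>T\<close>
  compares \<open>T f\<close> at two points of the source manifold, but the points
  \<open>y n\<close> lie in the target and are not yet known to come from the source. The link is
  made by bumps \<open>b n\<close> at \<open>x\<close>: requiring
  \<open>S (b n) (y n) > 1 / 2\<close> and applying density to the inverse \<open>S\<close> at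
  \<open>y n\<close> yields a point \<open>x'\<close> with \<open>b n x' \<noteq> 0\<close>, hence
  close to \<open>x\<close>, at which \<open>T f x'\<close> is close to \<open>f (y n)\<close>.
  Truncation at \<open>1\<close> keeps distance functions bounded, so their images under
  \<open>T\<close> reveal only small distances; this is why the semi-Lipschitz constant of
  \<open>h\<close> is first found locally. The constants stay sharp because, in charts, the Finsler
  norm is compared with its value at a frozen base point, with an error that can be made arbitrarily
  small.\<close>

lemma compact_imp_closed_span:
  fixes B :: "'e::real_normed_vector set"
  assumes "\<And>R. compact (span B \<inter> cball 0 R)"
  shows "closed (span B)"
  unfolding closed_sequential_limits
proof (intro allI impI, elim conjE)
  fix x l assume x: "\<forall>n. x n \<in> span B" and lim: "x \<longlonglongrightarrow> l"
  have "Bseq x" using lim by (simp add: convergent_imp_Bseq convergentI)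
  then obtain R where "\<And>n. norm (x n) \<le> R" by (meson BseqE)
  then have "\<forall>n. x n \<in> span B \<inter> cball 0 R" using x by auto
  moreover have "closed (span B \<inter> cball 0 R)" using assms by (rule compact_imp_closed)
  ultimately have "l \<in> span B \<inter> cball 0 R" using lim closed_sequentially by blast
  then show "l \<in> span B" by simp
qed

text \<open>The constant \<open>d\<close> is the distance of \<open>b\<close> from the closed span;
  homogeneity reduces the estimate to \<open>k = 1\<close>. It controls one coefficient of a vector
  by the norm of the vector.\<close>

lemma span_coefficient_bound:
  fixes B :: "'e::real_normed_vector set"
  assumes "closed (span B)" "b \<notin> span B"
  obtains d where "0 < d" "\<And>k u. u \<in> span B \<Longrightarrow> \<bar>k\<bar> * d \<le> norm (k *\<^sub>R b + u)"
proof
  define d where "d = infdist b (span B)"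
  have ne: "span B \<noteq> {}" using span_zero by blast
  show "0 < d" unfolding d_def using assms ne infdist_pos_not_in_closed by blast
  show "\<bar>k\<bar> * d \<le> norm (k *\<^sub>R b + u)" if u: "u \<in> span B" for k u
  proof (cases "k = 0")
    case False
    have "- (inverse k *\<^sub>R u) \<in> span B" using u by (simp add: span_neg span_scale)
    then have "d \<le> dist b (- (inverse k *\<^sub>R u))" unfolding d_def by (rule infdist_le)
    also have "\<dots> = norm (b + inverse k *\<^sub>R u)" by (simp add: dist_norm)
    finally have "\<bar>k\<bar> * d \<le> \<bar>k\<bar> * norm (b + inverse k *\<^sub>R u)" by (simp add: mult_left_mono)
    also have "\<dots> = norm (k *\<^sub>R (b + inverse k *\<^sub>R u))" by simp
    also have "\<dots> = norm (k *\<^sub>R b + u)" using False by (simp add: scaleR_add_right)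
    finally show ?thesis .
  qed simp
qed

text \<open>Heine-Borel for an abstract finite-dimensional norm. The coefficient bound confines the
  new coordinate, and the rest of the vector lies in a larger ball of the smaller span; the radius
  therefore varies in the induction.\<close>

lemma compact_span_cball:
  fixes B :: "'e::real_normed_vector set"
  assumes "finite B"
  shows "compact (span B \<inter> cball 0 R)"
  using assms
proof (induction B arbitrary: R rule: finite_induct)
  case empty
  have "finite (span {} \<inter> cball (0::'e) R)" by simp
  then show ?case by (rule finite_imp_compact)
next
  case (insert b B)
  show ?case
  proof (cases "b \<in> span B")
    case True
    then show ?thesis using insert.IH by (simp add: span_redundant)
  next
    case False
    have "closed (span B)" using insert.IH by (rule compact_imp_closed_span)
    then obtain d where d: "0 < d" "\<And>k u. u \<in> span B \<Longrightarrow> \<bar>k\<bar> * d \<le> norm (k *\<^sub>R b + u)"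
      using span_coefficient_bound False by blast
    \<comment> \<open>If the combination has norm at most \<open>R\<close>, then
      \<open>\<bar>k\<bar> \<le> R / d\<close>, and the triangle inequality gives the radius for
      \<open>u\<close>.\<close>
    define S where "S = (\<lambda>(k::real, u). k *\<^sub>R b + u) `
      ({- (R / d)..R / d} \<times> (span B \<inter> cball 0 (R + R / d * norm b)))"
    have "compact S" unfolding S_def
    proof (rule compact_continuous_image)
      show "compact ({- (R / d)..R / d} \<times> (span B \<inter> cball 0 (R + R / d * norm b)))"
        using insert.IH by (intro compact_Times) auto
      show "continuous_on ({- (R / d)..R / d} \<times> (span B \<inter> cball 0 (R + R / d * norm b)))
        (\<lambda>(k, u). k *\<^sub>R b + u)"
        unfolding case_prod_unfold by (intro continuous_intros)
    qed
    have "span (insert b B) \<inter> cball 0 R = S \<inter> cball 0 R"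
    proof (intro set_eqI iffI)
      fix x assume x: "x \<in> span (insert b B) \<inter> cball 0 R"
      then obtain k where k: "x - k *\<^sub>R b \<in> span B" using span_breakdown_eq by blast
      have "\<bar>k\<bar> * d \<le> norm x" using d(2)[OF k, of k] by simp
      then have kd: "\<bar>k\<bar> \<le> R / d" using x d(1) by (simp add: field_simps)
      have "norm (x - k *\<^sub>R b) \<le> norm x + \<bar>k\<bar> * norm b"
        using norm_triangle_ineq4[of x "k *\<^sub>R b"] by simp
      also have "\<dots> \<le> R + R / d * norm b" using x kd by (intro add_mono mult_right_mono) auto
      finally have "(k, x - k *\<^sub>R b) \<in> {- (R / d)..R / d} \<times> (span B \<inter> cball 0 (R + R / d * norm b))"
        using kd k by auto
      then have "(\<lambda>(k, u). k *\<^sub>R b + u) (k, x - k *\<^sub>R b) \<in> S" unfolding S_def by (rule imageI)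
      then show "x \<in> S \<inter> cball 0 R" using x by simp
    next
      fix x assume x: "x \<in> S \<inter> cball 0 R"
      then obtain k u where "u \<in> span B" "x = k *\<^sub>R b + u" unfolding S_def by auto
      then have "x - k *\<^sub>R b \<in> span B" by simp
      then show "x \<in> span (insert b B) \<inter> cball 0 R" using x span_breakdown_eq by blast
    qed
    then show ?thesis using \<open>compact S\<close> by (simp add: compact_Int_closed)
  qed
qed

lemma closed_span_finite: "finite B \<Longrightarrow> closed (span (B :: 'e::real_normed_vector set))"
  by (intro compact_imp_closed_span compact_span_cball)

lemma compact_cball_finite_span:
  fixes B :: "'e::real_normed_vector set"
  assumes "finite B" "span B = UNIV"
  shows "compact (cball (p::'e) R)"
proof -
  have "compact ((+) p ` cball 0 R)"
    using compact_span_cball[OF assms(1), of R] assms(2) by (intro compact_translation) simp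
  then show ?thesis by simp
qed

lemma compact_sphere_finite_span:
  fixes B :: "'e::real_normed_vector set"
  assumes "finite B" "span B = UNIV"
  shows "compact {v::'e. norm v = 1}"
proof -
  have "{v::'e. norm v = 1} = cball 0 1 \<inter> {v. norm v = 1}" by auto
  moreover have "closed {v::'e. norm v = 1}" by (intro closed_Collect_eq continuous_intros)
  ultimately show ?thesis using compact_cball_finite_span[OF assms] by (metis compact_Int_closed)
qed

text \<open>The coordinate at \<open>b\<close> is bounded because \<open>b\<close> has positive
  distance from the span of the other basis vectors; \<open>inverse d\<close> bounds its operator
  norm.\<close>

lemma bounded_linear_representation:
  fixes B :: "'e::real_normed_vector set"
  assumes B: "finite B" "independent B" "span B = UNIV" and b: "b \<in> B"
  shows "bounded_linear (\<lambda>x. representation B x b)"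
proof -
  have nb: "b \<notin> span (B - {b})" using B(2) b dependent_def by blast
  have "closed (span (B - {b}))" using B(1) by (simp add: closed_span_finite)
  then obtain d where d: "0 < d"
    "\<And>k u. u \<in> span (B - {b}) \<Longrightarrow> \<bar>k\<bar> * d \<le> norm (k *\<^sub>R b + u)"
    using span_coefficient_bound nb by blast
  show ?thesis
  proof (rule bounded_linear_intro[where K = "inverse d"])
    show "representation B (x + y) b = representation B x b + representation B y b" for x y
      using B by (simp add: representation_add)
    show "representation B (r *\<^sub>R x) b = r *\<^sub>R representation B x b" for r x
      using B by (simp add: representation_scale)
    show "norm (representation B x b) \<le> norm x * inverse d" for x
    proof -
      have "x = (\<Sum>c\<in>B. representation B x c *\<^sub>R c)"
        using B by (simp add: sum_representation_eq)
      also have "\<dots> = representation B x b *\<^sub>R b + (\<Sum>c\<in>B-{b}. representation B x c *\<^sub>R c)"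
        using B b by (simp add: sum.remove)
      finally have x: "x = representation B x b *\<^sub>R b + (\<Sum>c\<in>B-{b}. representation B x c *\<^sub>R c)" .
      have "(\<Sum>c\<in>B-{b}. representation B x c *\<^sub>R c) \<in> span (B - {b})"
        by (intro span_sum span_scale span_base)
      then have "\<bar>representation B x b\<bar> * d \<le> norm x" using d(2) x by metis
      then show ?thesis using d(1) by (simp add: field_simps)
    qed
  qed
qed

lemma finite_spanning_basis:
  assumes "\<exists>B::('e::real_normed_vector) set. finite B \<and> span B = UNIV"
  obtains B :: "('e::real_normed_vector) set" where "finite B" "independent B" "span B = UNIV"
proof -
  obtain C :: "'e set" where C: "finite C" "span C = UNIV" using assms by blast
  obtain B where "B \<subseteq> C" "independent B" "C \<subseteq> span B"
    using maximal_independent_subset by blast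
  moreover have "finite B" using \<open>B \<subseteq> C\<close> C(1) by (rule finite_subset)
  moreover have "span C \<subseteq> span B" using \<open>C \<subseteq> span B\<close> by (rule span_minimal) (rule subspace_span)
  ultimately show ?thesis using that C(2) by blast
qed


section \<open>Functions of class \<open>C\<^sup>1\<close>\<close>

lemma Ck_on_1_unfold:
  "Ck_on 1 f S \<longleftrightarrow> (\<forall>x\<in>S. f differentiable at x) \<and>
     (\<forall>v. continuous_on S (\<lambda>x. frechet_derivative f (at x) v))"
  by (simp only: One_nat_def Ck_on.simps)

text \<open>The derivative in a full neighbourhood of a point is unique, so the choice made by
  \<open>frechet_derivative\<close> may be replaced by any field of derivatives with continuous
  directional values.\<close>

lemma Ck_on_1_iff:
  "Ck_on 1 f S \<longleftrightarrow> (\<exists>f'. (\<forall>x\<in>S. (f has_derivative f' x) (at x)) \<and> (\<forall>v. continuous_on S (\<lambda>x. f' x v)))"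
proof
  assume "Ck_on 1 f S"
  then show "\<exists>f'. (\<forall>x\<in>S. (f has_derivative f' x) (at x)) \<and> (\<forall>v. continuous_on S (\<lambda>x. f' x v))"
    unfolding Ck_on_1_unfold frechet_derivative_works by (rule exI[where x = "\<lambda>x. frechet_derivative f (at x)"])
next
  assume "\<exists>f'. (\<forall>x\<in>S. (f has_derivative f' x) (at x)) \<and> (\<forall>v. continuous_on S (\<lambda>x. f' x v))"
  then obtain f' where f': "\<And>x. x \<in> S \<Longrightarrow> (f has_derivative f' x) (at x)"
    "\<And>v. continuous_on S (\<lambda>x. f' x v)" by auto
  have "continuous_on S (\<lambda>x. frechet_derivative f (at x) v)" for v
    using f'(2) by (rule continuous_on_eq) (simp add: frechet_derivative_at[OF f'(1), symmetric])
  moreover have "f differentiable at x" if "x \<in> S" for x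
    using f'(1)[OF that] by (rule differentiableI)
  ultimately show "Ck_on 1 f S" unfolding Ck_on_1_unfold by blast
qed

lemma Ck_on_1I:
  assumes "\<And>x. x \<in> S \<Longrightarrow> (f has_derivative f' x) (at x)" "\<And>v. continuous_on S (\<lambda>x. f' x v)"
  shows "Ck_on 1 f S"
  unfolding Ck_on_1_iff by (intro exI[of _ f'] conjI ballI allI assms)

lemma Ck_on_1E:
  assumes "Ck_on 1 f S"
  obtains f' where "\<And>x. x \<in> S \<Longrightarrow> (f has_derivative f' x) (at x)" "\<And>v. continuous_on S (\<lambda>x. f' x v)"
proof
  show "(f has_derivative frechet_derivative f (at x)) (at x)" if "x \<in> S" for x
    using assms that unfolding Ck_on_1_unfold frechet_derivative_works by blast
  show "continuous_on S (\<lambda>x. frechet_derivative f (at x) v)" for v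
    using assms unfolding Ck_on_1_unfold by blast
qed

lemma Ck_on_1_continuous:
  assumes "Ck_on 1 f S"
  shows "continuous_on S f"
proof -
  have "\<forall>x\<in>S. f differentiable at x" using assms unfolding Ck_on_1_unfold by (rule conjunct1)
  then show ?thesis by (simp add: continuous_at_imp_continuous_on differentiable_imp_continuous_within)
qed

lemma Ck_on_1_subset: "Ck_on 1 f S \<Longrightarrow> T \<subseteq> S \<Longrightarrow> Ck_on 1 f T"
  unfolding Ck_on_1_unfold by (auto intro: continuous_on_subset)

text \<open>Derivatives depend only on a neighbourhood; this allows gluing of functions given by
  different formulas on overlapping open sets.\<close>

lemma Ck_on_1_local:
  assumes "\<And>x. x \<in> S \<Longrightarrow> \<exists>N g. open N \<and> x \<in> N \<and> Ck_on 1 g N \<and> (\<forall>y\<in>N. f y = g y)"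
  shows "Ck_on 1 f S"
proof -
  have loc: "\<exists>N. open N \<and> x \<in> N \<and> Ck_on 1 f N" if x: "x \<in> S" for x
  proof -
    obtain N g where N: "open N" "x \<in> N" "Ck_on 1 g N" "\<forall>y\<in>N. f y = g y"
      using assms[OF x] by auto
    obtain g' where g': "\<And>x. x \<in> N \<Longrightarrow> (g has_derivative g' x) (at x)" "\<And>v. continuous_on N (\<lambda>x. g' x v)"
      using N(3) by (rule Ck_on_1E) (rule that)
    have "(f has_derivative g' y) (at y)" if "y \<in> N" for y
      using g'(1)[OF that] N(1) that by (rule has_derivative_transform_within_open) (use N in auto)
    then have "Ck_on 1 f N" using g'(2) by (rule Ck_on_1I)
    then show ?thesis using N by blast
  qed
  have "f differentiable at x" if "x \<in> S" for x
    using loc[OF that] unfolding Ck_on_1_unfold by blast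
  moreover have "continuous_on S (\<lambda>x. frechet_derivative f (at x) v)" for v
    unfolding continuous_on_eq_continuous_within
  proof
    fix x assume "x \<in> S"
    then obtain N where N: "open N" "x \<in> N" "Ck_on 1 f N" using loc by blast
    have "continuous_on N (\<lambda>x. frechet_derivative f (at x) v)"
      using N(3) unfolding Ck_on_1_unfold by simp
    then have "continuous (at x) (\<lambda>x. frechet_derivative f (at x) v)"
      using N(1,2) by (simp add: continuous_on_eq_continuous_at)
    then show "continuous (at x within S) (\<lambda>x. frechet_derivative f (at x) v)"
      by (rule continuous_at_imp_continuous_at_within)
  qed
  ultimately show ?thesis unfolding Ck_on_1_unfold by simp
qed

lemma Ck_on_1_const: "Ck_on 1 (\<lambda>x. k) S"
  by (rule Ck_on_1I[where f' = "\<lambda>x v. 0"]) auto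

lemma Ck_on_1_bounded_linear: "bounded_linear f \<Longrightarrow> Ck_on 1 f S"
  by (rule Ck_on_1I[where f' = "\<lambda>x. f"]) (auto simp: bounded_linear_imp_has_derivative)

lemma Ck_on_1_add:
  assumes "Ck_on 1 f S" "Ck_on 1 g S" shows "Ck_on 1 (\<lambda>x. f x + g x) S"
proof -
  obtain f' where "\<And>x. x \<in> S \<Longrightarrow> (f has_derivative f' x) (at x)" "\<And>v. continuous_on S (\<lambda>x. f' x v)"
    using assms(1) by (rule Ck_on_1E) (rule that)
  moreover obtain g' where "\<And>x. x \<in> S \<Longrightarrow> (g has_derivative g' x) (at x)" "\<And>v. continuous_on S (\<lambda>x. g' x v)"
    using assms(2) by (rule Ck_on_1E) (rule that)
  ultimately show ?thesis
    by (intro Ck_on_1I[where f' = "\<lambda>x v. f' x v + g' x v"] has_derivative_add continuous_on_add)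
qed

lemma Ck_on_1_sum:
  "finite I \<Longrightarrow> (\<And>i. i \<in> I \<Longrightarrow> Ck_on 1 (f i) S) \<Longrightarrow> Ck_on 1 (\<lambda>x. \<Sum>i\<in>I. f i x) S"
  by (induction I rule: finite_induct) (simp_all add: Ck_on_1_const Ck_on_1_add del: One_nat_def)

lemma Ck_on_1_mult:
  fixes f g :: "'e::real_normed_vector \<Rightarrow> real"
  assumes "Ck_on 1 f S" "Ck_on 1 g S" shows "Ck_on 1 (\<lambda>x. f x * g x) S"
proof -
  obtain f' where f': "\<And>x. x \<in> S \<Longrightarrow> (f has_derivative f' x) (at x)" "\<And>v. continuous_on S (\<lambda>x. f' x v)"
    using assms(1) by (rule Ck_on_1E) (rule that)
  obtain g' where g': "\<And>x. x \<in> S \<Longrightarrow> (g has_derivative g' x) (at x)" "\<And>v. continuous_on S (\<lambda>x. g' x v)"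
    using assms(2) by (rule Ck_on_1E) (rule that)
  show ?thesis
    by (rule Ck_on_1I[where f' = "\<lambda>x v. f x * g' x v + f' x v * g x"])
      (auto intro!: has_derivative_mult continuous_intros f' g' Ck_on_1_continuous[OF assms(1)] Ck_on_1_continuous[OF assms(2)])
qed

lemma Ck_on_1_inverse:
  fixes f :: "'e::real_normed_vector \<Rightarrow> real"
  assumes "Ck_on 1 f S" "\<And>x. x \<in> S \<Longrightarrow> f x \<noteq> 0" shows "Ck_on 1 (\<lambda>x. inverse (f x)) S"
proof -
  obtain f' where *: "\<And>x. x \<in> S \<Longrightarrow> (f has_derivative f' x) (at x)" "\<And>v. continuous_on S (\<lambda>x. f' x v)"
    using assms(1) by (rule Ck_on_1E) (rule that)
  show ?thesis
  proof (rule Ck_on_1I)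
    show "((\<lambda>x. inverse (f x)) has_derivative (\<lambda>v. - (inverse (f x) * f' x v * inverse (f x)))) (at x)"
      if "x \<in> S" for x
      using assms(2)[OF that] *(1)[OF that] by (auto intro!: derivative_eq_intros simp: mult.assoc)
    show "continuous_on S (\<lambda>x. - (inverse (f x) * f' x v * inverse (f x)))" for v
      using assms(2) by (intro continuous_intros * Ck_on_1_continuous[OF assms(1)]) auto
  qed
qed

lemma Ck_on_1_scaleR:
  fixes f :: "'e::real_normed_vector \<Rightarrow> real" and b :: "'f::real_normed_vector"
  assumes "Ck_on 1 f S" shows "Ck_on 1 (\<lambda>x. f x *\<^sub>R b) S"
proof -
  obtain f' where *: "\<And>x. x \<in> S \<Longrightarrow> (f has_derivative f' x) (at x)" "\<And>v. continuous_on S (\<lambda>x. f' x v)"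
    using assms(1) by (rule Ck_on_1E) (rule that)
  show ?thesis
    by (rule Ck_on_1I[where f' = "\<lambda>x v. f' x v *\<^sub>R b"])
      (auto intro!: has_derivative_scaleR_left continuous_intros *)
qed

text \<open>\<open>Ck_on\<close> controls the outer derivative only in fixed directions, whereas the
  chain rule evaluates it at the moving direction \<open>g' x v\<close>. Expanding that vector in a
  basis leaves finitely many fixed directions with continuous coefficients.\<close>

lemma Ck_on_1_compose:
  fixes g :: "'e::real_normed_vector \<Rightarrow> 'f::real_normed_vector" and f :: "'f \<Rightarrow> 'g::real_normed_vector"
  assumes fin: "\<exists>B::'f set. finite B \<and> span B = UNIV"
    and f: "Ck_on 1 f T" and g: "Ck_on 1 g S" and "g ` S \<subseteq> T"
  shows "Ck_on 1 (f \<circ> g) S"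
proof -
  obtain B :: "'f set" where B: "finite B" "independent B" "span B = UNIV"
    using fin by (rule finite_spanning_basis)
  obtain f' where f': "\<And>x. x \<in> T \<Longrightarrow> (f has_derivative f' x) (at x)" "\<And>v. continuous_on T (\<lambda>x. f' x v)"
    using f by (rule Ck_on_1E) (rule that)
  obtain g' where g': "\<And>x. x \<in> S \<Longrightarrow> (g has_derivative g' x) (at x)" "\<And>v. continuous_on S (\<lambda>x. g' x v)"
    using g by (rule Ck_on_1E) (rule that)
  show ?thesis
  proof (rule Ck_on_1I[where f' = "\<lambda>x. f' (g x) \<circ> g' x"])
    show "(f \<circ> g has_derivative f' (g x) \<circ> g' x) (at x)" if "x \<in> S" for x
      using g'(1)[OF that] by (rule diff_chain_at) (use f' that \<open>g ` S \<subseteq> T\<close> in auto)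
    fix v
    have eq: "(f' (g x) \<circ> g' x) v = (\<Sum>b\<in>B. representation B (g' x v) b *\<^sub>R f' (g x) b)" if "x \<in> S" for x
    proof -
      have "linear (f' (g x))" using f'(1) that \<open>g ` S \<subseteq> T\<close> by (blast dest: has_derivative_linear)
      then have "(\<Sum>b\<in>B. representation B (g' x v) b *\<^sub>R f' (g x) b)
        = f' (g x) (\<Sum>b\<in>B. representation B (g' x v) b *\<^sub>R b)"
        by (simp add: linear_sum linear_scale)
      also have "(\<Sum>b\<in>B. representation B (g' x v) b *\<^sub>R b) = g' x v"
        using B by (simp add: sum_representation_eq)
      finally show ?thesis by simp
    qed
    have "continuous_on S (\<lambda>x. \<Sum>b\<in>B. representation B (g' x v) b *\<^sub>R f' (g x) b)"
    proof (intro continuous_on_sum continuous_on_scaleR)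
      fix b assume "b \<in> B"
      then show "continuous_on S (\<lambda>x. representation B (g' x v) b)"
        using bounded_linear.continuous_on[OF bounded_linear_representation[OF B]] g'(2) by blast
      show "continuous_on S (\<lambda>x. f' (g x) b)"
        using f'(2) Ck_on_1_continuous[OF g] \<open>g ` S \<subseteq> T\<close> by (rule continuous_on_compose2)
    qed
    then show "continuous_on S (\<lambda>x. (f' (g x) \<circ> g' x) v)" by (rule continuous_on_eq) (simp only: eq)
  qed
qed

section \<open>From continuous partial derivatives to class C^1\<close>

text \<open>The increment is split into legs along single basis vectors, and the mean value theorem
  is applied to each leg. As the basis is arbitrary, the bounded coordinate functionals translate
  between coefficients and norms.\<close>

lemma Ck_on_1_partials:
  fixes g :: "'e::real_normed_vector \<Rightarrow> real"
  assumes B: "finite B" "independent B" "span B = (UNIV::'e set)"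
    and D: "\<And>b x. b \<in> B \<Longrightarrow> ((\<lambda>s. g (x + s *\<^sub>R b)) has_field_derivative D b x) (at 0)"
    and cD: "\<And>b. b \<in> B \<Longrightarrow> continuous_on UNIV (D b)"
  shows "Ck_on 1 g UNIV"
proof (rule Ck_on_1I[where f' = "\<lambda>x v. \<Sum>b\<in>B. representation B v b * D b x"])
  show "continuous_on UNIV (\<lambda>x. \<Sum>b\<in>B. representation B v b * D b x)" for v
    by (intro continuous_intros cD)
  have D': "((\<lambda>s. g (x + s *\<^sub>R b)) has_field_derivative D b (x + s *\<^sub>R b)) (at s)" if "b \<in> B" for b x s
  proof -
    have "((\<lambda>h. g (x + s *\<^sub>R b + (h - s) *\<^sub>R b)) has_field_derivative D b (x + s *\<^sub>R b) * (1 - 0)) (at s)"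
      by (rule DERIV_chain2[where f = "\<lambda>h. g (x + s *\<^sub>R b + h *\<^sub>R b)" and g = "\<lambda>h. h - s"])
        (auto intro!: derivative_eq_intros simp: D[OF that])
    then show ?thesis by (simp add: algebra_simps)
  qed
  fix x
  \<comment> \<open>Coefficients of size at most \<open>r / (2 * K)\<close> keep all intermediate
    points within \<open>r / 2\<close> of \<open>x\<close>; the summand \<open>1\<close> keeps
    \<open>K\<close> positive.\<close>
  define K where "K = 1 + (\<Sum>b\<in>B. norm b)"
  have K: "1 \<le> K" unfolding K_def by (simp add: sum_nonneg)
  have step: "\<exists>r>0. \<forall>c. (\<forall>b\<in>B. \<bar>c b\<bar> \<le> r) \<longrightarrow>
      \<bar>g (x + (\<Sum>b\<in>B. c b *\<^sub>R b)) - g x - (\<Sum>b\<in>B. c b * D b x)\<bar> \<le> e * (\<Sum>b\<in>B. \<bar>c b\<bar>)" if "0 < e" for e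
  proof -
    have "\<exists>r>0. \<forall>b\<in>B. \<forall>y. dist y x < r \<longrightarrow> dist (D b y) (D b x) < e"
    proof -
      have "\<forall>b\<in>B. \<exists>r>0. \<forall>y. dist y x < r \<longrightarrow> dist (D b y) (D b x) < e"
        using cD that by (auto simp: continuous_on_iff)
      then obtain r where r: "\<And>b. b \<in> B \<Longrightarrow> 0 < r b \<and> (\<forall>y. dist y x < r b \<longrightarrow> dist (D b y) (D b x) < e)"
        by metis
      have "0 < Min (insert 1 (r ` B))" using B(1) r by auto
      moreover have "Min (insert 1 (r ` B)) \<le> r b" if "b \<in> B" for b using B(1) that by simp
      ultimately show ?thesis using r by (meson less_le_trans)
    qed
    then obtain r where r: "0 < r" "\<And>b y. b \<in> B \<Longrightarrow> dist y x < r \<Longrightarrow> \<bar>D b y - D b x\<bar> < e"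
      by (metis dist_real_def)
    have "\<bar>g (x + (\<Sum>b\<in>C. c b *\<^sub>R b)) - g x - (\<Sum>b\<in>C. c b * D b x)\<bar> \<le> e * (\<Sum>b\<in>C. \<bar>c b\<bar>)"
      if "C \<subseteq> B" and c: "\<forall>b\<in>B. \<bar>c b\<bar> \<le> r / (2 * K)" for c C
      using finite_subset[OF \<open>C \<subseteq> B\<close> B(1)] \<open>C \<subseteq> B\<close>
    proof (induction C rule: finite_induct)
      case (insert b C)
      define y where "y = x + (\<Sum>b\<in>C. c b *\<^sub>R b)"
      have near: "dist (y + s *\<^sub>R b) x < r" if "\<bar>s\<bar> \<le> \<bar>c b\<bar>" for s
      proof -
        have "dist (y + s *\<^sub>R b) x = norm ((\<Sum>b\<in>C. c b *\<^sub>R b) + s *\<^sub>R b)"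
          unfolding y_def dist_norm by (simp add: algebra_simps)
        also have "\<dots> \<le> (\<Sum>b\<in>C. \<bar>c b\<bar> * norm b) + \<bar>c b\<bar> * norm b"
          using that by (intro norm_triangle_le add_mono norm_sum[THEN order_trans]) (auto intro: mult_right_mono sum_mono)
        also have "\<dots> = (\<Sum>b\<in>insert b C. \<bar>c b\<bar> * norm b)" using insert.hyps by simp
        also have "\<dots> \<le> (\<Sum>b\<in>insert b C. r / (2 * K) * norm b)"
          using c insert.prems by (intro sum_mono mult_right_mono) auto
        also have "\<dots> \<le> (\<Sum>b\<in>B. r / (2 * K) * norm b)"
          using insert.prems B(1) r K by (intro sum_mono2) auto
        also have "\<dots> = r / (2 * K) * (\<Sum>b\<in>B. norm b)" by (simp add: sum_distrib_left)
        also have "\<dots> \<le> r / (2 * K) * K" using r K by (intro mult_left_mono) (auto simp: K_def)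
        also have "\<dots> < r" using r K by simp
        finally show ?thesis .
      qed
      \<comment> \<open>Mean value theorem on the leg from \<open>y\<close> in direction
        \<open>b\<close>; the sign of \<open>c b\<close> decides the orientation of the
        interval.\<close>
      have "\<exists>z. \<bar>z\<bar> \<le> \<bar>c b\<bar> \<and> g (y + c b *\<^sub>R b) - g y = c b * D b (y + z *\<^sub>R b)"
      proof -
        have bB: "b \<in> B" using insert.prems by simp
        consider "c b = 0" | "0 < c b" | "c b < 0" by linarith
        then show ?thesis
        proof cases
          case 1 then show ?thesis by (intro exI[of _ 0]) simp
        next
          case 2
          obtain z where "0 < z" "z < c b"
            "g (y + c b *\<^sub>R b) - g (y + 0 *\<^sub>R b) = (c b - 0) * D b (y + z *\<^sub>R b)"
            using MVT2[OF 2, of "\<lambda>s. g (y + s *\<^sub>R b)" "\<lambda>s. D b (y + s *\<^sub>R b)"] D'[OF bB] by blast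
          then show ?thesis by (intro exI[of _ z]) simp
        next
          case 3
          obtain z where "c b < z" "z < 0"
            "g (y + 0 *\<^sub>R b) - g (y + c b *\<^sub>R b) = (0 - c b) * D b (y + z *\<^sub>R b)"
            using MVT2[OF 3, of "\<lambda>s. g (y + s *\<^sub>R b)" "\<lambda>s. D b (y + s *\<^sub>R b)"] D'[OF bB] by blast
          then show ?thesis by (intro exI[of _ z]) (simp add: algebra_simps)
        qed
      qed
      then obtain z where z: "\<bar>z\<bar> \<le> \<bar>c b\<bar>" "g (y + c b *\<^sub>R b) - g y = c b * D b (y + z *\<^sub>R b)" by blast
      have "\<bar>D b (y + z *\<^sub>R b) - D b x\<bar> \<le> e" using r(2)[OF _ near[OF z(1)]] insert.prems by force
      then have "\<bar>c b * (D b (y + z *\<^sub>R b) - D b x)\<bar> \<le> \<bar>c b\<bar> * e" by (simp add: abs_mult mult_left_mono)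
      then have "\<bar>g (y + c b *\<^sub>R b) - g y - c b * D b x\<bar> \<le> e * \<bar>c b\<bar>" using z(2) by (simp add: algebra_simps)
      moreover have "\<bar>g y - g x - (\<Sum>b\<in>C. c b * D b x)\<bar> \<le> e * (\<Sum>b\<in>C. \<bar>c b\<bar>)"
        using insert.IH insert.prems unfolding y_def by simp
      moreover have "x + (\<Sum>b\<in>insert b C. c b *\<^sub>R b) = y + c b *\<^sub>R b"
        using insert.hyps unfolding y_def by (simp add: algebra_simps)
      moreover have "(\<Sum>b\<in>insert b C. c b * D b x) = c b * D b x + (\<Sum>b\<in>C. c b * D b x)"
        "e * (\<Sum>b\<in>insert b C. \<bar>c b\<bar>) = e * \<bar>c b\<bar> + e * (\<Sum>b\<in>C. \<bar>c b\<bar>)"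
        using insert.hyps by (simp_all add: distrib_left)
      ultimately show ?case by (simp only:)
    qed simp
    then show ?thesis using r K by (intro exI[of _ "r / (2 * K)"]) auto
  qed
  obtain M where M: "\<And>b v. b \<in> B \<Longrightarrow> \<bar>representation B v b\<bar> \<le> norm v * M b" "\<And>b. b \<in> B \<Longrightarrow> 0 < M b"
  proof -
    have "\<forall>b\<in>B. \<exists>K>0. \<forall>v. \<bar>representation B v b\<bar> \<le> norm v * K"
      using bounded_linear.pos_bounded[OF bounded_linear_representation[OF B]] by auto
    then show ?thesis using that by metis
  qed
  \<comment> \<open>One constant serves twice: \<open>N * norm v\<close> bounds each coordinate and
    also the sum of the absolute values of all coordinates.\<close>
  define N where "N = 1 + (\<Sum>b\<in>B. M b)"
  have MN: "M b \<le> N" if "b \<in> B" for b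
    using member_le_sum[OF that, of M] M(2) B(1) unfolding N_def by force
  have N: "1 \<le> N" unfolding N_def using M(2) by (simp add: sum_nonneg less_imp_le)
  show "(g has_derivative (\<lambda>v. \<Sum>b\<in>B. representation B v b * D b x)) (at x)"
    unfolding has_derivative_within_alt2
  proof (intro conjI allI impI)
    show "bounded_linear (\<lambda>v. \<Sum>b\<in>B. representation B v b * D b x)"
      by (intro bounded_linear_sum bounded_linear_mult_left[THEN bounded_linear_compose]
          bounded_linear_representation[OF B])
    fix e :: real assume e: "0 < e"
    obtain r where r: "r > 0" "\<And>c. (\<forall>b\<in>B. \<bar>c b\<bar> \<le> r) \<Longrightarrow>
      \<bar>g (x + (\<Sum>b\<in>B. c b *\<^sub>R b)) - g x - (\<Sum>b\<in>B. c b * D b x)\<bar> \<le> e / N * (\<Sum>b\<in>B. \<bar>c b\<bar>)"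
      using step[of "e / N"] e N by auto
    have "norm (g y - g x - (\<Sum>b\<in>B. representation B (y - x) b * D b x)) \<le> e * norm (y - x)"
      if "dist y x < r / N" for y
    proof -
      define c where "c = representation B (y - x)"
      have cM: "\<bar>c b\<bar> \<le> norm (y - x) * M b" if "b \<in> B" for b using M(1)[OF that] c_def by simp
      have "\<bar>c b\<bar> \<le> r" if b: "b \<in> B" for b
      proof -
        have "\<bar>c b\<bar> \<le> norm (y - x) * N" using cM[OF b] MN[OF b] by (meson mult_left_mono norm_ge_zero order_trans)
        also have "\<dots> \<le> r / N * N" using \<open>dist y x < r / N\<close> N by (intro mult_right_mono) (auto simp: dist_norm)
        finally show ?thesis using N by simp
      qed
      then have "\<bar>g (x + (\<Sum>b\<in>B. c b *\<^sub>R b)) - g x - (\<Sum>b\<in>B. c b * D b x)\<bar> \<le> e / N * (\<Sum>b\<in>B. \<bar>c b\<bar>)"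
        using r(2) by blast
      moreover have "(\<Sum>b\<in>B. c b *\<^sub>R b) = y - x" unfolding c_def using B by (simp add: sum_representation_eq)
      moreover have "e / N * (\<Sum>b\<in>B. \<bar>c b\<bar>) \<le> e / N * (norm (y - x) * N)"
      proof (intro mult_left_mono)
        have "(\<Sum>b\<in>B. \<bar>c b\<bar>) \<le> (\<Sum>b\<in>B. norm (y - x) * M b)" using cM by (rule sum_mono)
        also have "\<dots> = norm (y - x) * (\<Sum>b\<in>B. M b)" by (simp add: sum_distrib_left)
        also have "\<dots> \<le> norm (y - x) * N" unfolding N_def by (intro mult_left_mono) auto
        finally show "(\<Sum>b\<in>B. \<bar>c b\<bar>) \<le> norm (y - x) * N" .
      qed (use e N in auto)
      ultimately show ?thesis using N unfolding c_def by simp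
    qed
    moreover have "0 < r / N" using r N by simp
    ultimately show "\<forall>\<^sub>F y in at x. norm (g y - g x - (\<Sum>b\<in>B. representation B (y - x) b * D b x)) \<le> e * norm (y - x)"
      unfolding eventually_at by blast
  qed
qed

section \<open>Averaging over translations\<close>

text \<open>
  Each averaging in a direction \<open>b\<close> makes the function differentiable in that direction and keeps the
  derivatives in the directions treated before; after averaging over a basis the function is \<open>C\<^sup>1\<close>.
  This works in any finite-dimensional normed space without choosing a measure on it.
\<close>

lemma average_along:
  fixes G :: "'e::real_normed_vector \<Rightarrow> real"
  assumes G: "continuous_on UNIV G" and t: "0 < t"
  shows "((\<lambda>s. integral {0..1} (\<lambda>r. G (x + s *\<^sub>R b + (r * t) *\<^sub>R b))) has_field_derivative
    (G (x + t *\<^sub>R b) - G x) / t) (at 0)"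
proof -
  \<comment> \<open>The interval is enlarged by \<open>1\<close> on both sides so that
    \<open>s + r * t\<close> stays in its interior for all \<open>\<bar>s\<bar> < 1\<close> and
    \<open>r \<in> {0..1}\<close>; the derivatives of \<open>P\<close> are then two-sided.\<close>
  have "continuous_on {-1..t + 1} (\<lambda>r. G (x + r *\<^sub>R b))"
    by (rule continuous_on_compose2[OF G]) (auto intro!: continuous_intros)
  then obtain P where P: "\<And>r. r \<in> {-1..t + 1} \<Longrightarrow>
      (P has_vector_derivative G (x + r *\<^sub>R b)) (at r within {-1..t + 1})"
    using antiderivative_continuous by blast
  have P': "(P has_field_derivative G (x + r *\<^sub>R b)) (at r)" if "-1 < r" "r < t + 1" for r
    using P[of r] that by (simp add: has_real_derivative_iff_has_vector_derivative at_within_Icc_at)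
  \<comment> \<open>By substitution the average is a difference quotient of the antiderivative
    \<open>P\<close>, whence the form of its derivative.\<close>
  have eq: "integral {0..1} (\<lambda>r. G (x + s *\<^sub>R b + (r * t) *\<^sub>R b)) = (P (s + t) - P s) / t"
    if "\<bar>s\<bar> < 1" for s
  proof -
    have "((\<lambda>r. G (x + s *\<^sub>R b + (r * t) *\<^sub>R b)) has_integral P (s + 1 * t) / t - P (s + 0 * t) / t) {0..1}"
    proof (rule fundamental_theorem_of_calculus)
      fix r :: real assume r: "r \<in> {0..1}"
      have rt: "0 \<le> r * t" "r * t \<le> t" using r t by (auto simp: mult_left_le_one_le)
      have "((\<lambda>r. P (s + r * t)) has_field_derivative G (x + (s + r * t) *\<^sub>R b) * t) (at r within {0..1})"
        by (rule DERIV_chain2[OF P']) (use that rt in \<open>auto intro!: derivative_eq_intros\<close>)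
      then have "((\<lambda>r. P (s + r * t) / t) has_field_derivative G (x + (s + r * t) *\<^sub>R b) * t / t) (at r within {0..1})"
        by (rule DERIV_cdivide)
      then show "((\<lambda>r. P (s + r * t) / t) has_vector_derivative G (x + s *\<^sub>R b + (r * t) *\<^sub>R b)) (at r within {0..1})"
        using t by (simp add: has_real_derivative_iff_has_vector_derivative algebra_simps)
    qed simp
    then show ?thesis by (simp add: integral_unique diff_divide_distrib)
  qed
  have "((\<lambda>s. (P (s + t) - P s) / t) has_field_derivative
      (G (x + (0 + t) *\<^sub>R b) * (1 + 0) - G (x + 0 *\<^sub>R b)) / t) (at 0)"
  proof (intro DERIV_cdivide DERIV_diff)
    show "((\<lambda>s. P (s + t)) has_field_derivative G (x + (0 + t) *\<^sub>R b) * (1 + 0)) (at 0)"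
      by (rule DERIV_chain2[OF P']) (use t in \<open>auto intro!: derivative_eq_intros\<close>)
    show "(P has_field_derivative G (x + 0 *\<^sub>R b)) (at 0)" using P'[of 0] t by simp
  qed
  then have "((\<lambda>s. (P (s + t) - P s) / t) has_field_derivative (G (x + t *\<^sub>R b) - G x) / t) (at 0)"
    by simp
  then show ?thesis
    by (rule has_field_derivative_transform_within_open[where S = "{-1<..<1}"]) (auto simp: eq abs_less_iff)
qed

text \<open>Differentiation under the integral sign. The hypothesis at parameter \<open>0\<close>
  for every base point yields the derivative along the whole line, since moving the base point
  shifts the parameter.\<close>

lemma average_derivative:
  fixes G :: "'e::real_normed_vector \<Rightarrow> real"
  assumes G: "continuous_on UNIV G" and D: "continuous_on UNIV D"
    and deriv: "\<And>x. ((\<lambda>s. G (x + s *\<^sub>R b)) has_field_derivative D x) (at 0)"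
  shows "((\<lambda>s. integral {0..1} (\<lambda>r. G (x + s *\<^sub>R b + (r * t) *\<^sub>R c))) has_field_derivative
    integral {0..1} (\<lambda>r. D (x + (r * t) *\<^sub>R c))) (at 0)"
proof -
  have "((\<lambda>s. integral (cbox 0 1) (\<lambda>r. G (x + s *\<^sub>R b + (r * t) *\<^sub>R c))) has_field_derivative
    integral (cbox 0 1) (\<lambda>r. D (x + 0 *\<^sub>R b + (r * t) *\<^sub>R c))) (at 0 within UNIV)"
  proof (rule leibniz_rule_field_derivative)
    fix s r :: real
    have "((\<lambda>h. G (x + s *\<^sub>R b + (r * t) *\<^sub>R c + (h - s) *\<^sub>R b)) has_field_derivative
        D (x + s *\<^sub>R b + (r * t) *\<^sub>R c) * (1 - 0)) (at s)"
      by (rule DERIV_chain2[where f = "\<lambda>h. G (x + s *\<^sub>R b + (r * t) *\<^sub>R c + h *\<^sub>R b)" and g = "\<lambda>h. h - s"])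
        (auto intro!: derivative_eq_intros simp: deriv)
    then show "((\<lambda>s. G (x + s *\<^sub>R b + (r * t) *\<^sub>R c)) has_field_derivative
        D (x + s *\<^sub>R b + (r * t) *\<^sub>R c)) (at s within UNIV)"
      by (simp add: algebra_simps)
  next
    show "(\<lambda>r. G (x + s *\<^sub>R b + (r * t) *\<^sub>R c)) integrable_on cbox 0 1" for s
      by (intro integrable_continuous continuous_on_compose2[OF G]) (auto intro!: continuous_intros)
    show "continuous_on (UNIV \<times> cbox 0 1) (\<lambda>(s, r). D (x + s *\<^sub>R b + (r * t) *\<^sub>R c))"
      unfolding case_prod_unfold
      by (rule continuous_on_compose2[OF D]) (auto intro!: continuous_intros)
  qed auto
  then show ?thesis by simp
qed

lemma continuous_average:
  fixes G :: "'e::real_normed_vector \<Rightarrow> real"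
  assumes G: "continuous_on UNIV G"
  shows "continuous_on UNIV (\<lambda>x. integral {0..1} (\<lambda>r. G (x + (r * t) *\<^sub>R c)))"
proof -
  have "continuous_on (UNIV \<times> cbox 0 1) (\<lambda>(x, r). G (x + (r * t) *\<^sub>R c))"
    unfolding case_prod_unfold
    by (rule continuous_on_compose2[OF G]) (auto intro!: continuous_intros)
  then have "continuous_on UNIV (\<lambda>x. integral (cbox 0 1) (\<lambda>r. G (x + (r * t) *\<^sub>R c)))"
    by (rule integral_continuous_on_param)
  then show ?thesis by simp
qed

text \<open>The last three properties say, without a measure, that \<open>G p\<close> averages the
  values \<open>g (p + w)\<close> with weights independent of \<open>p\<close>; the last one
  transfers bounds on increments. In the induction, half of the radius goes to the old directions
  and half to the new one.\<close>

lemma mollify_directions: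
  fixes g :: "'e::real_normed_vector \<Rightarrow> real"
  assumes g: "continuous_on UNIV g" and "finite B" and "0 < \<tau>"
  shows "\<exists>G D. continuous_on UNIV G \<and>
    (\<forall>b\<in>B. continuous_on UNIV (D b) \<and> (\<forall>x. ((\<lambda>s. G (x + s *\<^sub>R b)) has_field_derivative D b x) (at 0))) \<and>
    (\<forall>p K. (\<forall>w. norm w \<le> \<tau> \<longrightarrow> g (p + w) \<le> K) \<longrightarrow> G p \<le> K) \<and>
    (\<forall>p K. (\<forall>w. norm w \<le> \<tau> \<longrightarrow> K \<le> g (p + w)) \<longrightarrow> K \<le> G p) \<and>
    (\<forall>p p' K. (\<forall>w. norm w \<le> \<tau> \<longrightarrow> g (p' + w) - g (p + w) \<le> K) \<longrightarrow> G p' - G p \<le> K)"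
  using assms(2,3)
proof (induction B arbitrary: \<tau> rule: finite_induct)
  case empty
  show ?case
  proof (intro exI[of _ g] exI conjI allI impI)
    show "g p \<le> K" if "\<forall>w. norm w \<le> \<tau> \<longrightarrow> g (p + w) \<le> K" for p K
      using that[rule_format, of 0] empty by simp
    show "K \<le> g p" if "\<forall>w. norm w \<le> \<tau> \<longrightarrow> K \<le> g (p + w)" for p K
      using that[rule_format, of 0] empty by simp
    show "g p' - g p \<le> K" if "\<forall>w. norm w \<le> \<tau> \<longrightarrow> g (p' + w) - g (p + w) \<le> K" for p p' K
      using that[rule_format, of 0] empty by simp
  qed (auto simp: g)
next
  case (insert c B)
  obtain G D where G: "continuous_on UNIV G"
    "\<And>b. b \<in> B \<Longrightarrow> continuous_on UNIV (D b)"
    "\<And>b x. b \<in> B \<Longrightarrow> ((\<lambda>s. G (x + s *\<^sub>R b)) has_field_derivative D b x) (at 0)"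
    and hull: "\<And>p K. (\<And>w. norm w \<le> \<tau> / 2 \<Longrightarrow> g (p + w) \<le> K) \<Longrightarrow> G p \<le> K"
    "\<And>p K. (\<And>w. norm w \<le> \<tau> / 2 \<Longrightarrow> K \<le> g (p + w)) \<Longrightarrow> K \<le> G p"
    "\<And>p p' K. (\<And>w. norm w \<le> \<tau> / 2 \<Longrightarrow> g (p' + w) - g (p + w) \<le> K) \<Longrightarrow> G p' - G p \<le> K"
    using insert.IH[of "\<tau> / 2"] insert.prems by (metis half_gt_zero)
  \<comment> \<open>The set of directions may contain \<open>0\<close>; adding \<open>1\<close>
    keeps the divisor positive.\<close>
  define m where "m = norm c + 1"
  define t where "t = \<tau> / 2 / m"
  have nc: "0 < m" "norm c \<le> m" unfolding m_def by (simp_all add: add_nonneg_pos)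
  have t: "0 < t" unfolding t_def using insert.prems nc by simp
  have tc: "norm ((r * t) *\<^sub>R c) \<le> \<tau> / 2" if "r \<in> {0..1}" for r
  proof -
    have "norm ((r * t) *\<^sub>R c) = r * (t * norm c)" using that t by simp
    also have "\<dots> \<le> 1 * (t * m)" using that t nc by (intro mult_mono) auto
    also have "\<dots> = \<tau> / 2" unfolding t_def using nc by simp
    finally show ?thesis .
  qed
  have tw: "norm ((r * t) *\<^sub>R c + w) \<le> \<tau>" if "r \<in> {0..1}" "norm w \<le> \<tau> / 2" for r w
    using norm_triangle_le[of "(r * t) *\<^sub>R c" w \<tau>] tc[OF that(1)] that(2) by simp
  define G' where "G' = (\<lambda>x. integral {0..1} (\<lambda>r. G (x + (r * t) *\<^sub>R c)))"
  define D' where "D' = (\<lambda>b x. if b = c then (G (x + t *\<^sub>R c) - G x) / t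
    else integral {0..1} (\<lambda>r. D b (x + (r * t) *\<^sub>R c)))"
  have int: "(\<lambda>r. G (x + (r * t) *\<^sub>R c)) integrable_on {0..1}" for x
    by (intro integrable_continuous_interval continuous_on_compose2[OF G(1)]) (auto intro!: continuous_intros)
  show ?case
  proof (intro exI[of _ G'] exI[of _ D'] conjI ballI allI impI)
    show "continuous_on UNIV G'" unfolding G'_def by (rule continuous_average[OF G(1)])
  next
    fix b assume "b \<in> insert c B"
    show "continuous_on UNIV (D' b)"
    proof (cases "b = c")
      case True
      show ?thesis unfolding D'_def using True t
        by (auto intro!: continuous_intros continuous_on_compose2[OF G(1)])
    next
      case False
      then show ?thesis unfolding D'_def
        using continuous_average[OF G(2)] \<open>b \<in> insert c B\<close> by simp
    qed
    fix x
    show "((\<lambda>s. G' (x + s *\<^sub>R b)) has_field_derivative D' b x) (at 0)"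
    proof (cases "b = c")
      case True
      then show ?thesis unfolding D'_def G'_def using average_along[OF G(1) t] by simp
    next
      case False
      then have b: "b \<in> B" using \<open>b \<in> insert c B\<close> by simp
      show ?thesis unfolding D'_def G'_def using False average_derivative[OF G(1) G(2)[OF b] G(3)[OF b]] by simp
    qed
  next
    fix p K assume *: "\<forall>w. norm w \<le> \<tau> \<longrightarrow> g (p + w) \<le> K"
    have "G' p \<le> integral {0..1::real} (\<lambda>r. K)" unfolding G'_def
    proof (rule integral_le[OF int])
      fix r :: real assume r: "r \<in> {0..1}"
      show "G (p + (r * t) *\<^sub>R c) \<le> K"
        by (rule hull) (use * tw[OF r] in \<open>simp add: add.assoc\<close>)
    qed (rule integrable_const_ivl)
    then show "G' p \<le> K" by simp
  next
    fix p K assume *: "\<forall>w. norm w \<le> \<tau> \<longrightarrow> K \<le> g (p + w)"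
    have "integral {0..1::real} (\<lambda>r. K) \<le> G' p" unfolding G'_def
    proof (rule integral_le[OF _ int])
      fix r :: real assume r: "r \<in> {0..1}"
      show "K \<le> G (p + (r * t) *\<^sub>R c)"
        by (rule hull) (use * tw[OF r] in \<open>simp add: add.assoc\<close>)
    qed (rule integrable_const_ivl)
    then show "K \<le> G' p" by simp
  next
    fix p p' K assume *: "\<forall>w. norm w \<le> \<tau> \<longrightarrow> g (p' + w) - g (p + w) \<le> K"
    have "G' p' - G' p = integral {0..1} (\<lambda>r. G (p' + (r * t) *\<^sub>R c) - G (p + (r * t) *\<^sub>R c))"
      unfolding G'_def by (simp add: integral_diff[OF int int])
    also have "\<dots> \<le> integral {0..1::real} (\<lambda>r. K)"
    proof (rule integral_le[OF integrable_diff[OF int int]])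
      fix r :: real assume r: "r \<in> {0..1}"
      show "G (p' + (r * t) *\<^sub>R c) - G (p + (r * t) *\<^sub>R c) \<le> K"
        by (rule hull) (use * tw[OF r] in \<open>simp add: add.assoc\<close>)
    qed (rule integrable_const_ivl)
    finally show "G' p' - G' p \<le> K" by simp
  qed
qed

lemma mollify:
  fixes g :: "'e::real_normed_vector \<Rightarrow> real"
  assumes fin: "\<exists>B::'e set. finite B \<and> span B = UNIV"
    and g: "continuous_on UNIV g" and "0 < \<tau>"
  obtains G where "Ck_on 1 G UNIV"
    "\<And>p K. (\<And>w. norm w \<le> \<tau> \<Longrightarrow> g (p + w) \<le> K) \<Longrightarrow> G p \<le> K"
    "\<And>p K. (\<And>w. norm w \<le> \<tau> \<Longrightarrow> K \<le> g (p + w)) \<Longrightarrow> K \<le> G p"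
    "\<And>p p' K. (\<And>w. norm w \<le> \<tau> \<Longrightarrow> g (p' + w) - g (p + w) \<le> K) \<Longrightarrow> G p' - G p \<le> K"
proof -
  obtain B :: "'e set" where B: "finite B" "independent B" "span B = UNIV"
    using fin by (rule finite_spanning_basis)
  obtain G D where G: "\<And>b. b \<in> B \<Longrightarrow> continuous_on UNIV (D b)"
    "\<And>b x. b \<in> B \<Longrightarrow> ((\<lambda>s. G (x + s *\<^sub>R b)) has_field_derivative D b x) (at 0)"
    "\<And>p K. (\<And>w. norm w \<le> \<tau> \<Longrightarrow> g (p + w) \<le> K) \<Longrightarrow> G p \<le> K"
    "\<And>p K. (\<And>w. norm w \<le> \<tau> \<Longrightarrow> K \<le> g (p + w)) \<Longrightarrow> K \<le> G p"
    "\<And>p p' K. (\<And>w. norm w \<le> \<tau> \<Longrightarrow> g (p' + w) - g (p + w) \<le> K) \<Longrightarrow> G p' - G p \<le> K"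
    using mollify_directions[OF g B(1) \<open>0 < \<tau>\<close>] by metis
  show ?thesis using that[OF Ck_on_1_partials[OF B G(2,1)] G(3-5)] by blast
qed

text \<open>Smooth bumps come from mollifying a truncated cone; no smoothness of the norm is needed.\<close>

lemma bump_function:
  fixes p :: "'e::real_normed_vector"
  assumes fin: "\<exists>B::'e set. finite B \<and> span B = UNIV" and r: "r1 < r2"
  obtains e M where "Ck_on 1 e UNIV" "\<And>q. 0 \<le> e q \<and> e q \<le> (1::real)"
    "\<And>q. q \<in> cball p r1 \<Longrightarrow> e q = 1" "\<And>q. q \<notin> cball p r2 \<Longrightarrow> e q = 0"
    "\<And>q q'. \<bar>e q' - e q\<bar> \<le> M * norm (q' - q)" "0 \<le> M"
proof -
  \<comment> \<open>One third of the gap is for the descent of the cone, and one third on each side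
    for the averaging radius.\<close>
  define \<tau> where "\<tau> = (r2 - r1) / 3"
  have \<tau>: "0 < \<tau>" "r1 + 3 * \<tau> = r2" unfolding \<tau>_def using r by (auto simp: field_simps)
  define g where "g q = max 0 (min 1 ((r2 - \<tau> - dist p q) / \<tau>))" for q
  have "continuous_on UNIV g" unfolding g_def by (intro continuous_intros) (use \<tau> in auto)
  then obtain G where G: "Ck_on 1 G UNIV"
    "\<And>p K. (\<And>w. norm w \<le> \<tau> \<Longrightarrow> g (p + w) \<le> K) \<Longrightarrow> G p \<le> K"
    "\<And>p K. (\<And>w. norm w \<le> \<tau> \<Longrightarrow> K \<le> g (p + w)) \<Longrightarrow> K \<le> G p"
    "\<And>p p' K. (\<And>w. norm w \<le> \<tau> \<Longrightarrow> g (p' + w) - g (p + w) \<le> K) \<Longrightarrow> G p' - G p \<le> K"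
    using mollify[OF fin _ \<tau>(1)] by metis
  have g01: "0 \<le> g q" "g q \<le> 1" for q unfolding g_def by auto
  have G01: "0 \<le> G q \<and> G q \<le> 1" for q using G(2)[of q 1] G(3)[of 0 q] g01 by simp
  have near: "dist p (q + w) \<le> dist p q + \<tau>" "dist p q - \<tau> \<le> dist p (q + w)" if "norm w \<le> \<tau>" for q w
    using that dist_triangle[of p "q + w" q] dist_triangle[of p q "q + w"] by (auto simp: dist_norm)
  have g1: "1 \<le> g (q + w)" if "q \<in> cball p r1" "norm w \<le> \<tau>" for q w
    using near(1)[OF that(2), of q] that(1) \<tau> unfolding g_def by (auto simp: le_max_iff_disj pos_le_divide_eq)
  have g0: "g (q + w) \<le> 0" if "q \<notin> cball p r2" "norm w \<le> \<tau>" for q w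
    using near(2)[OF that(2), of q] that(1) \<tau> unfolding g_def by (auto simp: min_le_iff_disj divide_le_0_iff)
  have lip: "g (q' + w) - g (q + w) \<le> 1 / \<tau> * norm (q' - q)" for q q' w
  proof -
    have "dist p (q + w) \<le> dist p (q' + w) + norm (q' - q)"
      using dist_triangle[of p "q + w" "q' + w"] by (simp add: dist_norm norm_minus_commute)
    then have "(r2 - \<tau> - dist p (q' + w)) / \<tau> \<le> (r2 - \<tau> - dist p (q + w) + norm (q' - q)) / \<tau>"
      using \<tau>(1) by (intro divide_right_mono) auto
    moreover have "0 \<le> norm (q' - q) / \<tau>" using \<tau>(1) by simp
    ultimately show ?thesis unfolding g_def by (simp add: add_divide_distrib max_def min_def)
  qed
  have "\<bar>G q' - G q\<bar> \<le> 1 / \<tau> * norm (q' - q)" for q q'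
    using G(4)[OF lip, of q' q] G(4)[OF lip, of q q'] by (simp add: abs_le_iff norm_minus_commute)
  moreover have "G q = 1" if "q \<in> cball p r1" for q
    using G(3)[of 1 q] g1[OF that] G01[of q] by force
  moreover have "G q = 0" if "q \<notin> cball p r2" for q
    using G(2)[of q 0] g0[OF that] G01[of q] by force
  ultimately show ?thesis using that[OF G(1) G01] \<tau>(1) by (metis less_imp_le zero_less_divide_1_iff)
qed


section \<open>Finsler structures in charts\<close>

text \<open>Positivity comes from definiteness of the Hessian: at a zero \<open>v \<noteq> 0\<close>
  the nonnegative \<open>N\<close> has a minimum, so its derivative vanishes there, and the second
  derivative of the square, \<open>2 N N'' + 2 (N')^2\<close>, would vanish as well.\<close>

lemma minkowski_norm_pos:
  fixes N :: "'e::real_normed_vector \<Rightarrow> real"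
  assumes N: "minkowski_norm N" and v: "v \<noteq> 0"
  shows "0 < N v"
proof (rule ccontr)
  assume "\<not> 0 < N v"
  then have Nv: "N v = 0" using N unfolding minkowski_norm_def by (metis less_eq_real_def)
  have "Ck_on (Suc (Suc 0)) N (- {0})" using N unfolding minkowski_norm_def smooth_on_def by blast
  then have diff: "\<And>z. z \<noteq> 0 \<Longrightarrow> N differentiable (at z)"
    "\<And>z. z \<noteq> 0 \<Longrightarrow> (\<lambda>x. frechet_derivative N (at x) v) differentiable (at z)" by auto
  define D where "D z = frechet_derivative N (at z)" for z
  have D: "(N has_derivative D z) (at z)" if "z \<noteq> 0" for z
    using diff(1)[OF that] unfolding D_def by (simp add: frechet_derivative_works)
  have "D v = (\<lambda>h. 0)"
    by (rule has_derivative_local_min[OF D[OF v]]) (use N Nv in \<open>simp add: minkowski_norm_def\<close>)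
  obtain D2 where D2: "((\<lambda>z. D z v) has_derivative D2) (at v)"
    using diff(2)[OF v] unfolding D_def differentiable_def by blast
  have sq: "frechet_derivative (\<lambda>y. (N y)\<^sup>2) (at z) v = 2 * N z * D z v" if "z \<noteq> 0" for z
  proof -
    have "((\<lambda>y. (N y)\<^sup>2) has_derivative (\<lambda>h. 2 * N z * D z h)) (at z)"
      using D[OF that] by (auto intro!: derivative_eq_intros)
    then show ?thesis by (metis frechet_derivative_at)
  qed
  have "((\<lambda>z. 2 * N z * D z v) has_derivative (\<lambda>h. 2 * N v * D2 h + 2 * D v h * D v v)) (at v)"
    using D[OF v] D2 by (auto intro!: derivative_eq_intros)
  then have "((\<lambda>z. 2 * N z * D z v) has_derivative (\<lambda>h. 0)) (at v)"
    using Nv \<open>D v = (\<lambda>h. 0)\<close> by simp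
  moreover have "open (- {0::'e})" "v \<in> - {0}" using v by auto
  ultimately have "((\<lambda>z. frechet_derivative (\<lambda>y. (N y)\<^sup>2) (at z) v) has_derivative (\<lambda>h. 0)) (at v)"
    by (rule has_derivative_transform_within_open) (use sq in auto)
  then have "frechet_derivative (\<lambda>z. frechet_derivative (\<lambda>y. (N y)\<^sup>2) (at z) v) (at v) v = 0"
    by (metis frechet_derivative_at)
  then show False using N v unfolding minkowski_norm_def by fastforce
qed

locale finsler =
  fixes A :: "('a::{t2_space, second_countable_topology}, 'e::real_normed_vector) chart set"
    and F :: "'a \<Rightarrow> ('a, 'e) tangent \<Rightarrow> real"
  assumes finsler_manifold: "finsler_manifold A F"
    and connected_UNIV: "connected (UNIV :: 'a set)"
begin

abbreviation d :: "'a \<Rightarrow> 'a \<Rightarrow> real" where "d \<equiv> finsler_dist A F"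

abbreviation Fc :: "('a, 'e) chart \<Rightarrow> 'e \<times> 'e \<Rightarrow> real" where "Fc \<equiv> local_rep A F"

lemma atlas: "smooth_atlas A"
  using finsler_manifold unfolding finsler_manifold_def by blast

lemma finite_dimensional: "\<exists>B::'e set. finite B \<and> span B = UNIV"
  using atlas unfolding smooth_atlas_def by blast

lemma chart_at: obtains c where "c \<in> A" "x \<in> fst c"
  using atlas unfolding smooth_atlas_def by blast

lemma
  assumes "c \<in> A"
  shows open_chart: "open (fst c)"
    and open_chart_image: "open (snd c ` fst c)"
    and continuous_on_chart: "continuous_on (fst c) (snd c)"
    and continuous_on_chart_inv: "continuous_on (snd c ` fst c) (chart_inv c)"
    and chart_inv_chart: "x \<in> fst c \<Longrightarrow> chart_inv c (snd c x) = x"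
    and chart_inv_in: "p \<in> snd c ` fst c \<Longrightarrow> chart_inv c p \<in> fst c"
    and chart_chart_inv: "p \<in> snd c ` fst c \<Longrightarrow> snd c (chart_inv c p) = p"
  using atlas assms unfolding smooth_atlas_def homeomorphism_def by auto

lemma open_chart_preimage:
  assumes "c \<in> A" "open S" shows "open {x \<in> fst c. snd c x \<in> S}"
proof -
  have "open (fst c \<inter> snd c -` S)"
    using continuous_on_chart[OF assms(1)] open_chart[OF assms(1)] assms(2) by (rule continuous_open_preimage)
  moreover have "fst c \<inter> snd c -` S = {x \<in> fst c. snd c x \<in> S}" by auto
  ultimately show ?thesis by simp
qed

lemma open_chart_image_Int:
  assumes "c \<in> A" "open N" shows "open (snd c ` (fst c \<inter> N))"
proof -
  have "open (snd c ` fst c \<inter> chart_inv c -` N)"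
    using continuous_on_chart_inv[OF assms(1)] open_chart_image[OF assms(1)] assms(2)
    by (rule continuous_open_preimage)
  moreover have "snd c ` fst c \<inter> chart_inv c -` N = snd c ` (fst c \<inter> N)"
    using chart_inv_chart[OF assms(1)] by force
  ultimately show ?thesis by simp
qed

lemma Ck_on_transition:
  assumes "c \<in> A" "c' \<in> A"
  shows "Ck_on 1 (snd c' \<circ> chart_inv c) (snd c ` (fst c \<inter> fst c'))"
  using smooth_atlasD(5)[OF atlas assms] unfolding smooth_on_def by blast

lemma has_derivative_transition:
  assumes "c \<in> A" "c' \<in> A" "x \<in> fst c" "x \<in> fst c'"
  shows "(snd c' \<circ> chart_inv c has_derivative coord_change c c' x) (at (snd c x))"
  using Ck_on_transition[OF assms(1,2)] assms(3,4)
  unfolding Ck_on_1_unfold coord_change_def frechet_derivative_works by blast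

lemma continuous_on_coord_change:
  assumes "c \<in> A" "c' \<in> A"
  shows "continuous_on (snd c ` (fst c \<inter> fst c')) (\<lambda>p. coord_change c c' (chart_inv c p) w)"
proof -
  have "continuous_on (snd c ` (fst c \<inter> fst c')) (\<lambda>p. frechet_derivative (snd c' \<circ> chart_inv c) (at p) w)"
    using Ck_on_transition[OF assms] unfolding Ck_on_1_unfold by blast
  then show ?thesis
    by (rule continuous_on_eq) (auto simp: coord_change_def chart_inv_chart[OF assms(1)])
qed

lemma continuous_on_Fc: "c \<in> A \<Longrightarrow> continuous_on (snd c ` fst c \<times> UNIV) (Fc c)"
  using finsler_manifold unfolding finsler_manifold_def by blast

lemma minkowski_norm_Fc:
  assumes "c \<in> A" "p \<in> snd c ` fst c" shows "minkowski_norm (\<lambda>w. Fc c (p, w))"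
  using finsler_manifold assms(1) chart_inv_in[OF assms] unfolding finsler_manifold_def local_rep_def by simp

lemma Fc_nonneg: "c \<in> A \<Longrightarrow> p \<in> snd c ` fst c \<Longrightarrow> 0 \<le> Fc c (p, w)"
  using minkowski_norm_Fc unfolding minkowski_norm_def by blast

lemma Fc_scale: "c \<in> A \<Longrightarrow> p \<in> snd c ` fst c \<Longrightarrow> 0 \<le> l \<Longrightarrow> Fc c (p, l *\<^sub>R w) = l * Fc c (p, w)"
  using minkowski_norm_Fc unfolding minkowski_norm_def by blast

lemma Fc_pos: "c \<in> A \<Longrightarrow> p \<in> snd c ` fst c \<Longrightarrow> w \<noteq> 0 \<Longrightarrow> 0 < Fc c (p, w)"
  using minkowski_norm_pos[OF minkowski_norm_Fc] .

lemma Fc_zero: "c \<in> A \<Longrightarrow> p \<in> snd c ` fst c \<Longrightarrow> Fc c (p, 0) = 0"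
  using Fc_scale[of c p 0 0] by simp

text \<open>Reduces estimates to unit vectors, where compactness is available.\<close>

lemma Fc_normalize:
  assumes "c \<in> A" "p \<in> snd c ` fst c" "w \<noteq> 0"
  shows "Fc c (p, w) = norm w * Fc c (p, inverse (norm w) *\<^sub>R w)"
  using Fc_scale[OF assms(1,2), of "norm w" "inverse (norm w) *\<^sub>R w"] assms(3) by simp

lemma compact_unit_vectors: "compact (cball (p0::'e) R \<times> {v::'e. norm v = 1})"
  using finite_dimensional compact_cball_finite_span compact_sphere_finite_span compact_Times by metis

lemma continuous_on_unit_vectors:
  assumes "c \<in> A" "cball p0 R \<subseteq> snd c ` fst c"
  shows "continuous_on (cball p0 R \<times> {v. norm v = 1}) (Fc c)"
  by (rule continuous_on_subset[OF continuous_on_Fc[OF assms(1)]]) (use assms(2) in auto)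

text \<open>\<open>Fc c\<close> is positive and continuous on the compact set of unit vectors over
  the ball, and its minimum is the constant. It converts bounds in the model norm into bounds in the
  Finsler norm.\<close>

lemma Fc_lower:
  assumes c: "c \<in> A" and sub: "cball p0 R \<subseteq> snd c ` fst c"
  obtains m where "0 < m" "\<And>p w. p \<in> cball p0 R \<Longrightarrow> m * norm w \<le> Fc c (p, w)"
proof -
  let ?S = "cball p0 R \<times> {v::'e. norm v = 1}"
  have "\<exists>m>0. \<forall>z\<in>?S. m \<le> Fc c z"
  \<comment> \<open>The set is empty when the model space has dimension zero or the radius is
    negative; any positive \<open>m\<close> then works.\<close>
  proof (cases "?S = {}")
    case False
    from continuous_attains_inf[OF compact_unit_vectors this continuous_on_unit_vectors[OF c sub]]
    obtain z where z: "z \<in> ?S" "\<forall>y\<in>?S. Fc c z \<le> Fc c y" by blast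
    have "0 < Fc c (fst z, snd z)" by (rule Fc_pos[OF c]) (use z(1) sub in auto)
    then show ?thesis using z(2) by auto
  qed (auto intro: zero_less_one)
  then obtain m where m: "0 < m" "\<forall>z\<in>?S. m \<le> Fc c z" by blast
  have "m * norm w \<le> Fc c (p, w)" if p: "p \<in> cball p0 R" for p w
  proof (cases "w = 0")
    case True
    then show ?thesis using Fc_zero[OF c, of p] p sub by auto
  next
    case False
    have "(p, inverse (norm w) *\<^sub>R w) \<in> ?S" using p False by simp
    then have "norm w * m \<le> norm w * Fc c (p, inverse (norm w) *\<^sub>R w)"
      using m(2) by (intro mult_left_mono) auto
    then show ?thesis using Fc_normalize[OF c _ False, of p] p sub by (auto simp: mult.commute)
  qed
  then show ?thesis using that m(1) by blast
qed

text \<open>Uniform continuity over the compact set of unit vectors compares the norms at nearby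
  base points; by homogeneity the error is proportional to \<open>norm w\<close>.\<close>

lemma Fc_uniform:
  assumes c: "c \<in> A" and sub: "cball p0 R \<subseteq> snd c ` fst c" and "0 < e"
  obtains t where "0 < t" "\<And>p p' w. p \<in> cball p0 R \<Longrightarrow> p' \<in> cball p0 R \<Longrightarrow> dist p p' \<le> t \<Longrightarrow>
    Fc c (p', w) \<le> Fc c (p, w) + e * norm w"
proof -
  let ?S = "cball p0 R \<times> {v::'e. norm v = 1}"
  have "uniformly_continuous_on ?S (Fc c)"
    by (rule compact_uniformly_continuous[OF continuous_on_unit_vectors[OF c sub] compact_unit_vectors])
  then obtain t where t: "0 < t" "\<And>z z'. z \<in> ?S \<Longrightarrow> z' \<in> ?S \<Longrightarrow> dist z' z < t \<Longrightarrow> dist (Fc c z') (Fc c z) < e"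
    unfolding uniformly_continuous_on_def using \<open>0 < e\<close> by metis
  have "Fc c (p', w) \<le> Fc c (p, w) + e * norm w"
    if p: "p \<in> cball p0 R" "p' \<in> cball p0 R" "dist p p' \<le> t / 2" for p p' w
  proof (cases "w = 0")
    case True
    moreover have "p \<in> snd c ` fst c" "p' \<in> snd c ` fst c" using p sub by blast+
    ultimately show ?thesis by (simp add: Fc_zero[OF c])
  next
    case False
    let ?w = "inverse (norm w) *\<^sub>R w"
    have "dist (p', ?w) (p, ?w) < t" using p(3) t(1) by (simp add: dist_Pair_Pair dist_commute)
    then have "dist (Fc c (p', ?w)) (Fc c (p, ?w)) < e" using p False by (intro t(2)) auto
    then have "Fc c (p', ?w) \<le> Fc c (p, ?w) + e" by (simp add: dist_real_def)
    then have "norm w * Fc c (p', ?w) \<le> norm w * (Fc c (p, ?w) + e)" by (intro mult_left_mono) auto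
    moreover have "p \<in> snd c ` fst c" "p' \<in> snd c ` fst c" using p sub by blast+
    ultimately show ?thesis using Fc_normalize[OF c _ False, of p] Fc_normalize[OF c _ False, of p']
      by (simp add: algebra_simps)
  qed
  then show ?thesis using that[of "t / 2"] t(1) by auto
qed

lemma Fc_upper:
  assumes c: "c \<in> A" and sub: "cball p0 R \<subseteq> snd c ` fst c"
  obtains K where "0 < K" "\<And>p w. p \<in> cball p0 R \<Longrightarrow> Fc c (p, w) \<le> K * norm w"
proof -
  let ?S = "cball p0 R \<times> {v::'e. norm v = 1}"
  have "bounded (Fc c ` ?S)"
    by (intro compact_imp_bounded compact_continuous_image continuous_on_unit_vectors[OF c sub] compact_unit_vectors)
  then obtain K where K: "0 < K" "\<And>z. z \<in> ?S \<Longrightarrow> \<bar>Fc c z\<bar> \<le> K"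
    unfolding bounded_pos by auto
  have "Fc c (p, w) \<le> K * norm w" if p: "p \<in> cball p0 R" for p w
  proof (cases "w = 0")
    case True
    then show ?thesis using Fc_zero[OF c, of p] p sub by auto
  next
    case False
    have "Fc c (p, inverse (norm w) *\<^sub>R w) \<le> K"
      using K(2)[of "(p, inverse (norm w) *\<^sub>R w)"] p False by simp
    then have "norm w * Fc c (p, inverse (norm w) *\<^sub>R w) \<le> norm w * K"
      by (intro mult_left_mono) auto
    then show ?thesis using Fc_normalize[OF c _ False, of p] p sub by (auto simp: mult.commute)
  qed
  then show ?thesis using that K(1) by blast
qed


section \<open>Paths and their lengths\<close>

text \<open>The interval \<open>S\<close> remains a parameter because at its end points the velocity
  is a one-sided derivative.\<close>

definition speed :: "real set \<Rightarrow> (real \<Rightarrow> 'a) \<Rightarrow> real \<Rightarrow> real" where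
  "speed S \<sigma> t = F (\<sigma> t) (velocity A S \<sigma> t)"

lemma eventually_in_chart:
  assumes "continuous_on S \<sigma>" "t \<in> S" "open U" "\<sigma> t \<in> U"
  obtains r where "0 < r" "\<And>s. s \<in> S \<Longrightarrow> dist s t < r \<Longrightarrow> \<sigma> s \<in> U"
proof -
  have "(\<sigma> \<longlongrightarrow> \<sigma> t) (at t within S)" using assms(1,2) by (simp add: continuous_on_def)
  then have "\<forall>\<^sub>F s in at t within S. \<sigma> s \<in> U" using assms(3,4) by (rule topological_tendstoD)
  then obtain r where "0 < r" "\<And>s. s \<in> S \<Longrightarrow> s \<noteq> t \<Longrightarrow> dist s t < r \<Longrightarrow> \<sigma> s \<in> U"
    unfolding eventually_at by blast
  then show ?thesis using that assms(4) by metis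
qed

lemma C1_pathD:
  assumes "C1_path_on A {a..b} \<sigma>" "t \<in> {a..b}" "c \<in> A" "\<sigma> t \<in> fst c"
  shows "(snd c \<circ> \<sigma> has_vector_derivative velocity A {a..b} \<sigma> t c) (at t within {a..b})"
  using assms unfolding C1_path_on_def velocity_def
  by (auto simp: vector_derivative_works differentiable_def)

lemma velocity_eq:
  assumes "a < b" "t \<in> {a..b}" "c \<in> A" "\<sigma> t \<in> fst c"
    and "(snd c \<circ> \<sigma> has_vector_derivative w) (at t within {a..b})"
  shows "velocity A {a..b} \<sigma> t c = w"
  using vector_derivative_within_cbox[of a b t "snd c \<circ> \<sigma>" w] assms unfolding velocity_def by simp

text \<open>By the chain rule for the transition maps, the coordinate vectors of the velocity
  transform like a tangent vector. One chart determines it, and the speed can be computed in any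
  chart around the point.\<close>

lemma velocity_tangent:
  assumes \<sigma>: "C1_path_on A {a..b} \<sigma>" and ab: "a < b" and t: "t \<in> {a..b}" and c: "c \<in> A" "\<sigma> t \<in> fst c"
  shows "velocity A {a..b} \<sigma> t = tangent_of A c (\<sigma> t) (velocity A {a..b} \<sigma> t c)"
proof
  fix c'
  show "velocity A {a..b} \<sigma> t c' = tangent_of A c (\<sigma> t) (velocity A {a..b} \<sigma> t c) c'"
  proof (cases "c' \<in> A \<and> \<sigma> t \<in> fst c'")
    case True
    have cont: "continuous_on {a..b} \<sigma>" using \<sigma> unfolding C1_path_on_def by blast
    obtain r where r: "0 < r" "\<And>s. s \<in> {a..b} \<Longrightarrow> dist s t < r \<Longrightarrow> \<sigma> s \<in> fst c"
      using eventually_in_chart[OF cont t open_chart[OF c(1)] c(2)] by blast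
    let ?g = "snd c' \<circ> chart_inv c"
    have "(?g has_derivative coord_change c c' (\<sigma> t)) (at ((snd c \<circ> \<sigma>) t) within (snd c \<circ> \<sigma>) ` {a..b})"
      using has_derivative_transition[OF c(1) _ c(2), of c'] True by (simp add: has_derivative_at_withinI)
    with C1_pathD[OF \<sigma> t c]
    have "((?g \<circ> (snd c \<circ> \<sigma>)) has_vector_derivative coord_change c c' (\<sigma> t) (velocity A {a..b} \<sigma> t c))
      (at t within {a..b})"
      by (rule vector_derivative_diff_chain_within)
    then have "(snd c' \<circ> \<sigma> has_vector_derivative coord_change c c' (\<sigma> t) (velocity A {a..b} \<sigma> t c))
      (at t within {a..b})"
      using r(1) t
      by (rule has_vector_derivative_transform_within) (use r(2) chart_inv_chart[OF c(1)] in auto)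
    then have "velocity A {a..b} \<sigma> t c' = coord_change c c' (\<sigma> t) (velocity A {a..b} \<sigma> t c)"
      using True by (intro velocity_eq[OF ab t]) auto
    then show ?thesis using True by (simp add: tangent_of_def)
  qed (auto simp: velocity_def tangent_of_def)
qed

lemma speed_eq:
  assumes "C1_path_on A {a..b} \<sigma>" "a < b" "t \<in> {a..b}" "c \<in> A" "\<sigma> t \<in> fst c"
  shows "speed {a..b} \<sigma> t = Fc c (snd c (\<sigma> t), velocity A {a..b} \<sigma> t c)"
  using velocity_tangent[OF assms] chart_inv_chart[OF assms(4,5)] unfolding speed_def local_rep_def by simp

lemma speed_nonneg:
  assumes "C1_path_on A {a..b} \<sigma>" "a < b" "t \<in> {a..b}"
  shows "0 \<le> speed {a..b} \<sigma> t"
proof -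
  obtain c where "c \<in> A" "\<sigma> t \<in> fst c" by (rule chart_at)
  then show ?thesis using speed_eq[OF assms] Fc_nonneg by simp
qed

lemma speed_continuous:
  assumes \<sigma>: "C1_path_on A {a..b} \<sigma>" and ab: "a < b"
  shows "continuous_on {a..b} (speed {a..b} \<sigma>)"
  unfolding continuous_on_eq_continuous_within
proof
  fix t assume t: "t \<in> {a..b}"
  obtain c where c: "c \<in> A" "\<sigma> t \<in> fst c" by (rule chart_at)
  have cont: "continuous_on {a..b} \<sigma>" using \<sigma> unfolding C1_path_on_def by blast
  obtain r where r: "0 < r" "\<And>s. s \<in> {a..b} \<Longrightarrow> dist s t < r \<Longrightarrow> \<sigma> s \<in> fst c"
    using eventually_in_chart[OF cont t open_chart[OF c(1)] c(2)] by blast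
  let ?T = "{a..b} \<inter> \<sigma> -` fst c"
  have "continuous_on ?T (\<lambda>t. Fc c (snd c (\<sigma> t), velocity A {a..b} \<sigma> t c))"
  proof (rule continuous_on_compose2[OF continuous_on_Fc[OF c(1)]])
    have "continuous_on ?T (\<lambda>t. snd c (\<sigma> t))"
      by (rule continuous_on_compose2[OF continuous_on_chart[OF c(1)]])
        (auto intro: continuous_on_subset[OF cont])
    then show "continuous_on ?T (\<lambda>t. (snd c (\<sigma> t), velocity A {a..b} \<sigma> t c))"
      using \<sigma> c(1) unfolding C1_path_on_def by (intro continuous_on_Pair) auto
  qed auto
  then have "continuous_on ?T (speed {a..b} \<sigma>)"
    by (rule continuous_on_eq) (use speed_eq[OF \<sigma> ab _ c(1)] in auto)
  then have "continuous (at t within ?T) (speed {a..b} \<sigma>)"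
    using t c by (simp add: continuous_on_eq_continuous_within)
  \<comment> \<open>Near \<open>t\<close> the path stays in the chart domain, so restricting to its
    preimage does not change the filter.\<close>
  moreover have "at t within ?T = at t within {a..b}"
    by (rule at_within_nhd[where S = "ball t r"]) (use r in \<open>auto simp: dist_commute\<close>)
  ultimately show "continuous (at t within {a..b}) (speed {a..b} \<sigma>)" by simp
qed

text \<open>Agreement is required only on the interval. Thus the case \<open>k = 0\<close> replaces
  a path by another one that coincides with it there, as happens when paths are glued.\<close>

lemma C1_path_shift:
  assumes \<sigma>: "C1_path_on A {a..b} \<sigma>" and ab: "a < b" and \<rho>: "\<And>t. t \<in> {a+k..b+k} \<Longrightarrow> \<rho> t = \<sigma> (t - k)"
  shows "C1_path_on A {a+k..b+k} \<rho>"
    "\<And>t. t \<in> {a+k..b+k} \<Longrightarrow> velocity A {a+k..b+k} \<rho> t = velocity A {a..b} \<sigma> (t - k)"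
proof -
  have img: "(\<lambda>t. t - k) ` {a+k..b+k} = {a..b}"
    by (auto simp: image_iff intro!: bexI[where x = "x + k" for x])
  have D: "(snd c \<circ> \<rho> has_vector_derivative velocity A {a..b} \<sigma> (t - k) c) (at t within {a+k..b+k})"
    if "t \<in> {a+k..b+k}" "c \<in> A" "\<rho> t \<in> fst c" for t c
  proof -
    have "((\<lambda>t. t - k) has_vector_derivative 1) (at t within {a+k..b+k})"
      by (auto intro!: derivative_eq_intros)
    then have "((snd c \<circ> \<sigma>) \<circ> (\<lambda>t. t - k) has_vector_derivative 1 *\<^sub>R velocity A {a..b} \<sigma> (t - k) c) (at t within {a+k..b+k})"
      by (rule vector_diff_chain_within) (unfold img, rule C1_pathD[OF \<sigma>], use that \<rho>[OF that(1)] in auto)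
    then have "((snd c \<circ> \<sigma>) \<circ> (\<lambda>t. t - k) has_vector_derivative velocity A {a..b} \<sigma> (t - k) c) (at t within {a+k..b+k})"
      by simp
    then show ?thesis using zero_less_one that(1)
      by (rule has_vector_derivative_transform_within) (simp add: \<rho>)
  qed
  show eq: "velocity A {a+k..b+k} \<rho> t = velocity A {a..b} \<sigma> (t - k)" if t: "t \<in> {a+k..b+k}" for t
  proof
    fix c
    show "velocity A {a+k..b+k} \<rho> t c = velocity A {a..b} \<sigma> (t - k) c"
    proof (cases "c \<in> A \<and> \<rho> t \<in> fst c")
      case True
      then show ?thesis using velocity_eq[OF _ t _ _ D[OF t]] ab by auto
    next
      case False
      then show ?thesis using \<rho>[OF t] by (auto simp: velocity_def)
    qed
  qed
  show "C1_path_on A {a+k..b+k} \<rho>" unfolding C1_path_on_def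
  proof (intro conjI ballI)
    have "continuous_on {a+k..b+k} (\<lambda>t. \<sigma> (t - k))"
      by (rule continuous_on_compose2[where t = "{a..b}"])
        (use \<sigma> in \<open>auto simp: C1_path_on_def intro!: continuous_intros\<close>)
    then show "continuous_on {a+k..b+k} \<rho>" by (rule continuous_on_eq) (simp add: \<rho>)
    fix c assume c: "c \<in> A"
    show "(snd c \<circ> \<rho>) differentiable (at t within {a+k..b+k})" if "t \<in> {a+k..b+k} \<inter> \<rho> -` fst c" for t
      using D[of t c] that c by (auto intro: differentiableI_vector)
    have "continuous_on ({a+k..b+k} \<inter> \<rho> -` fst c) (\<lambda>t. velocity A {a..b} \<sigma> (t - k) c)"
      by (rule continuous_on_compose2[where t = "{a..b} \<inter> \<sigma> -` fst c" and g = "\<lambda>t. velocity A {a..b} \<sigma> t c"])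
        (use \<sigma> c in \<open>auto simp: C1_path_on_def \<rho> intro!: continuous_intros\<close>)
    then show "continuous_on ({a+k..b+k} \<inter> \<rho> -` fst c) (\<lambda>t. velocity A {a+k..b+k} \<rho> t c)"
      by (rule continuous_on_eq) (use eq in auto)
  qed
qed

section \<open>Piecewise paths as chains of pieces\<close>

definition polypath :: "nat \<Rightarrow> (nat \<Rightarrow> real) \<Rightarrow> (real \<Rightarrow> 'a) \<Rightarrow> bool" where
  "polypath n s \<sigma> \<longleftrightarrow> (\<forall>i<n. s i < s (Suc i) \<and> C1_path_on A {s i..s (Suc i)} \<sigma>)"

definition poly_length :: "nat \<Rightarrow> (nat \<Rightarrow> real) \<Rightarrow> (real \<Rightarrow> 'a) \<Rightarrow> real" where
  "poly_length n s \<sigma> = (\<Sum>i<n. integral {s i..s (Suc i)} (speed {s i..s (Suc i)} \<sigma>))"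

text \<open>A piecewise path reduced to its end points and its length. Every piece keeps its own
  parameter interval, so concatenation needs no reparametrization and estimates follow by induction
  on the pieces.\<close>

inductive chain :: "'a \<Rightarrow> 'a \<Rightarrow> real \<Rightarrow> bool" where
  chain_single: "a < b \<Longrightarrow> C1_path_on A {a..b} \<sigma> \<Longrightarrow> \<sigma> a = x \<Longrightarrow> \<sigma> b = y \<Longrightarrow>
     chain x y (integral {a..b} (speed {a..b} \<sigma>))"
| chain_step: "chain x y l \<Longrightarrow> a < b \<Longrightarrow> C1_path_on A {a..b} \<sigma> \<Longrightarrow> \<sigma> a = y \<Longrightarrow> \<sigma> b = z \<Longrightarrow>
     chain x z (l + integral {a..b} (speed {a..b} \<sigma>))"

lemma polypath_mono:
  assumes "polypath n s \<sigma>" "i \<le> j" "j \<le> n" shows "s i \<le> s j"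
  using assms(2,3)
proof (induction j rule: dec_induct)
  case (step j)
  then have "s j < s (Suc j)" using assms(1) unfolding polypath_def by simp
  then show ?case using step by simp
qed simp

lemma velocity_interior:
  assumes "t \<in> {u<..<v}" "{u..v} \<subseteq> {a..b}"
  shows "velocity A {u..v} \<sigma> t = velocity A {a..b} \<sigma> t"
proof -
  have "t \<in> {a<..<b}"
  proof -
    have "u \<in> {a..b}" "v \<in> {a..b}" using assms by auto
    then show ?thesis using assms(1) by auto
  qed
  then have "at t within {a..b} = at t" "at t within {u..v} = at t"
    using assms(1) by (simp_all add: at_within_Icc_at)
  then show ?thesis by (simp only: velocity_def)
qed

text \<open>In the interior of a piece the derivative relative to the piece and the one relative to
  \<open>{a..b}\<close> agree; they may differ at break points, which the integral ignores.\<close>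

lemma polypath_length:
  assumes p: "polypath n s \<sigma>" and sub: "{s 0..s n} \<subseteq> {a..b}"
  shows "(speed {a..b} \<sigma> has_integral poly_length n s \<sigma>) {s 0..s n}"
proof -
  have "(speed {a..b} \<sigma> has_integral poly_length k s \<sigma>) {s 0..s k}" if "k \<le> n" for k
    using that
  proof (induction k)
    case 0
    show ?case using has_integral_refl(1)[of "speed {a..b} \<sigma>" "s 0"]
      by (simp only: poly_length_def box_real lessThan_0 sum.empty)
  next
    case (Suc k)
    have k: "s k < s (Suc k)" "C1_path_on A {s k..s (Suc k)} \<sigma>"
      using p Suc.prems unfolding polypath_def by auto
    have sub': "{s k..s (Suc k)} \<subseteq> {a..b}"
      using polypath_mono[OF p, of 0 k] polypath_mono[OF p, of "Suc k" n] Suc.prems k(1) sub by auto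
    have "(speed {s k..s (Suc k)} \<sigma> has_integral integral {s k..s (Suc k)} (speed {s k..s (Suc k)} \<sigma>)) (cbox (s k) (s (Suc k)))"
      using integrable_continuous_interval[OF speed_continuous[OF k(2,1)]] by (simp add: has_integral_integral)
    then have "(speed {a..b} \<sigma> has_integral integral {s k..s (Suc k)} (speed {s k..s (Suc k)} \<sigma>)) (cbox (s k) (s (Suc k)))"
      by (rule has_integral_spike_interior) (use velocity_interior[OF _ sub'] in \<open>simp add: speed_def\<close>)
    then have "(speed {a..b} \<sigma> has_integral poly_length k s \<sigma> + integral {s k..s (Suc k)} (speed {s k..s (Suc k)} \<sigma>)) {s 0..s (Suc k)}"
      using Suc polypath_mono[OF p, of 0 k] k(1)
      by (intro has_integral_combine[where c = "s k"]) auto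
    then show ?case by (simp add: poly_length_def)
  qed
  then show ?thesis by simp
qed

lemma polypath_chain:
  assumes "polypath n s \<sigma>" "0 < n"
  shows "chain (\<sigma> (s 0)) (\<sigma> (s n)) (poly_length n s \<sigma>)"
  using assms
proof (induction n)
  case (Suc n)
  have n: "s n < s (Suc n)" "C1_path_on A {s n..s (Suc n)} \<sigma>" and p: "polypath n s \<sigma>"
    using Suc.prems unfolding polypath_def by auto
  show ?case
  proof (cases "n = 0")
    case True
    then show ?thesis using chain_single[OF n refl refl] by (simp add: poly_length_def)
  next
    case False
    then show ?thesis using chain_step[OF Suc.IH[OF p] n refl refl] by (simp add: poly_length_def)
  qed
qed simp

text \<open>Recovers an actual path from a chain: the parameter intervals are placed end to end by
  translating each new piece.\<close>

lemma chain_polypath: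
  assumes "chain x y l"
  shows "\<exists>n s \<sigma>. 0 < n \<and> polypath n s \<sigma> \<and> \<sigma> (s 0) = x \<and> \<sigma> (s n) = y \<and> poly_length n s \<sigma> = l"
  using assms
proof induction
  case (chain_single a b \<sigma> x y)
  show ?case
    by (rule exI[of _ 1], rule exI[of _ "\<lambda>i. if i = 0 then a else b"], rule exI[of _ \<sigma>])
      (use chain_single in \<open>auto simp: polypath_def poly_length_def\<close>)
next
  case (chain_step x y l a b \<rho> z)
  obtain n s \<sigma> where IH: "0 < n" "polypath n s \<sigma>" "\<sigma> (s 0) = x" "\<sigma> (s n) = y" "poly_length n s \<sigma> = l"
    using chain_step.IH by blast
  \<comment> \<open>The translation moves the left end \<open>a\<close> of the new interval to the
    old right end \<open>s n\<close>.\<close>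
  define k where "k = s n - a"
  define s' where "s' = s(Suc n := b + k)"
  define \<sigma>' where "\<sigma>' t = (if t \<le> s n then \<sigma> t else \<rho> (t - k))" for t
  have s'n: "s' n = a + k" "s' (Suc n) = b + k" unfolding s'_def k_def by simp_all
  have s'i: "s' i = s i" if "i \<le> n" for i using that unfolding s'_def by simp
  have new: "C1_path_on A {a+k..b+k} \<sigma>'"
    "\<And>t. t \<in> {a+k..b+k} \<Longrightarrow> velocity A {a+k..b+k} \<sigma>' t = velocity A {a..b} \<rho> (t - k)"
    "\<And>t. t \<in> {a+k..b+k} \<Longrightarrow> \<sigma>' t = \<rho> (t - k)"
  proof -
    show *: "\<sigma>' t = \<rho> (t - k)" if "t \<in> {a+k..b+k}" for t
      using that chain_step.hyps(4) IH(4) unfolding \<sigma>'_def k_def by auto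
    show "C1_path_on A {a+k..b+k} \<sigma>'"
      "\<And>t. t \<in> {a+k..b+k} \<Longrightarrow> velocity A {a+k..b+k} \<sigma>' t = velocity A {a..b} \<rho> (t - k)"
      using C1_path_shift[OF chain_step.hyps(3,2) *] by auto
  qed
  have old: "C1_path_on A {s i..s (Suc i)} \<sigma>'"
    "\<And>t. t \<in> {s i..s (Suc i)} \<Longrightarrow> speed {s i..s (Suc i)} \<sigma>' t = speed {s i..s (Suc i)} \<sigma> t"
    "s i < s (Suc i)" if i: "i < n" for i
  proof -
    have si: "s i < s (Suc i)" "C1_path_on A {s i..s (Suc i)} \<sigma>" "s (Suc i) \<le> s n"
      using IH(2) i polypath_mono[OF IH(2), of "Suc i" n] unfolding polypath_def by auto
    have *: "\<sigma>' t = \<sigma> (t - 0)" if "t \<in> {s i + 0..s (Suc i) + 0}" for t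
      using that si(3) unfolding \<sigma>'_def by auto
    show "C1_path_on A {s i..s (Suc i)} \<sigma>'"
      using C1_path_shift(1)[OF si(2,1) *] by simp
    show "speed {s i..s (Suc i)} \<sigma>' t = speed {s i..s (Suc i)} \<sigma> t" if "t \<in> {s i..s (Suc i)}" for t
      using C1_path_shift(2)[OF si(2,1) *, of t] * that unfolding speed_def by simp
    show "s i < s (Suc i)" by (rule si)
  qed
  have ab: "s' n < s' (Suc n)" using s'n chain_step.hyps by simp
  have "polypath (Suc n) s' \<sigma>'" unfolding polypath_def
  proof (intro allI impI)
    fix i assume "i < Suc n"
    then consider "i < n" | "i = n" by linarith
    then show "s' i < s' (Suc i) \<and> C1_path_on A {s' i..s' (Suc i)} \<sigma>'"
    proof cases
      case 1 then show ?thesis using old(1,3)[OF 1] s'i by simp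
    next
      case 2 then show ?thesis using new(1) s'n ab by simp
    qed
  qed
  moreover have "\<sigma>' (s' 0) = x" using IH(3) polypath_mono[OF IH(2), of 0 n] s'i by (simp add: \<sigma>'_def)
  moreover have "\<sigma>' (s' (Suc n)) = z" using s'n new(3)[of "b + k"] chain_step.hyps by simp
  moreover have "poly_length (Suc n) s' \<sigma>' = l + integral {a..b} (speed {a..b} \<rho>)"
  proof -
    have "integral {s' i..s' (Suc i)} (speed {s' i..s' (Suc i)} \<sigma>') = integral {s i..s (Suc i)} (speed {s i..s (Suc i)} \<sigma>)"
      if i: "i < n" for i
    proof -
      have "s' i = s i" "s' (Suc i) = s (Suc i)" using s'i i by simp_all
      moreover have "integral {s i..s (Suc i)} (speed {s i..s (Suc i)} \<sigma>') = integral {s i..s (Suc i)} (speed {s i..s (Suc i)} \<sigma>)"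
        by (rule integral_cong) (rule old(2)[OF i])
      ultimately show ?thesis by (simp only:)
    qed
    moreover have "integral {s' n..s' (Suc n)} (speed {s' n..s' (Suc n)} \<sigma>') = integral {a..b} (speed {a..b} \<rho>)"
    proof -
      have "integral {a+k..b+k} (speed {a+k..b+k} \<sigma>') = integral {a+k..b+k} (\<lambda>t. speed {a..b} \<rho> (t + - k))"
        using new by (intro integral_cong) (auto simp: speed_def)
      also have "\<dots> = integral {a..b} (speed {a..b} \<rho>)"
        using integral_shift_real_ivl[of a "- k" b "speed {a..b} \<rho>"] by simp
      finally show ?thesis using s'n by simp
    qed
    ultimately show ?thesis using IH(5) by (simp add: poly_length_def)
  qed
  ultimately show ?case by blast
qed

lemma finsler_dist_chain: "d x y = Inf {l. chain x y l}"
proof -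
  have "{finsler_length A F a b \<sigma> | a b \<sigma>. a < b \<and> piecewise_C1_path A a b \<sigma> \<and> \<sigma> a = x \<and> \<sigma> b = y}
    = {l. chain x y l}" (is "?L = ?R")
  proof (intro set_eqI iffI)
    fix l assume "l \<in> ?L"
    then obtain a b \<sigma> where l: "l = finsler_length A F a b \<sigma>" "a < b" "piecewise_C1_path A a b \<sigma>" "\<sigma> a = x" "\<sigma> b = y"
      by blast
    then obtain n s where s: "s 0 = a" "s n = b" "polypath n s \<sigma>"
      unfolding piecewise_C1_path_def polypath_def by blast
    have "0 < n" using s l(2) by (cases n) auto
    have "(speed {a..b} \<sigma> has_integral poly_length n s \<sigma>) {a..b}"
      using polypath_length[OF s(3), of a b] s by simp
    then have "l = poly_length n s \<sigma>" unfolding l(1) finsler_length_def speed_def by (rule integral_unique)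
    then show "l \<in> ?R" using polypath_chain[OF s(3) \<open>0 < n\<close>] s l by simp
  next
    fix l assume "l \<in> ?R"
    then obtain n s \<sigma> where s: "0 < n" "polypath n s \<sigma>" "\<sigma> (s 0) = x" "\<sigma> (s n) = y" "poly_length n s \<sigma> = l"
      using chain_polypath by blast
    have "s 0 < s 1" using s unfolding polypath_def by auto
    then have "s 0 < s n" using polypath_mono[OF s(2), of 1 n] s(1) by simp
    moreover have "piecewise_C1_path A (s 0) (s n) \<sigma>"
      using s unfolding piecewise_C1_path_def polypath_def by blast
    moreover have "finsler_length A F (s 0) (s n) \<sigma> = l"
      using polypath_length[OF s(2) order_refl] s(5)
      unfolding finsler_length_def speed_def by (simp add: integral_unique)
    ultimately show "l \<in> ?L" using s by blast
  qed
  then show ?thesis unfolding finsler_dist_def by simp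
qed

lemma chain_trans:
  assumes "chain y z l'" "chain x y l" shows "chain x z (l + l')"
  using assms
proof (induction)
  case (chain_single a b \<sigma> y z)
  then show ?case using chain_step by blast
next
  case (chain_step y w l' a b \<sigma> z)
  show ?case using chain.chain_step[OF chain_step.IH[OF chain_step.prems] chain_step.hyps(2-5)]
    by (simp add: add.assoc)
qed

lemma chain_nonneg: "chain x y l \<Longrightarrow> 0 \<le> l"
  by (induction rule: chain.induct)
    (auto intro!: add_nonneg_nonneg integral_nonneg integrable_continuous_interval speed_continuous speed_nonneg)

lemma dist_le_chain: "chain x y l \<Longrightarrow> d x y \<le> l"
  unfolding finsler_dist_chain by (rule cInf_lower) (auto intro!: bdd_belowI[of _ 0] chain_nonneg)

section \<open>The Finsler distance\<close>

lemma chart_cball: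
  assumes "c \<in> A" "x \<in> fst c" "open N" "x \<in> N"
  obtains r where "0 < r" "cball (snd c x) r \<subseteq> snd c ` (fst c \<inter> N)"
proof -
  have "open (snd c ` (fst c \<inter> N))" by (rule open_chart_image_Int[OF assms(1,3)])
  then show ?thesis using that assms(2,4) open_contains_cball by blast
qed

text \<open>Segments in a chart are the source of explicit upper bounds for the distance. Their
  velocity in \<open>c\<close> is the constant \<open>q - p\<close>; in other charts it is the image
  under \<open>coord_change\<close>, which is continuous along the segment.\<close>

lemma chain_segment:
  assumes c: "c \<in> A" and sub: "closed_segment p q \<subseteq> snd c ` fst c"
  shows "chain (chart_inv c p) (chart_inv c q) (integral {0..1} (\<lambda>s. Fc c (p + s *\<^sub>R (q - p), q - p)))"
proof -
  define line where "line s = p + s *\<^sub>R (q - p)" for s :: real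
  define \<sigma> where "\<sigma> s = chart_inv c (line s)" for s
  have line: "line s \<in> snd c ` fst c" if "s \<in> {0..1}" for s
  proof -
    have "line s = (1 - s) *\<^sub>R p + s *\<^sub>R q" unfolding line_def by (simp add: algebra_simps)
    then show ?thesis using that sub unfolding closed_segment_def by auto
  qed
  have dline: "(line has_vector_derivative q - p) (at s within S)" for s S
    unfolding line_def by (auto intro!: derivative_eq_intros)
  have \<sigma>_chart: "\<sigma> s \<in> fst c" "snd c (\<sigma> s) = line s" if "s \<in> {0..1}" for s
    using line[OF that] chart_inv_in[OF c] chart_chart_inv[OF c] unfolding \<sigma>_def by auto
  have D: "(snd c' \<circ> \<sigma> has_vector_derivative coord_change c c' (\<sigma> s) (q - p)) (at s within {0..1})"
    if s: "s \<in> {0..1}" and c': "c' \<in> A" "\<sigma> s \<in> fst c'" for s c'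
  proof -
    have "(snd c' \<circ> chart_inv c has_derivative coord_change c c' (\<sigma> s)) (at (line s) within line ` {0..1})"
      using has_derivative_transition[OF c c'(1) _ c'(2)] \<sigma>_chart[OF s] by (simp add: has_derivative_at_withinI)
    with dline have "((snd c' \<circ> chart_inv c) \<circ> line has_vector_derivative coord_change c c' (\<sigma> s) (q - p)) (at s within {0..1})"
      by (rule vector_derivative_diff_chain_within)
    moreover have "(snd c' \<circ> chart_inv c) \<circ> line = snd c' \<circ> \<sigma>" by (auto simp: \<sigma>_def)
    ultimately show ?thesis by simp
  qed
  have vel: "velocity A {0..1} \<sigma> s c' = coord_change c c' (\<sigma> s) (q - p)"
    if "s \<in> {0..1}" "c' \<in> A" "\<sigma> s \<in> fst c'" for s c'
    using velocity_eq[OF _ that D[OF that]] by simp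
  have vel_c: "velocity A {0..1} \<sigma> s c = q - p" if s: "s \<in> {0..1}" for s
  proof (rule velocity_eq)
    show "(snd c \<circ> \<sigma> has_vector_derivative q - p) (at s within {0..1})"
      using dline zero_less_one s
      by (rule has_vector_derivative_transform_within) (simp add: \<sigma>_chart)
  qed (use s c \<sigma>_chart in auto)
  have cline: "continuous_on S line" for S unfolding line_def by (intro continuous_intros)
  have C1: "C1_path_on A {0..1} \<sigma>" unfolding C1_path_on_def
  proof (intro conjI ballI)
    show "continuous_on {0..1} \<sigma>" unfolding \<sigma>_def
      by (rule continuous_on_compose2[OF continuous_on_chart_inv[OF c] cline]) (use line in auto)
    fix c' assume c': "c' \<in> A"
    show "(snd c' \<circ> \<sigma>) differentiable (at s within {0..1})" if "s \<in> {0..1} \<inter> \<sigma> -` fst c'" for s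
      using D[of s c'] that c' by (auto intro: differentiableI_vector)
    have "continuous_on ({0..1} \<inter> \<sigma> -` fst c') (\<lambda>s. coord_change c c' (chart_inv c (line s)) (q - p))"
    proof (rule continuous_on_compose2[OF continuous_on_coord_change[OF c c'] cline], rule image_subsetI)
      fix s assume "s \<in> {0..1} \<inter> \<sigma> -` fst c'"
      then show "line s \<in> snd c ` (fst c \<inter> fst c')"
        using \<sigma>_chart[of s] by (intro image_eqI[where x = "\<sigma> s"]) auto
    qed
    then show "continuous_on ({0..1} \<inter> \<sigma> -` fst c') (\<lambda>s. velocity A {0..1} \<sigma> s c')"
      by (rule continuous_on_eq) (use vel c' in \<open>auto simp: \<sigma>_def\<close>)
  qed
  have "chain (chart_inv c p) (chart_inv c q) (integral {0..1} (speed {0..1} \<sigma>))"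
    using zero_less_one C1 by (rule chain_single) (simp_all add: \<sigma>_def line_def)
  moreover have "integral {0..1} (speed {0..1} \<sigma>) = integral {0..1} (\<lambda>s. Fc c (p + s *\<^sub>R (q - p), q - p))"
    by (rule integral_cong)
      (use speed_eq[OF C1 zero_less_one _ c] \<sigma>_chart vel_c in \<open>auto simp: line_def\<close>)
  ultimately show ?thesis by simp
qed

lemma chain_refl: "chain x x 0"
proof -
  obtain c where c: "c \<in> A" "x \<in> fst c" by (rule chart_at)
  have "chain (chart_inv c (snd c x)) (chart_inv c (snd c x)) (integral {0..1::real} (\<lambda>s. Fc c (snd c x, 0)))"
    using chain_segment[OF c(1), of "snd c x" "snd c x"] c(2) by simp
  then show ?thesis using c chart_inv_chart[OF c] Fc_zero[OF c(1), of "snd c x"] by simp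
qed

text \<open>The points reachable from \<open>x\<close> form an open set, and so do the others,
  because nearby points reach each other in both directions; connectedness concludes. In particular
  the infimum defining the distance is over a nonempty set.\<close>

lemma chain_exists: "\<exists>l. chain x y l"
proof -
  define S where "S = {y. \<exists>l. chain x y l}"
  have nbhd: "\<exists>N. open N \<and> y \<in> N \<and> (\<forall>z\<in>N. (\<exists>l. chain y z l) \<and> (\<exists>l. chain z y l))" for y
  proof -
    obtain c where c: "c \<in> A" "y \<in> fst c" by (rule chart_at)
    obtain r where r: "0 < r" "cball (snd c y) r \<subseteq> snd c ` (fst c \<inter> UNIV)"
      using chart_cball[OF c open_UNIV] by blast
    have "(\<exists>l. chain y z l) \<and> (\<exists>l. chain z y l)" if z: "z \<in> fst c" "snd c z \<in> ball (snd c y) r" for z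
    proof -
      have "closed_segment (snd c y) (snd c z) \<subseteq> cball (snd c y) r"
        using z(2) r(1) by (intro closed_segment_subset) auto
      then have sub: "closed_segment (snd c y) (snd c z) \<subseteq> snd c ` fst c" using r(2) by auto
      have "\<exists>l. chain y z l"
        using chain_segment[OF c(1) sub] chart_inv_chart[OF c(1)] c(2) z(1) by auto
      moreover have "\<exists>l. chain z y l"
        using chain_segment[OF c(1), of "snd c z" "snd c y"] sub chart_inv_chart[OF c(1)] c(2) z(1)
        by (auto simp: closed_segment_commute)
      ultimately show ?thesis by blast
    qed
    then show ?thesis
      using open_chart_preimage[OF c(1) open_ball, of "snd c y" r] c(2) r(1)
      by (intro exI[of _ "{z \<in> fst c. snd c z \<in> ball (snd c y) r}"]) auto
  qed
  have "open S" unfolding open_subopen[of S]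
  proof
    fix y assume "y \<in> S"
    moreover obtain N where N: "open N" "y \<in> N" "\<forall>z\<in>N. (\<exists>l. chain y z l) \<and> (\<exists>l. chain z y l)"
      using nbhd by blast
    ultimately show "\<exists>T. open T \<and> y \<in> T \<and> T \<subseteq> S" unfolding S_def using chain_trans
      by (intro exI[of _ N]) blast
  qed
  moreover have "open (- S)" unfolding open_subopen[of "- S"]
  proof
    fix y assume "y \<in> - S"
    moreover obtain N where N: "open N" "y \<in> N" "\<forall>z\<in>N. (\<exists>l. chain y z l) \<and> (\<exists>l. chain z y l)"
      using nbhd by blast
    ultimately show "\<exists>T. open T \<and> y \<in> T \<and> T \<subseteq> - S" unfolding S_def using chain_trans
      by (intro exI[of _ N]) blast
  qed
  ultimately have "S = {} \<or> - S = {}"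
    using connectedD[OF connected_UNIV, of S "- S"] by auto
  moreover have "x \<in> S" unfolding S_def using chain_refl by blast
  ultimately show ?thesis unfolding S_def by blast
qed

lemma le_dist: "(\<And>l. chain x y l \<Longrightarrow> k \<le> l) \<Longrightarrow> k \<le> d x y"
  unfolding finsler_dist_chain using chain_exists by (intro cInf_greatest) auto

lemma dist_approx:
  assumes "0 < e" obtains l where "chain x y l" "l < d x y + e"
proof -
  have "Inf {l. chain x y l} < d x y + e" using assms by (simp add: finsler_dist_chain)
  from cInf_lessD[OF _ this] show ?thesis using that chain_exists[of x y] by auto
qed

lemma d_nonneg: "0 \<le> d x y"
  by (rule le_dist) (rule chain_nonneg)

lemma d_self: "d x x = 0"
  using dist_le_chain[OF chain_refl] d_nonneg by (intro antisym)

lemma d_triangle: "d x z \<le> d x y + d y z"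
proof (rule field_le_epsilon)
  fix e :: real assume "0 < e"
  then have e: "0 < e / 2" by simp
  obtain l where "chain x y l" "l < d x y + e / 2" using e by (rule dist_approx)
  moreover obtain l' where "chain y z l'" "l' < d y z + e / 2" using e by (rule dist_approx)
  ultimately show "d x z \<le> d x y + d y z + e"
    using dist_le_chain[OF chain_trans, of y z l' x l] by simp
qed

text \<open>Freezing the base point: the segment stays in the convex set
  \<open>cball p0 R \<inter> cball p t\<close>, where the norm differs little from the one at
  \<open>p\<close>, and its length is estimated by integration.\<close>

lemma d_segment:
  assumes c: "c \<in> A" and sub: "cball p0 R \<subseteq> snd c ` fst c" and "0 < e"
  obtains t where "0 < t" "\<And>p q q'. p \<in> cball p0 R \<Longrightarrow> q \<in> cball p0 R \<Longrightarrow> q' \<in> cball p0 R \<Longrightarrow>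
    dist p q \<le> t \<Longrightarrow> dist p q' \<le> t \<Longrightarrow>
    d (chart_inv c q) (chart_inv c q') \<le> Fc c (p, q' - q) + e * norm (q' - q)"
proof -
  obtain t where t: "0 < t" "\<And>p p' w. p \<in> cball p0 R \<Longrightarrow> p' \<in> cball p0 R \<Longrightarrow> dist p p' \<le> t \<Longrightarrow>
    Fc c (p', w) \<le> Fc c (p, w) + e * norm w"
    using Fc_uniform[OF assms] by blast
  have "d (chart_inv c q) (chart_inv c q') \<le> Fc c (p, q' - q) + e * norm (q' - q)"
    if p: "p \<in> cball p0 R" "q \<in> cball p0 R" "q' \<in> cball p0 R" "dist p q \<le> t" "dist p q' \<le> t" for p q q'
  proof -
    have seg: "closed_segment q q' \<subseteq> cball p0 R \<inter> cball p t"
      using p by (intro closed_segment_subset convex_Int convex_cball) auto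
    have inseg: "q + s *\<^sub>R (q' - q) \<in> closed_segment q q'" if "s \<in> {0..1}" for s
      using that by (auto simp: in_segment algebra_simps intro!: exI[of _ s])
    have "d (chart_inv c q) (chart_inv c q') \<le> integral {0..1} (\<lambda>s. Fc c (q + s *\<^sub>R (q' - q), q' - q))"
      using chain_segment[OF c] seg sub by (intro dist_le_chain) blast
    also have "\<dots> \<le> integral {0..1::real} (\<lambda>s. Fc c (p, q' - q) + e * norm (q' - q))"
    proof (rule integral_le)
      show "(\<lambda>s. Fc c (q + s *\<^sub>R (q' - q), q' - q)) integrable_on {0..1}"
      proof (intro integrable_continuous_interval continuous_on_compose2[OF continuous_on_Fc[OF c]])
        show "continuous_on {0..1} (\<lambda>s. (q + s *\<^sub>R (q' - q), q' - q))" by (intro continuous_intros)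
        show "(\<lambda>s. (q + s *\<^sub>R (q' - q), q' - q)) ` {0..1} \<subseteq> snd c ` fst c \<times> UNIV"
          using inseg seg sub by blast
      qed
      fix s :: real assume "s \<in> {0..1}"
      then have "q + s *\<^sub>R (q' - q) \<in> cball p0 R \<inter> cball p t" using inseg seg by blast
      then show "Fc c (q + s *\<^sub>R (q' - q), q' - q) \<le> Fc c (p, q' - q) + e * norm (q' - q)"
        using p(1) by (intro t(2)) auto
    qed (rule integrable_const_ivl)
    finally show ?thesis by simp
  qed
  then show ?thesis using that t(1) by blast
qed


section \<open>The infinitesimal semi-Lipschitz condition\<close>

text \<open>The slope at \<open>y\<close> is measured in the norm frozen at \<open>y\<close>. Both
  points vary, as in strict differentiability, because the path argument compares points on either
  side of a given one; \<open>f\<close> itself may fail to be differentiable.\<close>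

definition slope_le :: "('a \<Rightarrow> real) \<Rightarrow> real \<Rightarrow> ('a, 'e) chart \<Rightarrow> 'a \<Rightarrow> bool" where
  "slope_le f L c y \<longleftrightarrow> (\<forall>e>0. \<exists>r>0. \<forall>q\<in>ball (snd c y) r. \<forall>q'\<in>ball (snd c y) r.
     f (chart_inv c q') - f (chart_inv c q) \<le> L * Fc c (snd c y, q' - q) + e * norm (q' - q))"

lemma slope_leD:
  assumes "slope_le f L c y" "0 < e"
  obtains r where "0 < r" "\<And>q q'. q \<in> ball (snd c y) r \<Longrightarrow> q' \<in> ball (snd c y) r \<Longrightarrow>
    f (chart_inv c q') - f (chart_inv c q) \<le> L * Fc c (snd c y, q' - q) + e * norm (q' - q)"
  using assms unfolding slope_le_def by meson

text \<open>With the error term \<open>e * (v - u)\<close> the inequality is additive over adjacent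
  intervals, so by bisection it suffices to prove it on short intervals around each
  parameter.\<close>

lemma slope_le_path:
  assumes slope: "\<And>y. \<exists>c\<in>A. y \<in> fst c \<and> slope_le f L c y" and L: "0 \<le> L"
    and \<sigma>: "C1_path_on A {a..b} \<sigma>" and ab: "a < b"
  shows "f (\<sigma> b) - f (\<sigma> a) \<le> L * integral {a..b} (speed {a..b} \<sigma>)"
proof (rule field_le_epsilon)
  fix e0 :: real assume "0 < e0"
  define e where "e = e0 / (b - a)"
  have e: "0 < e" "e * (b - a) = e0" unfolding e_def using \<open>0 < e0\<close> ab by auto
  let ?v = "speed {a..b} \<sigma>"
  have int: "?v integrable_on {u..v}" if "a \<le> u" "v \<le> b" for u v
    using integrable_continuous_interval[OF speed_continuous[OF \<sigma> ab]] that
    by (auto intro: integrable_on_subinterval)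
  have "a \<le> a \<longrightarrow> b \<le> b \<longrightarrow> f (\<sigma> b) - f (\<sigma> a) \<le> L * integral {a..b} ?v + e * (b - a)"
  proof (rule Bolzano[where P = "\<lambda>u v. a \<le> u \<longrightarrow> v \<le> b \<longrightarrow> f (\<sigma> v) - f (\<sigma> u) \<le> L * integral {u..v} ?v + e * (v - u)"])
    show "a \<le> b" using ab by simp
  next
    fix u v w assume *: "a \<le> u \<longrightarrow> v \<le> b \<longrightarrow> f (\<sigma> v) - f (\<sigma> u) \<le> L * integral {u..v} ?v + e * (v - u)"
      "a \<le> v \<longrightarrow> w \<le> b \<longrightarrow> f (\<sigma> w) - f (\<sigma> v) \<le> L * integral {v..w} ?v + e * (w - v)" "u \<le> v" "v \<le> w"
    show "a \<le> u \<longrightarrow> w \<le> b \<longrightarrow> f (\<sigma> w) - f (\<sigma> u) \<le> L * integral {u..w} ?v + e * (w - u)"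
    proof (intro impI)
      assume uw: "a \<le> u" "w \<le> b"
      have I: "integral {u..w} ?v = integral {u..v} ?v + integral {v..w} ?v"
        using Henstock_Kurzweil_Integration.integral_combine[OF *(3,4) int[OF uw]] by simp
      have "f (\<sigma> v) - f (\<sigma> u) \<le> L * integral {u..v} ?v + e * (v - u)"
        "f (\<sigma> w) - f (\<sigma> v) \<le> L * integral {v..w} ?v + e * (w - v)" using * uw by auto
      then show "f (\<sigma> w) - f (\<sigma> u) \<le> L * integral {u..w} ?v + e * (w - u)"
        unfolding I by (simp add: algebra_simps)
    qed
  next
    fix t assume "a \<le> t" "t \<le> b"
    then have t: "t \<in> {a..b}" by simp
    obtain c where c: "c \<in> A" "\<sigma> t \<in> fst c" "slope_le f L c (\<sigma> t)" using slope by blast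
    define p where "p = snd c (\<sigma> t)"
    define w where "w = velocity A {a..b} \<sigma> t c"
    have p: "p \<in> snd c ` fst c" unfolding p_def using c by simp
    \<comment> \<open>Budget per unit of time: replacing the difference quotient by the velocity,
      and the speed at \<open>t\<close> by nearby speeds, costs \<open>L * e1\<close> each; the
      slope error costs \<open>e1\<close>. Together this is at most \<open>e\<close>.\<close>
    define e1 where "e1 = e / (2 * L + 2)"
    have "0 < e1" "e1 * (2 * L + 2) = e" unfolding e1_def using e L by (auto simp: add_nonneg_pos)
    then have e1: "0 < e1" "2 * L * e1 + 2 * e1 = e" by (simp_all add: algebra_simps)
    have "continuous_on UNIV (\<lambda>w. Fc c (p, w))"
      by (rule continuous_on_compose2[OF continuous_on_Fc[OF c(1)]]) (use p in \<open>auto intro!: continuous_intros\<close>)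
    then obtain \<eta> where \<eta>: "0 < \<eta>" "\<And>w'. dist w' w < \<eta> \<Longrightarrow> dist (Fc c (p, w')) (Fc c (p, w)) < e1"
      using e1(1) unfolding continuous_on_iff by (metis UNIV_I)
    define \<eta>' where "\<eta>' = min 1 (\<eta> / 2)"
    have \<eta>': "0 < \<eta>'" "\<eta>' \<le> 1" "\<eta>' < \<eta>" unfolding \<eta>'_def using \<eta>(1) by auto
    \<comment> \<open>A displacement in time \<open>h\<close> will have norm at most
      \<open>h * M\<close>; the slope condition is therefore used with error
      \<open>e1 / M\<close>.\<close>
    define M where "M = norm w + 1"
    have M: "0 < M" unfolding M_def by (simp add: add_nonneg_pos)
    obtain r where r: "0 < r" "\<And>q q'. q \<in> ball p r \<Longrightarrow> q' \<in> ball p r \<Longrightarrow>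
        f (chart_inv c q') - f (chart_inv c q) \<le> L * Fc c (p, q' - q) + e1 / M * norm (q' - q)"
      using slope_leD[OF c(3), of "e1 / M"] e1 M unfolding p_def by auto
    have cont: "continuous_on {a..b} \<sigma>" using \<sigma> unfolding C1_path_on_def by blast
    have op: "open {x \<in> fst c. snd c x \<in> ball p r}" by (rule open_chart_preimage[OF c(1) open_ball])
    have "\<sigma> t \<in> {x \<in> fst c. snd c x \<in> ball p r}" using c r(1) unfolding p_def by simp
    from eventually_in_chart[OF cont t op this] obtain d1
      where d1: "0 < d1" "\<And>s. s \<in> {a..b} \<Longrightarrow> dist s t < d1 \<Longrightarrow> \<sigma> s \<in> {x \<in> fst c. snd c x \<in> ball p r}"
      by blast
    have "(snd c \<circ> \<sigma> has_vector_derivative w) (at t within {a..b})"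
      unfolding w_def by (rule C1_pathD[OF \<sigma> t c(1,2)])
    then obtain d2 where d2: "0 < d2" "\<And>s. s \<in> {a..b} \<Longrightarrow> \<bar>s - t\<bar> < d2 \<Longrightarrow>
        norm (snd c (\<sigma> s) - p - (s - t) *\<^sub>R w) \<le> \<eta>' * \<bar>s - t\<bar>"
      unfolding has_vector_derivative_def has_derivative_within_alt p_def
      using \<eta>'(1) by (auto simp: comp_def)
    obtain d3 where d3: "0 < d3" "\<And>s. s \<in> {a..b} \<Longrightarrow> dist s t < d3 \<Longrightarrow> dist (?v s) (?v t) < e1"
      using speed_continuous[OF \<sigma> ab] t e1(1) unfolding continuous_on_iff by metis
    have vt: "?v t = Fc c (p, w)" unfolding p_def w_def by (rule speed_eq[OF \<sigma> ab t c(1,2)])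
    show "\<exists>d>0. \<forall>u v. u \<le> t \<and> t \<le> v \<and> v - u < d \<longrightarrow>
        a \<le> u \<longrightarrow> v \<le> b \<longrightarrow> f (\<sigma> v) - f (\<sigma> u) \<le> L * integral {u..v} ?v + e * (v - u)"
    proof (intro exI conjI allI impI)
      show "0 < min d1 (min d2 d3)" using d1 d2 d3 by simp
      fix u v assume uv: "u \<le> t \<and> t \<le> v \<and> v - u < min d1 (min d2 d3)" "a \<le> u" "v \<le> b"
      show "f (\<sigma> v) - f (\<sigma> u) \<le> L * integral {u..v} ?v + e * (v - u)"
      proof (cases "u = v")
        case False
        define h where "h = v - u"
        have h: "0 < h" unfolding h_def using uv False by simp
        have near: "s \<in> {a..b}" "dist s t < d1" "\<bar>s - t\<bar> < d2" "dist s t < d3" if "s \<in> {u..v}" for s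
          using that uv by (auto simp: dist_real_def)
        define D where "D = snd c (\<sigma> v) - snd c (\<sigma> u)"
        have "norm (D - h *\<^sub>R w) = norm ((snd c (\<sigma> v) - p - (v - t) *\<^sub>R w) - (snd c (\<sigma> u) - p - (u - t) *\<^sub>R w))"
          unfolding D_def h_def by (simp add: algebra_simps)
        also have "\<dots> \<le> \<eta>' * \<bar>v - t\<bar> + \<eta>' * \<bar>u - t\<bar>"
          using near[of v] near[of u] uv by (intro norm_triangle_le_diff add_mono d2) auto
        also have "\<dots> = \<eta>' * h" using uv unfolding h_def by (simp add: algebra_simps)
        finally have Dh: "norm (D - h *\<^sub>R w) \<le> \<eta>' * h" .
        \<comment> \<open>Homogeneity extracts the duration \<open>h\<close>; the remaining
          difference quotient is close to \<open>w\<close>, where continuity of the norm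
          applies.\<close>
        have "D = h *\<^sub>R (inverse h *\<^sub>R D)" using h by simp
        then have FD: "Fc c (p, D) = h * Fc c (p, inverse h *\<^sub>R D)" using Fc_scale[OF c(1) p] h by (metis less_imp_le)
        have "inverse h *\<^sub>R D - w = inverse h *\<^sub>R (D - h *\<^sub>R w)" using h by (simp add: algebra_simps)
        then have "dist (inverse h *\<^sub>R D) w = inverse h * norm (D - h *\<^sub>R w)" using h by (simp add: dist_norm)
        also have "\<dots> \<le> inverse h * (\<eta>' * h)" using Dh h by (intro mult_left_mono) auto
        also have "\<dots> = \<eta>'" using h by (simp add: field_simps)
        also have "\<dots> < \<eta>" by (rule \<eta>')
        finally have "Fc c (p, inverse h *\<^sub>R D) \<le> ?v t + e1" using \<eta>(2) vt by (fastforce simp: dist_real_def)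
        then have FD': "Fc c (p, D) \<le> h * (?v t + e1)" unfolding FD using h by (intro mult_left_mono) auto
        have "\<eta>' * h \<le> 1 * h" using \<eta>'(2) h by (intro mult_right_mono) auto
        then have Dh1: "norm (D - h *\<^sub>R w) \<le> h" using Dh by linarith
        have "norm D \<le> norm (h *\<^sub>R w) + norm (D - h *\<^sub>R w)" using norm_triangle_sub[of D "h *\<^sub>R w"] by simp
        also have "\<dots> \<le> h * norm w + h" using Dh1 h by simp
        finally have nD: "norm D \<le> h * M" unfolding M_def by (simp add: algebra_simps)
        have in_ball: "\<sigma> s \<in> fst c" "snd c (\<sigma> s) \<in> ball p r" if "s \<in> {u..v}" for s
          using d1(2)[of s] near[OF that] by auto
        have "f (\<sigma> v) - f (\<sigma> u) \<le> L * Fc c (p, D) + e1 / M * norm D"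
          using r(2)[of "snd c (\<sigma> u)" "snd c (\<sigma> v)"] in_ball[of u] in_ball[of v] uv(1) chart_inv_chart[OF c(1)]
          unfolding D_def by simp
        also have "\<dots> \<le> L * (h * (?v t + e1)) + e1 / M * (h * M)"
          using FD' nD L e1 M by (intro add_mono mult_left_mono) auto
        also have "\<dots> = L * (h * (?v t - e1)) + (2 * L * e1 + e1) * h" using M by (simp add: algebra_simps)
        also have "\<dots> \<le> L * integral {u..v} ?v + e * h"
        proof (intro add_mono mult_left_mono mult_right_mono L)
          have "integral {u..v} (\<lambda>s. ?v t - e1) \<le> integral {u..v} ?v"
          proof (rule integral_le[OF integrable_const_ivl int[OF uv(2,3)]])
            fix s assume "s \<in> {u..v}"
            then show "?v t - e1 \<le> ?v s" using d3(2)[of s] near[of s] by (auto simp: dist_real_def)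
          qed
          then show "h * (?v t - e1) \<le> integral {u..v} ?v" using h unfolding h_def by simp
          show "2 * L * e1 + e1 \<le> e" using e1 by simp
        qed (use h in simp)
        finally show ?thesis unfolding h_def .
      qed simp
    qed
  qed
  then show "f (\<sigma> b) - f (\<sigma> a) \<le> L * integral {a..b} ?v + e0" using e(2) by simp
qed

text \<open>Adding the estimates for the pieces of a chain and passing to the infimum over chains
  keeps the constant \<open>L\<close>.\<close>

lemma slope_le_imp_lipschitz:
  assumes slope: "\<And>y. \<exists>c\<in>A. y \<in> fst c \<and> slope_le f L c y" and L: "0 \<le> L"
  shows "f z' - f z \<le> L * d z z'"
proof -
  have chain: "f y - f x \<le> L * l" if "chain x y l" for x y l
    using that
  proof induction
    case (chain_single a b \<sigma> x y)
    then show ?case using slope_le_path[OF slope L] by blast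
  next
    case (chain_step x y l a b \<sigma> z)
    then have "f z - f y \<le> L * integral {a..b} (speed {a..b} \<sigma>)" using slope_le_path[OF slope L] by blast
    then show ?case using chain_step.IH by (simp add: algebra_simps)
  qed
  show ?thesis
  \<comment> \<open>Passing to the infimum divides by \<open>L\<close>, so the value zero is treated
    separately.\<close>
  proof (cases "L = 0")
    case True
    then show ?thesis using chain_exists[of z z'] chain[of z z'] by auto
  next
    case False
    then have "(f z' - f z) / L \<le> d z z'"
      using L chain[of z z'] by (intro le_dist) (simp add: field_simps)
    then show ?thesis using False L by (simp add: field_simps)
  qed
qed

text \<open>Converse of the integration along paths, on an open set: short chart segments bound the
  distance by the norm frozen at \<open>y\<close>.\<close>

lemma lipschitz_imp_slope_le:
  assumes lip: "\<And>z z'. z \<in> N \<Longrightarrow> z' \<in> N \<Longrightarrow> f z' - f z \<le> L * d z z'" and L: "0 \<le> L"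
    and N: "open N" "y \<in> N" and c: "c \<in> A" "y \<in> fst c"
  shows "slope_le f L c y"
  unfolding slope_le_def
proof (intro allI impI)
  fix e :: real assume "0 < e"
  \<comment> \<open>The divisor \<open>L + 1\<close> instead of \<open>L\<close> covers
    \<open>L = 0\<close>.\<close>
  then have e: "0 < e / (L + 1)" using L by simp
  obtain R where R: "0 < R" "cball (snd c y) R \<subseteq> snd c ` (fst c \<inter> N)"
    using chart_cball[OF c N] by blast
  then have "cball (snd c y) R \<subseteq> snd c ` fst c" by blast
  from d_segment[OF c(1) this e] obtain t where t: "0 < t" "\<And>p q q'. p \<in> cball (snd c y) R \<Longrightarrow>
    q \<in> cball (snd c y) R \<Longrightarrow> q' \<in> cball (snd c y) R \<Longrightarrow> dist p q \<le> t \<Longrightarrow> dist p q' \<le> t \<Longrightarrow>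
    d (chart_inv c q) (chart_inv c q') \<le> Fc c (p, q' - q) + e / (L + 1) * norm (q' - q)"
    by blast
  have "f (chart_inv c q') - f (chart_inv c q) \<le> L * Fc c (snd c y, q' - q) + e * norm (q' - q)"
    if q: "q \<in> ball (snd c y) (min R t)" "q' \<in> ball (snd c y) (min R t)" for q q'
  proof -
    have inN: "chart_inv c q \<in> N" if "q \<in> ball (snd c y) (min R t)" for q
    proof -
      have "q \<in> cball (snd c y) R" using that by simp
      then show ?thesis using R(2) chart_inv_chart[OF c(1)] by force
    qed
    have "f (chart_inv c q') - f (chart_inv c q) \<le> L * d (chart_inv c q) (chart_inv c q')"
      using lip inN q by blast
    also have "\<dots> \<le> L * (Fc c (snd c y, q' - q) + e / (L + 1) * norm (q' - q))"
      using q R(1) L by (intro mult_left_mono t(2)) auto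
    also have "\<dots> = L * Fc c (snd c y, q' - q) + L * (e / (L + 1)) * norm (q' - q)"
      by (simp add: algebra_simps)
    also have "\<dots> \<le> L * Fc c (snd c y, q' - q) + e * norm (q' - q)"
      using L \<open>0 < e\<close> by (intro add_left_mono mult_right_mono) (auto simp: field_simps)
    finally show ?thesis .
  qed
  then show "\<exists>r>0. \<forall>q\<in>ball (snd c y) r. \<forall>q'\<in>ball (snd c y) r.
      f (chart_inv c q') - f (chart_inv c q) \<le> L * Fc c (snd c y, q' - q) + e * norm (q' - q)"
    using R(1) t(1) by (intro exI[of _ "min R t"]) auto
qed

text \<open>The infinitesimal condition is local, so passing through it turns local bounds into a
  global one without loss in the constant.\<close>

lemma locally_lipschitz_imp_lipschitz:
  assumes "\<And>y. \<exists>N. open N \<and> y \<in> N \<and> (\<forall>z\<in>N. \<forall>z'\<in>N. f z' - f z \<le> L * d z z')" and "0 \<le> L"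
  shows "f z' - f z \<le> L * d z z'"
proof (rule slope_le_imp_lipschitz)
  fix y
  obtain N where N: "open N" "y \<in> N" "\<forall>z\<in>N. \<forall>z'\<in>N. f z' - f z \<le> L * d z z'" using assms(1) by blast
  obtain c where c: "c \<in> A" "y \<in> fst c" by (rule chart_at)
  show "\<exists>c\<in>A. y \<in> fst c \<and> slope_le f L c y"
    using c lipschitz_imp_slope_le[OF _ assms(2) N(1,2) c] N(3) by blast
qed (rule assms)

section \<open>\<open>C\<^sup>1\<close> functions with small support\<close>

definition C1_on :: "('a \<Rightarrow> real) \<Rightarrow> 'a set \<Rightarrow> bool" where
  "C1_on f V \<longleftrightarrow> (\<forall>c\<in>A. Ck_on 1 (f \<circ> chart_inv c) (snd c ` (fst c \<inter> V)))"

lemma C1_function_iff: "C1_function A f \<longleftrightarrow> C1_on f UNIV"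
  unfolding C1_function_def C1_on_def by simp

lemma C1_on_subset: "C1_on f V \<Longrightarrow> W \<subseteq> V \<Longrightarrow> C1_on f W"
  unfolding C1_on_def by (meson Ck_on_1_subset Int_mono image_mono subset_refl)

lemma C1_on_local:
  assumes "\<And>y. y \<in> V \<Longrightarrow> \<exists>N g. open N \<and> y \<in> N \<and> C1_on g N \<and> (\<forall>z\<in>N. f z = g z)"
  shows "C1_on f V"
  unfolding C1_on_def
proof
  fix c assume c: "c \<in> A"
  show "Ck_on 1 (f \<circ> chart_inv c) (snd c ` (fst c \<inter> V))"
  proof (rule Ck_on_1_local)
    fix x assume "x \<in> snd c ` (fst c \<inter> V)"
    then obtain y where y: "y \<in> fst c" "y \<in> V" "x = snd c y" by blast
    obtain N g where N: "open N" "y \<in> N" "C1_on g N" "\<forall>z\<in>N. f z = g z" using assms[OF y(2)] by auto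
    show "\<exists>N g. open N \<and> x \<in> N \<and> Ck_on 1 g N \<and> (\<forall>y\<in>N. (f \<circ> chart_inv c) y = g y)"
      by (rule exI[of _ "snd c ` (fst c \<inter> N)"], rule exI[of _ "g \<circ> chart_inv c"])
        (use N y c chart_inv_chart[OF c] open_chart_image_Int in \<open>auto simp: C1_on_def\<close>)
  qed
qed

lemma C1_on_const: "C1_on (\<lambda>x. k) V"
  unfolding C1_on_def comp_def by (simp only: Ck_on_1_const) blast

lemma C1_on_add: "C1_on f V \<Longrightarrow> C1_on g V \<Longrightarrow> C1_on (\<lambda>x. f x + g x) V"
  unfolding C1_on_def comp_def by (intro ballI Ck_on_1_add) blast+

lemma C1_on_mult: "C1_on f V \<Longrightarrow> C1_on g V \<Longrightarrow> C1_on (\<lambda>x. f x * g x) V"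
  unfolding C1_on_def comp_def by (intro ballI Ck_on_1_mult) blast+

lemma C1_on_diff:
  assumes "C1_on f V" "C1_on g V" shows "C1_on (\<lambda>x. f x - g x) V"
  using C1_on_add[OF assms(1) C1_on_mult[OF C1_on_const[of "-1"] assms(2)]] by simp

lemma C1_on_inverse:
  assumes "C1_on f UNIV" "\<And>x. f x \<noteq> 0" shows "C1_on (\<lambda>x. inverse (f x)) UNIV"
  using assms unfolding C1_on_def comp_def by (intro ballI Ck_on_1_inverse) blast+

lemma C1_on_chart:
  fixes g :: "'e \<Rightarrow> real"
  assumes c: "c \<in> A" and g: "Ck_on 1 g UNIV"
  shows "C1_on (\<lambda>z. g (snd c z)) (fst c)"
  unfolding C1_on_def
proof
  fix c' assume c': "c' \<in> A"
  have "Ck_on 1 (g \<circ> (snd c \<circ> chart_inv c')) (snd c' ` (fst c' \<inter> fst c))"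
    by (rule Ck_on_1_compose[OF finite_dimensional g Ck_on_transition[OF c' c]]) simp
  then show "Ck_on 1 ((\<lambda>z. g (snd c z)) \<circ> chart_inv c') (snd c' ` (fst c' \<inter> fst c))"
    by (simp only: comp_def)
qed

lemma C1_on_continuous:
  assumes "C1_on f UNIV" shows "continuous_on UNIV f"
  unfolding continuous_on_eq_continuous_at[OF open_UNIV]
proof
  fix x :: 'a
  obtain c where c: "c \<in> A" "x \<in> fst c" by (rule chart_at)
  have "Ck_on 1 (f \<circ> chart_inv c) (snd c ` (fst c \<inter> UNIV))"
    using assms c(1) unfolding C1_on_def by blast
  then have "continuous_on (snd c ` fst c) (f \<circ> chart_inv c)"
    by (simp only: Ck_on_1_continuous Int_UNIV_right)
  then have "continuous_on (fst c) (\<lambda>z. (f \<circ> chart_inv c) (snd c z))"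
    by (rule continuous_on_compose2[OF _ continuous_on_chart[OF c(1)]]) simp
  then have "continuous_on (fst c) f"
    by (rule continuous_on_eq) (simp add: chart_inv_chart[OF c(1)])
  then show "isCont f x" using c open_chart[OF c(1)] by (simp add: continuous_on_eq_continuous_at)
qed

section \<open>Functions extended by zero from a chart\<close>

text \<open>Both \<open>f\<close> and \<open>- f\<close> are semi-Lipschitz. Despite the name there
  is no lower bound on increments.\<close>

definition bilipschitz :: "('a \<Rightarrow> real) \<Rightarrow> bool" where
  "bilipschitz f \<longleftrightarrow> (\<exists>L\<ge>0. \<forall>z z'. \<bar>f z' - f z\<bar> \<le> L * d z z')"

text \<open>Compactness makes the image closed in the Hausdorff manifold and not merely in the chart
  domain; this is what makes extension by zero regular.\<close>

lemma closed_chart_cball: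
  assumes "c \<in> A" "cball p r \<subseteq> snd c ` fst c"
  shows "closed (chart_inv c ` cball p r)"
proof (rule compact_imp_closed, rule compact_continuous_image)
  show "continuous_on (cball p r) (chart_inv c)"
    using continuous_on_chart_inv[OF assms(1)] assms(2) by (rule continuous_on_subset)
  show "compact (cball p r)" using finite_dimensional compact_cball_finite_span by blast
qed

lemma chart_cball_iff:
  assumes "c \<in> A" "cball p r \<subseteq> snd c ` fst c"
  shows "z \<in> chart_inv c ` cball p r \<longleftrightarrow> z \<in> fst c \<and> snd c z \<in> cball p r"
  using chart_inv_chart[OF assms(1)] chart_inv_in[OF assms(1)] chart_chart_inv[OF assms(1)] assms(2)
  by (auto simp del: mem_cball intro!: image_eqI[where x = "snd c z"])

definition extend_chart :: "('a, 'e) chart \<Rightarrow> ('e \<Rightarrow> real) \<Rightarrow> 'a \<Rightarrow> real" where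
  "extend_chart c g z = (if z \<in> fst c then g (snd c z) else 0)"

lemma extend_chart_C1:
  assumes c: "c \<in> A" and sub: "cball p0 R \<subseteq> snd c ` fst c"
    and g: "Ck_on 1 g UNIV" "\<And>q. q \<notin> cball p0 R \<Longrightarrow> g q = 0"
  shows "C1_on (extend_chart c g) UNIV"
proof (rule C1_on_local)
  fix y
  show "\<exists>N h. open N \<and> y \<in> N \<and> C1_on h N \<and> (\<forall>z\<in>N. extend_chart c g z = h z)"
  proof (cases "y \<in> fst c")
    case True
    then show ?thesis
      by (intro exI[of _ "fst c"] exI[of _ "\<lambda>z. g (snd c z)"])
        (use c open_chart C1_on_chart[OF c g(1)] in \<open>auto simp: extend_chart_def\<close>)
  next
    case False
    then have "y \<notin> chart_inv c ` cball p0 R" using chart_cball_iff[OF c sub] by blast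
    moreover have "extend_chart c g z = 0" if "z \<notin> chart_inv c ` cball p0 R" for z
      using that g(2) chart_cball_iff[OF c sub] unfolding extend_chart_def by auto
    ultimately show ?thesis
      by (intro exI[of _ "- (chart_inv c ` cball p0 R)"] exI[of _ "\<lambda>z. 0"])
        (use closed_chart_cball[OF c sub] C1_on_const in auto)
  qed
qed

text \<open>Over the ball, the lower bound \<open>m\<close> turns the slope \<open>M\<close> in the
  model norm into the Finsler slope \<open>M / m\<close>; off the ball the function vanishes on an
  open set. The local slopes then integrate to a global bound.\<close>

lemma extend_chart_lipschitz:
  assumes c: "c \<in> A" and sub: "cball p0 R \<subseteq> snd c ` fst c"
    and g: "\<And>q. q \<notin> cball p0 R \<Longrightarrow> g q = 0" "\<And>q q'. \<bar>g q' - g q\<bar> \<le> M * norm (q' - q)" "0 \<le> M"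
  shows "bilipschitz (extend_chart c g)"
proof -
  obtain m where m: "0 < m" "\<And>p w. p \<in> cball p0 R \<Longrightarrow> m * norm w \<le> Fc c (p, w)"
    using Fc_lower[OF c sub] by blast
  have L: "0 \<le> M / m" using m g by simp
  \<comment> \<open>The one-sided estimate is proved for a general \<open>h\<close> and then used
    for \<open>g\<close> and for \<open>- g\<close>.\<close>
  have one: "extend_chart c h z' - extend_chart c h z \<le> M / m * d z z'"
    if h: "\<And>q. q \<notin> cball p0 R \<Longrightarrow> h q = 0" "\<And>q q'. h q' - h q \<le> M * norm (q' - q)" for h z z'
  proof (rule slope_le_imp_lipschitz[OF _ L])
    fix y
    show "\<exists>c'\<in>A. y \<in> fst c' \<and> slope_le (extend_chart c h) (M / m) c' y"
    proof (cases "y \<in> chart_inv c ` cball p0 R")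
      case True
      then have y: "y \<in> fst c" "snd c y \<in> cball p0 R" using chart_cball_iff[OF c sub] by auto
      obtain r where r: "0 < r" "cball (snd c y) r \<subseteq> snd c ` (fst c \<inter> UNIV)"
        using chart_cball[OF c y(1) open_UNIV] by blast
      have "slope_le (extend_chart c h) (M / m) c y" unfolding slope_le_def
      proof (intro allI impI exI[of _ r] conjI ballI r(1))
        fix e :: real and q q' assume e: "0 < e" and q: "q \<in> ball (snd c y) r" "q' \<in> ball (snd c y) r"
        have "q \<in> snd c ` fst c" "q' \<in> snd c ` fst c" using r(2) q by auto
        then have "extend_chart c h (chart_inv c q') - extend_chart c h (chart_inv c q) = h q' - h q"
          using chart_inv_in[OF c] chart_chart_inv[OF c] by (simp add: extend_chart_def)
        also have "\<dots> \<le> M * norm (q' - q)" by (rule h)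
        also have "\<dots> = M / m * (m * norm (q' - q))" using m by simp
        also have "\<dots> \<le> M / m * Fc c (snd c y, q' - q)" using L m(2)[OF y(2)] by (rule mult_left_mono[rotated])
        also have "\<dots> \<le> M / m * Fc c (snd c y, q' - q) + e * norm (q' - q)" using e by simp
        finally show "extend_chart c h (chart_inv c q') - extend_chart c h (chart_inv c q)
          \<le> M / m * Fc c (snd c y, q' - q) + e * norm (q' - q)" .
      qed
      then show ?thesis using c y by blast
    next
      case False
      obtain c' where c': "c' \<in> A" "y \<in> fst c'" by (rule chart_at)
      have zero: "extend_chart c h z = 0" if "z \<in> - (chart_inv c ` cball p0 R)" for z
        using that h(1) chart_cball_iff[OF c sub] unfolding extend_chart_def by auto
      have "0 \<le> M / m * d z z'" for z z' using L d_nonneg by (rule mult_nonneg_nonneg)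
      then have "slope_le (extend_chart c h) (M / m) c' y"
        by (intro lipschitz_imp_slope_le[where N = "- (chart_inv c ` cball p0 R)"])
          (use zero L closed_chart_cball[OF c sub] False c' in auto)
      then show ?thesis using c' by blast
    qed
  qed
  have "\<bar>extend_chart c g z' - extend_chart c g z\<bar> \<le> M / m * d z z'" for z z'
  proof -
    have "g q' - g q \<le> M * norm (q' - q)" for q q' using g(2)[of q' q] by simp
    then have "extend_chart c g z' - extend_chart c g z \<le> M / m * d z z'"
      using one[of g] g(1) by blast
    moreover have "- g q' - - g q \<le> M * norm (q' - q)" for q q' using g(2)[of q' q] by simp
    then have "extend_chart c (\<lambda>q. - g q) z' - extend_chart c (\<lambda>q. - g q) z \<le> M / m * d z z'"
      using one[of "\<lambda>q. - g q"] g(1) by simp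
    ultimately show ?thesis by (auto simp: extend_chart_def abs_le_iff)
  qed
  then show ?thesis unfolding bilipschitz_def using L by blast
qed

lemma bump:
  assumes c: "c \<in> A" "y \<in> fst c" and r: "0 < r1" "r1 < r2" and sub: "cball (snd c y) r2 \<subseteq> snd c ` fst c"
  obtains b where "C1_on b UNIV" "bilipschitz b" "\<And>z. 0 \<le> b z \<and> b z \<le> 1"
    "\<And>z. z \<in> fst c \<Longrightarrow> snd c z \<in> cball (snd c y) r1 \<Longrightarrow> b z = 1"
    "\<And>z. b z \<noteq> 0 \<Longrightarrow> z \<in> fst c \<and> snd c z \<in> cball (snd c y) r2"
proof -
  obtain e M where e: "Ck_on 1 e UNIV" "\<And>q. 0 \<le> e q \<and> e q \<le> (1::real)"
    "\<And>q. q \<in> cball (snd c y) r1 \<Longrightarrow> e q = 1" "\<And>q. q \<notin> cball (snd c y) r2 \<Longrightarrow> e q = 0"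
    "\<And>q q'. \<bar>e q' - e q\<bar> \<le> M * norm (q' - q)" "0 \<le> M"
    using bump_function[OF finite_dimensional r(2), of "snd c y"] by metis
  show ?thesis
  proof (rule that[of "extend_chart c e"])
    show "C1_on (extend_chart c e) UNIV" by (rule extend_chart_C1[OF c(1) sub e(1,4)])
    show "bilipschitz (extend_chart c e)" by (rule extend_chart_lipschitz[OF c(1) sub e(4-6)])
  qed (use e in \<open>auto simp: extend_chart_def split: if_splits\<close>)
qed

lemma bump_at:
  assumes "open N" "y \<in> N"
  obtains b where "C1_on b UNIV" "bilipschitz b" "\<And>z. 0 \<le> b z \<and> b z \<le> 1" "b y = 1"
    "\<And>z. b z \<noteq> 0 \<Longrightarrow> z \<in> N"
proof -
  obtain c where c: "c \<in> A" "y \<in> fst c" by (rule chart_at)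
  obtain r where r: "0 < r" "cball (snd c y) r \<subseteq> snd c ` (fst c \<inter> N)"
    using chart_cball[OF c assms] by blast
  then have sub: "cball (snd c y) r \<subseteq> snd c ` fst c" by blast
  have r2: "0 < r / 2" "r / 2 < r" using r by auto
  obtain b where b: "C1_on b UNIV" "bilipschitz b" "\<And>z. 0 \<le> b z \<and> b z \<le> 1"
    "\<And>z. z \<in> fst c \<Longrightarrow> snd c z \<in> cball (snd c y) (r / 2) \<Longrightarrow> b z = 1"
    "\<And>z. b z \<noteq> 0 \<Longrightarrow> z \<in> fst c \<and> snd c z \<in> cball (snd c y) r"
    using bump[OF c r2 sub] by blast
  have "z \<in> N" if z: "b z \<noteq> 0" for z
  proof -
    have zc: "z \<in> fst c" "snd c z \<in> cball (snd c y) r" using b(5)[OF z] by auto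
    then obtain z' where "z' \<in> fst c" "z' \<in> N" "snd c z = snd c z'" using r(2) by blast
    then show ?thesis using chart_inv_chart[OF c(1)] zc(1) by metis
  qed
  then show ?thesis using that b(1-3) b(4)[OF c(2)] r(1) by auto
qed

section \<open>Comparison of the distance with the manifold topology\<close>

text \<open>A bump that is \<open>1\<close> at \<open>y\<close> and \<open>0\<close> off
  \<open>N\<close> is Lipschitz in both directions, so points off \<open>N\<close> keep a fixed
  distance both from and to \<open>y\<close>.\<close>

lemma d_small_imp_near:
  assumes "open N" "y \<in> N"
  obtains r where "0 < r" "\<And>z. d y z < r \<Longrightarrow> z \<in> N" "\<And>z. d z y < r \<Longrightarrow> z \<in> N"
proof -
  obtain b where b: "bilipschitz b" "b y = 1" "\<And>z. b z \<noteq> 0 \<Longrightarrow> z \<in> N"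
    using bump_at[OF assms] by metis
  obtain L where L: "0 \<le> L" "\<And>z z'. \<bar>b z' - b z\<bar> \<le> L * d z z'"
    using b(1) unfolding bilipschitz_def by blast
  have far: "z \<in> N" if "t < 1 / (L + 1)" "\<bar>b y - b z\<bar> \<le> L * t" "0 \<le> t" for z t
  proof (rule ccontr)
    assume "z \<notin> N"
    then have "b z = 0" using b(3) by blast
    then have "1 \<le> L * t" using that b(2) by simp
    moreover have "t * (L + 1) < 1" using that(1) L(1) by (simp add: field_simps)
    ultimately show False using that(3) by (simp add: algebra_simps)
  qed
  show ?thesis
  proof (rule that[of "1 / (L + 1)"])
    show "0 < 1 / (L + 1)" using L by simp
    show "z \<in> N" if "d y z < 1 / (L + 1)" for z
      using far[OF that] L(2)[where z = y and z' = z] d_nonneg by (simp add: abs_minus_commute)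
    show "z \<in> N" if "d z y < 1 / (L + 1)" for z
      using far[OF that] L(2)[where z = z and z' = y] d_nonneg by simp
  qed
qed

text \<open>Chart segments can be traversed in both directions, and the upper bound \<open>K\<close>
  of the Finsler norm makes them short in \<open>d\<close>.\<close>

lemma near_imp_d_small:
  assumes "0 < e"
  obtains N where "open N" "y \<in> N" "\<And>z. z \<in> N \<Longrightarrow> d y z < e \<and> d z y < e"
proof -
  obtain c where c: "c \<in> A" "y \<in> fst c" by (rule chart_at)
  let ?p = "snd c y"
  obtain R where R: "0 < R" "cball ?p R \<subseteq> snd c ` (fst c \<inter> UNIV)"
    using chart_cball[OF c open_UNIV] by blast
  then have sub: "cball ?p R \<subseteq> snd c ` fst c" by simp
  obtain K where K: "0 < K" "\<And>p w. p \<in> cball ?p R \<Longrightarrow> Fc c (p, w) \<le> K * norm w"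
    using Fc_upper[OF c(1) sub] by blast
  obtain t where t: "0 < t" "\<And>p q q'. p \<in> cball ?p R \<Longrightarrow> q \<in> cball ?p R \<Longrightarrow> q' \<in> cball ?p R \<Longrightarrow>
    dist p q \<le> t \<Longrightarrow> dist p q' \<le> t \<Longrightarrow>
    d (chart_inv c q) (chart_inv c q') \<le> Fc c (p, q' - q) + 1 * norm (q' - q)"
    using d_segment[OF c(1) sub zero_less_one] by blast
  define r where "r = min (min R t) (e / (K + 1))"
  have r: "0 < r" "r \<le> R" "r \<le> t" "r \<le> e / (K + 1)" unfolding r_def using R t K assms by auto
  have small: "d (chart_inv c q) (chart_inv c q') < e"
    if "q \<in> ball ?p r" "q' \<in> ball ?p r" "norm (q' - q) < r" for q q'
  proof -
    have "d (chart_inv c q) (chart_inv c q') \<le> Fc c (?p, q' - q) + 1 * norm (q' - q)"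
      using that r by (intro t(2)) auto
    also have "\<dots> \<le> (K + 1) * norm (q' - q)" using K(2)[of ?p "q' - q"] R(1) by (simp add: algebra_simps)
    also have "\<dots> < (K + 1) * (e / (K + 1))" using that r K by (intro mult_strict_left_mono) auto
    also have "\<dots> = e" using K by simp
    finally show ?thesis .
  qed
  show ?thesis
  proof (rule that[of "{z \<in> fst c. snd c z \<in> ball ?p r}"])
    show "open {z \<in> fst c. snd c z \<in> ball ?p r}" by (rule open_chart_preimage[OF c(1) open_ball])
    show "y \<in> {z \<in> fst c. snd c z \<in> ball ?p r}" using c r by simp
    fix z assume "z \<in> {z \<in> fst c. snd c z \<in> ball ?p r}"
    then show "d y z < e \<and> d z y < e"
      using small[of ?p "snd c z"] small[of "snd c z" ?p] r(1) chart_inv_chart[OF c(1)] c(2)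
      by (auto simp: dist_norm norm_minus_commute)
  qed
qed

lemma bilipschitz_const: "bilipschitz (\<lambda>z. k)"
  unfolding bilipschitz_def by (auto intro!: exI[of _ 0])

lemma bilipschitz_mult:
  assumes "bilipschitz f" "bilipschitz g" and f: "\<And>z. \<bar>f z\<bar> \<le> a" and g: "\<And>z. \<bar>g z\<bar> \<le> b"
  shows "bilipschitz (\<lambda>z. f z * g z)"
proof -
  obtain L M where L: "0 \<le> L" "\<And>z z'. \<bar>f z' - f z\<bar> \<le> L * d z z'"
    and M: "0 \<le> M" "\<And>z z'. \<bar>g z' - g z\<bar> \<le> M * d z z'"
    using assms(1,2) unfolding bilipschitz_def by blast
  have ab: "0 \<le> a" "0 \<le> b" using f g abs_ge_zero order_trans by blast+
  have "\<bar>f z' * g z' - f z * g z\<bar> \<le> (a * M + b * L) * d z z'" for z z'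
  proof -
    have "f z' * g z' - f z * g z = f z' * (g z' - g z) + g z * (f z' - f z)" by (simp add: algebra_simps)
    then have "\<bar>f z' * g z' - f z * g z\<bar> \<le> \<bar>f z'\<bar> * \<bar>g z' - g z\<bar> + \<bar>g z\<bar> * \<bar>f z' - f z\<bar>"
      by (simp add: abs_triangle_ineq abs_mult[symmetric])
    also have "\<dots> \<le> a * (M * d z z') + b * (L * d z z')"
      using f g L M ab by (intro add_mono mult_mono) auto
    finally show ?thesis by (simp add: algebra_simps)
  qed
  then show ?thesis unfolding bilipschitz_def using L M ab by (intro exI[of _ "a * M + b * L"]) auto
qed

lemma bilipschitz_one_minus:
  assumes "bilipschitz f" shows "bilipschitz (\<lambda>z. 1 - f z)"
proof -
  obtain L where L: "0 \<le> L" "\<And>z z'. \<bar>f z' - f z\<bar> \<le> L * d z z'" using assms unfolding bilipschitz_def by blast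
  have "\<bar>(1 - f z') - (1 - f z)\<bar> \<le> L * d z z'" for z z' using L(2)[of z' z] by (simp add: abs_minus_commute)
  then show ?thesis unfolding bilipschitz_def using L(1) by blast
qed


section \<open>Smooth approximation of semi-Lipschitz functions\<close>

text \<open>\<open>f'\<close> interpolates between \<open>f\<close> and its mollification
  \<open>G\<close> in the chart, with weight \<open>\<eta>\<close>. Increments of the weight
  multiply \<open>G - f\<close>, so this difference is made small in comparison with the Lipschitz
  constant of \<open>\<eta>\<close>. The last two conclusions keep regions where \<open>f\<close> is
  already regular and add regions where \<open>\<eta>\<close> is \<open>1\<close>.\<close>

lemma smoothing_step:
  assumes f: "\<And>z z'. f z' - f z \<le> L * d z z'" "0 \<le> L" and f01: "\<And>z. 0 \<le> f z \<and> f z \<le> 1"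
    and c: "c \<in> A" and r: "0 < r" "r < R" and sub: "cball p0 R \<subseteq> snd c ` fst c"
    and \<eta>: "C1_on \<eta> UNIV" "bilipschitz \<eta>" "\<And>z. 0 \<le> \<eta> z \<and> \<eta> z \<le> 1"
      "\<And>z. \<eta> z \<noteq> 0 \<Longrightarrow> z \<in> fst c \<and> snd c z \<in> cball p0 r"
    and e: "0 < \<epsilon>"
  obtains f' where "\<And>z z'. f' z' - f' z \<le> (L + \<epsilon>) * d z z'" "\<And>z. 0 \<le> f' z \<and> f' z \<le> 1"
    "\<And>z. \<bar>f' z - f z\<bar> \<le> \<epsilon>" "\<And>z. \<eta> z = 0 \<Longrightarrow> f' z = f z"
    "\<And>V. open V \<Longrightarrow> C1_on f V \<Longrightarrow> C1_on f' V"
    "\<And>V. open V \<Longrightarrow> (\<And>z. z \<in> V \<Longrightarrow> \<eta> z = 1) \<Longrightarrow> C1_on f' V"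
proof -
  let ?\<psi> = "chart_inv c"
  obtain M where M: "0 \<le> M" "\<And>z z'. \<bar>\<eta> z' - \<eta> z\<bar> \<le> M * d z z'"
    using \<eta>(2) unfolding bilipschitz_def by blast
  obtain m where m: "0 < m" "\<And>p w. p \<in> cball p0 R \<Longrightarrow> m * norm w \<le> Fc c (p, w)"
    using Fc_lower[OF c sub] by blast
  obtain K where K: "0 < K" "\<And>p w. p \<in> cball p0 R \<Longrightarrow> Fc c (p, w) \<le> K * norm w"
    using Fc_upper[OF c sub] by blast
  \<comment> \<open>The freezing error has relative size \<open>e1 / m\<close> and is to raise the
    slope by at most \<open>\<epsilon> / 2\<close>.\<close>
  define e1 where "e1 = m * \<epsilon> / (2 * (L + 1))"
  have "l * (m * \<epsilon> / (2 * l) / m) = \<epsilon> / 2" if "0 < l" for l using m(1) that by simp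
  from this[of "L + 1"] have e1: "0 < e1" "(L + 1) * (e1 / m) = \<epsilon> / 2"
    unfolding e1_def using m(1) e f(2) by simp_all
  obtain t where t: "0 < t" "\<And>p q q'. p \<in> cball p0 R \<Longrightarrow> q \<in> cball p0 R \<Longrightarrow> q' \<in> cball p0 R \<Longrightarrow>
    dist p q \<le> t \<Longrightarrow> dist p q' \<le> t \<Longrightarrow> d (?\<psi> q) (?\<psi> q') \<le> Fc c (p, q' - q) + e1 * norm (q' - q)"
    using d_segment[OF c sub e1(1)] by blast
  \<comment> \<open>\<open>\<kappa>\<close> will bound \<open>G - f\<close> near the support of
    \<open>\<eta>\<close>. The bound \<open>\<epsilon> / 2\<close> on \<open>M * \<kappa>\<close>
    pays for the increments of the weight; the bound \<open>1\<close> keeps the slope below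
    \<open>L + 1\<close> before the freezing error is applied.\<close>
  define \<kappa> where "\<kappa> = min \<epsilon> (min 1 (\<epsilon> / 2) / (M + 1))"
  have \<kappa>: "0 < \<kappa>" "\<kappa> \<le> \<epsilon>" "M * \<kappa> \<le> 1" "M * \<kappa> \<le> \<epsilon> / 2"
  proof -
    show "0 < \<kappa>" "\<kappa> \<le> \<epsilon>" unfolding \<kappa>_def using e M(1) by auto
    have "\<kappa> \<le> min 1 (\<epsilon> / 2) / (M + 1)" unfolding \<kappa>_def by simp
    then have "M * \<kappa> \<le> M * (min 1 (\<epsilon> / 2) / (M + 1))" using M(1) by (rule mult_left_mono)
    also have "\<dots> = M / (M + 1) * min 1 (\<epsilon> / 2)" by simp
    also have "\<dots> \<le> 1 * min 1 (\<epsilon> / 2)" using M(1) e by (intro mult_right_mono) auto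
    finally show "M * \<kappa> \<le> 1" "M * \<kappa> \<le> \<epsilon> / 2" by auto
  qed
  \<comment> \<open>In the model norm, \<open>H\<close> bounds the change of \<open>f\<close>, read
    in the chart, per unit of displacement.\<close>
  define H where "H = L * (K + e1)"
  have H: "0 \<le> H" unfolding H_def using f(2) K e1 by simp
  \<comment> \<open>The averaging radius leaves room inside the ball of radius \<open>R\<close>,
    keeps two successive moves within \<open>t\<close>, and changes \<open>f\<close> by at most
    \<open>\<kappa>\<close>.\<close>
  define \<tau> where "\<tau> = min (min ((R - r) / 2) (t / 2)) (\<kappa> / (H + 1))"
  have \<tau>: "0 < \<tau>" "r + 2 * \<tau> \<le> R" "2 * \<tau> \<le> t" "H * \<tau> \<le> \<kappa>"
  proof -
    show "0 < \<tau>" unfolding \<tau>_def using r t(1) \<kappa>(1) H by auto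
    have "\<tau> \<le> min ((R - r) / 2) (t / 2)" unfolding \<tau>_def by (rule min.cobounded1)
    then have *: "\<tau> \<le> (R - r) / 2" "\<tau> \<le> t / 2" by (simp_all only: min.bounded_iff)
    show "r + 2 * \<tau> \<le> R" using *(1) by (simp add: field_simps)
    show "2 * \<tau> \<le> t" using *(2) by (simp add: field_simps)
    have "\<tau> \<le> \<kappa> / (H + 1)" unfolding \<tau>_def by (rule min.cobounded2)
    have "H * \<tau> \<le> H * (\<kappa> / (H + 1))" using \<open>\<tau> \<le> \<kappa> / (H + 1)\<close> H by (rule mult_left_mono)
    also have "\<dots> \<le> \<kappa>" using H \<kappa>(1) by (simp add: field_simps)
    finally show "H * \<tau> \<le> \<kappa>" .
  qed
  \<comment> \<open>Radial retraction onto the ball: \<open>mollify\<close> expects a function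
    continuous on the whole model space. On the ball, where values are compared, it is the
    identity.\<close>
  define \<rho> where "\<rho> q = p0 + (R / max R (norm (q - p0))) *\<^sub>R (q - p0)" for q
  have R: "0 < R" using r by simp
  have \<rho>_in: "\<rho> q \<in> cball p0 R" for q
  proof -
    have "dist p0 (\<rho> q) = R / max R (norm (q - p0)) * norm (q - p0)"
      unfolding \<rho>_def using R by (simp add: dist_norm)
    also have "\<dots> \<le> R" using R by (simp add: field_simps max_def)
    finally show ?thesis by simp
  qed
  have \<rho>_id: "\<rho> q = q" if "q \<in> cball p0 R" for q
    using that R unfolding \<rho>_def by (simp add: dist_norm norm_minus_commute max_absorb1)
  have c\<rho>: "continuous_on UNIV \<rho>" unfolding \<rho>_def
    by (intro continuous_intros) (use R in \<open>auto simp: max_def\<close>)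
  have cf: "continuous_on (snd c ` fst c) (\<lambda>q. f (?\<psi> q))"
  proof (rule continuous_on_compose2[OF _ continuous_on_chart_inv[OF c]])
    show "continuous_on UNIV f" unfolding continuous_on_eq_continuous_at[OF open_UNIV]
    proof
      fix y
      show "isCont f y" unfolding isCont_def tendsto_iff
      proof (intro allI impI)
        fix \<delta> :: real assume that: "0 < \<delta>"
        have "0 < \<delta> / (L + 1)" using that f(2) by simp
        then obtain N where N: "open N" "y \<in> N" "\<And>z. z \<in> N \<Longrightarrow> d y z < \<delta> / (L + 1) \<and> d z y < \<delta> / (L + 1)"
          using near_imp_d_small by metis
        have "dist (f z) (f y) < \<delta>" if "z \<in> N" for z
        proof -
          have "L * s < \<delta>" if "s < \<delta> / (L + 1)" "0 \<le> s" for s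
          proof -
            have "(L + 1) * s < \<delta>" using that(1) f(2) by (simp add: field_simps)
            then show ?thesis using that(2) by (simp add: algebra_simps)
          qed
          then have "L * d y z < \<delta>" "L * d z y < \<delta>" using N(3)[OF \<open>z \<in> N\<close>] d_nonneg by auto
          then show ?thesis using f(1)[of z y] f(1)[of y z] by (simp add: dist_real_def abs_less_iff)
        qed
        then show "\<forall>\<^sub>F z in at y. dist (f z) (f y) < \<delta>"
          using N unfolding eventually_at_topological by (intro exI[of _ N]) simp
      qed
    qed
  qed auto
  have "continuous_on UNIV (\<lambda>q. f (?\<psi> (\<rho> q)))"
    by (rule continuous_on_compose2[OF cf c\<rho>]) (use \<rho>_in sub in blast)
  from mollify[OF finite_dimensional this \<tau>(1)] obtain G where G: "Ck_on 1 G UNIV"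
    "\<And>p K. (\<And>w. norm w \<le> \<tau> \<Longrightarrow> f (?\<psi> (\<rho> (p + w))) \<le> K) \<Longrightarrow> G p \<le> K"
    "\<And>p K. (\<And>w. norm w \<le> \<tau> \<Longrightarrow> K \<le> f (?\<psi> (\<rho> (p + w)))) \<Longrightarrow> K \<le> G p"
    "\<And>p p' K. (\<And>w. norm w \<le> \<tau> \<Longrightarrow> f (?\<psi> (\<rho> (p' + w))) - f (?\<psi> (\<rho> (p + w))) \<le> K) \<Longrightarrow> G p' - G p \<le> K"
    by metis
  have G01: "0 \<le> G q \<and> G q \<le> 1" for q using G(2)[where K = 1] G(3)[where K = 0] f01 by blast
  have move: "q + w \<in> cball p0 R" "dist p (q + w) \<le> t"
    if "p \<in> cball p0 r" "q \<in> cball p \<tau>" "norm w \<le> \<tau>" for p q w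
  proof -
    have "dist p (q + w) \<le> 2 * \<tau>" using dist_triangle[of p "q + w" q] that by (simp add: dist_norm)
    then show "q + w \<in> cball p0 R" "dist p (q + w) \<le> t"
      using dist_triangle[of p0 "q + w" p] that(1) \<tau> by auto
  qed
  have in_R: "q \<in> cball p0 R" if "p \<in> cball p0 r" "q \<in> cball p \<tau>" for p q
    using move(1)[OF that, of 0] \<tau>(1) by simp
  define E where "E p v = Fc c (p, v) + e1 * norm v" for p v
  have fE: "f (?\<psi> (q' + w)) - f (?\<psi> (q + w)) \<le> L * E p (q' - q)" and dE: "d (?\<psi> q) (?\<psi> q') \<le> E p (q' - q)"
    if "p \<in> cball p0 r" "q \<in> cball p \<tau>" "q' \<in> cball p \<tau>" "norm w \<le> \<tau>" for p q q' w
  proof -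
    have p: "p \<in> cball p0 R" using that(1) r by auto
    have *: "d (?\<psi> (q + w)) (?\<psi> (q' + w)) \<le> E p (q' - q)" if "norm w \<le> \<tau>" for w
      using t(2)[OF p move(1)[OF \<open>p \<in> cball p0 r\<close> \<open>q \<in> cball p \<tau>\<close> that]
          move(1)[OF \<open>p \<in> cball p0 r\<close> \<open>q' \<in> cball p \<tau>\<close> that]]
        move(2)[OF \<open>p \<in> cball p0 r\<close> _ that] \<open>q \<in> cball p \<tau>\<close> \<open>q' \<in> cball p \<tau>\<close>
      unfolding E_def by simp
    show "f (?\<psi> (q' + w)) - f (?\<psi> (q + w)) \<le> L * E p (q' - q)"
      using f(1) mult_left_mono[OF *[OF \<open>norm w \<le> \<tau>\<close>] f(2)] by (rule order_trans)
    show "d (?\<psi> q) (?\<psi> q') \<le> E p (q' - q)" using *[of 0] \<tau>(1) by simp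
  qed
  \<comment> \<open>Translation by a common \<open>w\<close> does not change \<open>q' - q\<close>,
    so all translates obey the same bound and the average inherits it.\<close>
  have GE: "G q' - G q \<le> L * E p (q' - q)"
    if "p \<in> cball p0 r" "q \<in> cball p \<tau>" "q' \<in> cball p \<tau>" for p q q'
  proof (rule G(4))
    fix w :: 'e assume w: "norm w \<le> \<tau>"
    show "f (?\<psi> (\<rho> (q' + w))) - f (?\<psi> (\<rho> (q + w))) \<le> L * E p (q' - q)"
      using fE[OF that w] \<rho>_id[OF move(1)[OF that(1,2) w]] \<rho>_id[OF move(1)[OF that(1,3) w]] by simp
  qed
  have close: "\<bar>G q - f (?\<psi> q)\<bar> \<le> \<kappa>" if q: "p \<in> cball p0 r" "q \<in> cball p \<tau>" for p q
  proof -
    have E\<kappa>: "L * (Fc c (p', v) + e1 * norm v) \<le> \<kappa>" if "norm v \<le> \<tau>" "p' \<in> cball p0 R" for v p'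
    proof -
      have "Fc c (p', v) + e1 * norm v \<le> (K + e1) * norm v" using K(2)[OF that(2), of v] by (simp add: algebra_simps)
      also have "\<dots> \<le> (K + e1) * \<tau>" using that(1) K e1 by (intro mult_left_mono) auto
      finally have "L * (Fc c (p', v) + e1 * norm v) \<le> H * \<tau>"
        unfolding H_def using f(2) by (simp add: mult_left_mono mult.assoc)
      then show ?thesis using \<tau>(4) by simp
    qed
    have qR: "q \<in> cball p0 R" by (rule in_R[OF q])
    have *: "\<bar>f (?\<psi> (q + w)) - f (?\<psi> q)\<bar> \<le> \<kappa>" if w: "norm w \<le> \<tau>" for w
    proof -
      have qw: "q + w \<in> cball p0 R" by (rule move(1)[OF q w])
      have "d (?\<psi> q) (?\<psi> (q + w)) \<le> Fc c (q, w) + e1 * norm w"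
        using t(2)[OF qR qR qw] w \<tau> t(1) by (simp add: dist_norm)
      then have "f (?\<psi> (q + w)) - f (?\<psi> q) \<le> L * (Fc c (q, w) + e1 * norm w)"
        using f mult_left_mono order_trans by blast
      moreover have "d (?\<psi> (q + w)) (?\<psi> q) \<le> Fc c (q, - w) + e1 * norm (- w)"
        using t(2)[OF qR qw qR] w \<tau> t(1) by (simp add: dist_norm)
      then have "f (?\<psi> q) - f (?\<psi> (q + w)) \<le> L * (Fc c (q, - w) + e1 * norm (- w))"
        using f mult_left_mono order_trans by blast
      ultimately show ?thesis using E\<kappa>[of w, OF _ qR] E\<kappa>[of "- w", OF _ qR] w by (simp add: abs_le_iff)
    qed
    have "G q \<le> f (?\<psi> q) + \<kappa>"
    proof (rule G(2))
      fix w :: 'e assume w: "norm w \<le> \<tau>"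
      show "f (?\<psi> (\<rho> (q + w))) \<le> f (?\<psi> q) + \<kappa>"
        using *[OF w] \<rho>_id[OF move(1)[OF q w]] by (simp add: abs_le_iff)
    qed
    moreover have "f (?\<psi> q) - \<kappa> \<le> G q"
    proof (rule G(3))
      fix w :: 'e assume w: "norm w \<le> \<tau>"
      show "f (?\<psi> q) - \<kappa> \<le> f (?\<psi> (\<rho> (q + w)))"
        using *[OF w] \<rho>_id[OF move(1)[OF q w]] by (simp add: abs_le_iff)
    qed
    ultimately show ?thesis by (simp add: abs_le_iff)
  qed
  define f' where "f' z = (if z \<in> fst c then (1 - \<eta> z) * f z + \<eta> z * G (snd c z) else f z)" for z
  let ?S = "?\<psi> ` cball p0 r"
  have sub': "cball p0 r \<subseteq> snd c ` fst c" using sub r by auto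
  have f'_out: "f' z = f z" if "\<eta> z = 0" for z using that unfolding f'_def by simp
  have f'_out': "f' z = f z" if "z \<in> - ?S" for z
    using that f'_out \<eta>(4) chart_cball_iff[OF c sub'] by blast
  show ?thesis
  proof (rule that[of f'])
    show "0 \<le> f' z \<and> f' z \<le> 1" for z
    proof -
      have "0 \<le> (1 - \<eta> z) * f z + \<eta> z * G (snd c z)" using \<eta>(3) f01 G01 by simp
      moreover have "(1 - \<eta> z) * f z + \<eta> z * G (snd c z) \<le> (1 - \<eta> z) * 1 + \<eta> z * 1"
        using \<eta>(3)[of z] f01[of z] G01[of "snd c z"] by (intro add_mono mult_left_mono) auto
      ultimately show ?thesis using f01 unfolding f'_def by simp
    qed
    show "\<bar>f' z - f z\<bar> \<le> \<epsilon>" for z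
    proof (cases "\<eta> z = 0")
      case False
      then have z: "z \<in> fst c" "snd c z \<in> cball p0 r" using \<eta>(4) by auto
      have "f' z - f z = \<eta> z * (G (snd c z) - f z)" unfolding f'_def using z by (simp add: algebra_simps)
      then have "\<bar>f' z - f z\<bar> = \<eta> z * \<bar>G (snd c z) - f z\<bar>" using \<eta>(3)[of z] by (simp add: abs_mult)
      also have "\<dots> \<le> 1 * \<kappa>"
        using close[OF z(2), of "snd c z"] chart_inv_chart[OF c z(1)] \<eta>(3)[of z] \<tau>(1)
        by (intro mult_mono) auto
      finally show ?thesis using \<kappa> by simp
    qed (use f'_out e in simp)
    show "f' z = f z" if "\<eta> z = 0" for z by (rule f'_out[OF that])
    have C1G: "C1_on (\<lambda>z. G (snd c z)) (fst c)" by (rule C1_on_chart[OF c G(1)])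
    show "C1_on f' V" if V: "open V" "C1_on f V" for V
    proof (rule C1_on_local)
      fix y assume y: "y \<in> V"
      show "\<exists>N g. open N \<and> y \<in> N \<and> C1_on g N \<and> (\<forall>z\<in>N. f' z = g z)"
      proof (cases "y \<in> fst c")
        case True
        have "C1_on (\<lambda>z. (1 - \<eta> z) * f z + \<eta> z * G (snd c z)) (V \<inter> fst c)"
          by (intro C1_on_add C1_on_mult C1_on_diff C1_on_const)
            (auto intro: C1_on_subset[OF \<eta>(1)] C1_on_subset[OF V(2)] C1_on_subset[OF C1G])
        then show ?thesis
          by (intro exI[of _ "V \<inter> fst c"] exI[of _ "\<lambda>z. (1 - \<eta> z) * f z + \<eta> z * G (snd c z)"])
            (use True y V open_chart[OF c] in \<open>auto simp: f'_def\<close>)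
      next
        case False
        then have "y \<in> - ?S" using chart_cball_iff[OF c sub'] by blast
        then show ?thesis
          by (intro exI[of _ "V \<inter> - ?S"] exI[of _ f])
            (use y V f'_out' closed_chart_cball[OF c sub'] in \<open>auto intro: C1_on_subset\<close>)
      qed
    qed
    show "C1_on f' V" if V: "open V" "\<And>z. z \<in> V \<Longrightarrow> \<eta> z = 1" for V
    proof (rule C1_on_local)
      fix y assume y: "y \<in> V"
      have "V \<subseteq> fst c" using V(2) \<eta>(4) by force
      moreover have "f' z = G (snd c z)" if "z \<in> V" for z
        using that V(2) \<open>V \<subseteq> fst c\<close> unfolding f'_def by auto
      ultimately show "\<exists>N g. open N \<and> y \<in> N \<and> C1_on g N \<and> (\<forall>z\<in>N. f' z = g z)"
        by (intro exI[of _ V] exI[of _ "\<lambda>z. G (snd c z)"]) (use y V(1) C1_on_subset[OF C1G] in auto)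
    qed
    show "f' z' - f' z \<le> (L + \<epsilon>) * d z z'" for z z'
    proof (rule slope_le_imp_lipschitz)
      show "0 \<le> L + \<epsilon>" using f(2) e by simp
      fix y
      show "\<exists>c\<in>A. y \<in> fst c \<and> slope_le f' (L + \<epsilon>) c y"
      proof (cases "y \<in> ?S")
        case False
        obtain c' where c': "c' \<in> A" "y \<in> fst c'" by (rule chart_at)
        have "slope_le f' (L + \<epsilon>) c' y"
        proof (rule lipschitz_imp_slope_le[OF _ _ _ _ c'])
          fix z z' assume "z \<in> - ?S" "z' \<in> - ?S"
          then have "f' z' - f' z \<le> L * d z z'" using f(1) f'_out' by simp
          also have "\<dots> \<le> (L + \<epsilon>) * d z z'" using e d_nonneg by (intro mult_right_mono) auto
          finally show "f' z' - f' z \<le> (L + \<epsilon>) * d z z'" .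
        qed (use False f(2) e closed_chart_cball[OF c sub'] in auto)
        then show ?thesis using c' by blast
      next
        case True
        then have y: "y \<in> fst c" "snd c y \<in> cball p0 r" using chart_cball_iff[OF c sub'] by auto
        let ?p = "snd c y"
        have "slope_le f' (L + \<epsilon>) c y" unfolding slope_le_def
        proof (intro allI impI exI[of _ \<tau>] conjI ballI \<tau>(1))
          fix e' :: real and q q' assume e': "0 < e'" and q: "q \<in> ball ?p \<tau>" "q' \<in> ball ?p \<tau>"
          have q: "q \<in> cball ?p \<tau>" "q' \<in> cball ?p \<tau>" using q by auto
          let ?z = "?\<psi> q" and ?z' = "?\<psi> q'"
          have z: "?z \<in> fst c" "snd c ?z = q" "?z' \<in> fst c" "snd c ?z' = q'"
            using in_R[OF y(2) q(1)] in_R[OF y(2) q(2)] sub chart_inv_in[OF c] chart_chart_inv[OF c] by auto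
          have dE': "d ?z ?z' \<le> E ?p (q' - q)" using dE[OF y(2) q, of 0] \<tau>(1) by simp
          have fE': "f ?z' - f ?z \<le> L * E ?p (q' - q)" using fE[OF y(2) q, of 0] \<tau>(1) by simp
          have E0: "0 \<le> E ?p (q' - q)" using dE' d_nonneg order_trans by blast
          have \<eta>E: "\<bar>\<eta> ?z' - \<eta> ?z\<bar> \<le> M * E ?p (q' - q)"
            using M(2) mult_left_mono[OF dE' M(1)] by (rule order_trans)
          \<comment> \<open>Product rule for increments: the first two summands are governed by the
            slopes of \<open>f\<close> and \<open>G\<close>, the last one by the closeness
            \<open>\<kappa>\<close>.\<close>
          have "f' ?z' - f' ?z = (1 - \<eta> ?z') * (f ?z' - f ?z) + \<eta> ?z' * (G q' - G q)
              + (\<eta> ?z' - \<eta> ?z) * (G q - f ?z)"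
            unfolding f'_def using z by (simp add: algebra_simps)
          also have "\<dots> \<le> (1 - \<eta> ?z') * (L * E ?p (q' - q)) + \<eta> ?z' * (L * E ?p (q' - q))
              + (M * E ?p (q' - q)) * \<kappa>"
          proof (intro add_mono mult_left_mono)
            have "(\<eta> ?z' - \<eta> ?z) * (G q - f ?z) \<le> \<bar>\<eta> ?z' - \<eta> ?z\<bar> * \<bar>G q - f ?z\<bar>"
              by (simp add: abs_mult[symmetric])
            also have "\<dots> \<le> (M * E ?p (q' - q)) * \<kappa>"
              using \<eta>E close[OF y(2) q(1)] M(1) E0 by (intro mult_mono) auto
            finally show "(\<eta> ?z' - \<eta> ?z) * (G q - f ?z) \<le> (M * E ?p (q' - q)) * \<kappa>" .
          qed (use fE' GE[OF y(2) q] \<eta>(3) in auto)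
          also have "\<dots> = (L + M * \<kappa>) * E ?p (q' - q)" by (simp add: algebra_simps)
          also have "\<dots> \<le> (L + M * \<kappa>) * ((1 + e1 / m) * Fc c (?p, q' - q))"
          proof (rule mult_left_mono)
            have "m * norm (q' - q) \<le> Fc c (?p, q' - q)" using m(2)[of ?p] y(2) r by auto
            then have "e1 / m * (m * norm (q' - q)) \<le> e1 / m * Fc c (?p, q' - q)"
              using e1 m by (intro mult_left_mono) auto
            then show "E ?p (q' - q) \<le> (1 + e1 / m) * Fc c (?p, q' - q)"
              unfolding E_def using m by (simp add: algebra_simps)
            show "0 \<le> L + M * \<kappa>" using f(2) M \<kappa> by simp
          qed
          also have "\<dots> = ((L + M * \<kappa>) * (1 + e1 / m)) * Fc c (?p, q' - q)" by (simp add: mult.assoc)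
          also have "\<dots> \<le> (L + \<epsilon>) * Fc c (?p, q' - q)"
          proof (rule mult_right_mono)
            have "(L + M * \<kappa>) * (e1 / m) \<le> (L + 1) * (e1 / m)"
              using \<kappa>(3) e1 m by (intro mult_right_mono) auto
            then show "(L + M * \<kappa>) * (1 + e1 / m) \<le> L + \<epsilon>"
              using e1(2) \<kappa>(4) by (simp add: distrib_left)
            show "0 \<le> Fc c (?p, q' - q)" using Fc_nonneg[OF c] y(1) by simp
          qed
          also have "\<dots> \<le> (L + \<epsilon>) * Fc c (?p, q' - q) + e' * norm (q' - q)" using e' by simp
          finally show "f' ?z' - f' ?z \<le> (L + \<epsilon>) * Fc c (?p, q' - q) + e' * norm (q' - q)" .
        qed
        then show ?thesis using c y by blast
      qed
    qed
  qed
qed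

text \<open>
  The smoothing steps are carried out in countably many charts; the \<open>k\<close>-th cut-off vanishes where the
  earlier cores were, so that the sequence of functions is eventually constant near every point.
\<close>

lemma smooth_approximation:
  assumes f: "\<And>z z'. f z' - f z \<le> L * d z z'" "0 \<le> L" and f01: "\<And>z. 0 \<le> f z \<and> f z \<le> 1"
    and \<epsilon>: "0 < \<epsilon>"
  obtains g where "C1_on g UNIV" "\<And>z z'. g z' - g z \<le> (L + \<epsilon>) * d z z'"
    "\<And>z. 0 \<le> g z \<and> g z \<le> 1" "\<And>z. \<bar>g z - f z\<bar> \<le> \<epsilon>"
proof -
  have "\<exists>c R. c \<in> A \<and> y \<in> fst c \<and> 0 < R \<and> cball (snd c y) (4 * R) \<subseteq> snd c ` fst c" for y
  proof -
    obtain c where c: "c \<in> A" "y \<in> fst c" by (rule chart_at)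
    obtain R where "0 < R" "cball (snd c y) R \<subseteq> snd c ` (fst c \<inter> UNIV)"
      using chart_cball[OF c open_UNIV] by blast
    then show ?thesis using c by (intro exI[of _ c] exI[of _ "R / 4"]) simp
  qed
  then obtain C R where CR: "\<And>y. C y \<in> A" "\<And>y. y \<in> fst (C y)" "\<And>y. 0 < R y"
    "\<And>y. cball (snd (C y) y) (4 * R y) \<subseteq> snd (C y) ` fst (C y)"
    by metis
  \<comment> \<open>Nested radii in units of \<open>R y\<close>: the sets of radius \<open>1\<close>
    will cover, \<open>a\<close> lives within \<open>3 / 2\<close>, regularity is gained on radius
    \<open>2\<close>, \<open>e\<close> lives within \<open>3\<close>, and the chart contains radius
    \<open>4\<close>.\<close>
  define W where "W k y = {z \<in> fst (C y). snd (C y) z \<in> ball (snd (C y) y) (k * R y)}" for k y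
  have openW: "open (W k y)" for k y unfolding W_def by (rule open_chart_preimage[OF CR(1) open_ball])
  have sub: "cball (snd (C y) y) (k * R y) \<subseteq> snd (C y) ` fst (C y)" if "k \<le> 4" for k y
  proof -
    have "k * R y \<le> 4 * R y" using that CR(3)[of y] by (intro mult_right_mono) auto
    then show ?thesis using CR(4)[of y] subset_cball by blast
  qed
  \<comment> \<open>Second countability enters through Lindelof's theorem; the enumeration of the
    subcover may repeat its members.\<close>
  have cover: "\<exists>Y::nat \<Rightarrow> 'a. (\<Union>n. W 1 (Y n)) = UNIV"
  proof -
    obtain F' where F': "F' \<subseteq> range (W 1)" "countable F'" "\<Union>F' = \<Union>(range (W 1))"
      using Lindelof[of "range (W 1)"] openW by blast
    have "y \<in> W 1 y" for y using CR(2,3)[of y] unfolding W_def by simp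
    then have U: "\<Union>F' = UNIV" unfolding F'(3) by blast
    then have ne: "F' \<noteq> {}" by auto
    have "\<forall>n. \<exists>y. from_nat_into F' n = W 1 y"
      using F'(1) from_nat_into[OF ne] by blast
    then obtain Y where Y: "\<And>n. from_nat_into F' n = W 1 (Y n)" by metis
    have "(\<Union>n. W 1 (Y n)) = \<Union>(range (from_nat_into F'))" by (simp add: Y)
    also have "\<dots> = UNIV" using range_from_nat_into[OF ne F'(2)] U by simp
    finally show ?thesis by blast
  qed
  then obtain Y :: "nat \<Rightarrow> 'a" where Y: "(\<Union>n. W 1 (Y n)) = UNIV" by blast
  have "\<exists>b. C1_on b UNIV \<and> bilipschitz b \<and> (\<forall>z. 0 \<le> b z \<and> b z \<le> 1) \<and> (\<forall>z\<in>W s y. b z = 1) \<and>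
      (\<forall>z. b z \<noteq> 0 \<longrightarrow> z \<in> fst (C y) \<and> snd (C y) z \<in> cball (snd (C y) y) (s' * R y))"
    if "0 < s" "s < s'" "s' \<le> 4" for s s' y
  proof -
    have "0 < s * R y" "s * R y < s' * R y" using that CR(3)[of y] by simp_all
    from bump[OF CR(1,2) this sub[OF that(3)]] obtain b where b: "C1_on b UNIV" "bilipschitz b"
      "\<And>z. 0 \<le> b z \<and> b z \<le> 1"
      "\<And>z. z \<in> fst (C y) \<Longrightarrow> snd (C y) z \<in> cball (snd (C y) y) (s * R y) \<Longrightarrow> b z = 1"
      "\<And>z. b z \<noteq> 0 \<Longrightarrow> z \<in> fst (C y) \<and> snd (C y) z \<in> cball (snd (C y) y) (s' * R y)"
      by blast
    have "\<forall>z\<in>W s y. b z = 1" using b(4) unfolding W_def by simp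
    then show ?thesis using b(1-3,5) by blast
  qed
  note bumps = this
  have "\<forall>n. \<exists>b. C1_on b UNIV \<and> bilipschitz b \<and> (\<forall>z. 0 \<le> b z \<and> b z \<le> 1) \<and> (\<forall>z\<in>W 2 (Y n). b z = 1) \<and>
      (\<forall>z. b z \<noteq> 0 \<longrightarrow> z \<in> fst (C (Y n)) \<and> snd (C (Y n)) z \<in> cball (snd (C (Y n)) (Y n)) (3 * R (Y n)))"
    using bumps[of 2 3] by simp
  from choice[OF this] obtain e where e: "\<And>n. C1_on (e n) UNIV" "\<And>n. bilipschitz (e n)"
    "\<And>n z. 0 \<le> e n z \<and> e n z \<le> 1" "\<And>n z. z \<in> W 2 (Y n) \<Longrightarrow> e n z = 1"
    "\<And>n z. e n z \<noteq> 0 \<Longrightarrow> z \<in> fst (C (Y n)) \<and> snd (C (Y n)) z \<in> cball (snd (C (Y n)) (Y n)) (3 * R (Y n))"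
    by blast
  have "\<forall>n. \<exists>b. C1_on b UNIV \<and> bilipschitz b \<and> (\<forall>z. 0 \<le> b z \<and> b z \<le> 1) \<and> (\<forall>z\<in>W 1 (Y n). b z = 1) \<and>
      (\<forall>z. b z \<noteq> 0 \<longrightarrow> z \<in> fst (C (Y n)) \<and> snd (C (Y n)) z \<in> cball (snd (C (Y n)) (Y n)) (3 / 2 * R (Y n)))"
    using bumps[of 1 "3 / 2"] by simp
  from choice[OF this] obtain a where a: "\<And>n. C1_on (a n) UNIV" "\<And>n. bilipschitz (a n)"
    "\<And>n z. 0 \<le> a n z \<and> a n z \<le> 1" "\<And>n z. z \<in> W 1 (Y n) \<Longrightarrow> a n z = 1"
    "\<And>n z. a n z \<noteq> 0 \<Longrightarrow> z \<in> fst (C (Y n)) \<and> snd (C (Y n)) z \<in> cball (snd (C (Y n)) (Y n)) (3 / 2 * R (Y n))"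
    by blast
  define D where "D n = chart_inv (C (Y n)) ` cball (snd (C (Y n)) (Y n)) (3 / 2 * R (Y n))" for n
  have D: "closed (D n)" "D n \<subseteq> W 2 (Y n)" "\<And>z. z \<notin> D n \<Longrightarrow> a n z = 0" for n
  proof -
    have s: "cball (snd (C (Y n)) (Y n)) (3 / 2 * R (Y n)) \<subseteq> snd (C (Y n)) ` fst (C (Y n))" by (rule sub) simp
    show "closed (D n)" unfolding D_def by (rule closed_chart_cball[OF CR(1) s])
    show "D n \<subseteq> W 2 (Y n)"
    proof
      fix z assume "z \<in> D n"
      then have "z \<in> fst (C (Y n)) \<and> dist (snd (C (Y n)) (Y n)) (snd (C (Y n)) z) \<le> 3 / 2 * R (Y n)"
        unfolding D_def using chart_cball_iff[OF CR(1) s] by simp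
      moreover have "3 / 2 * R (Y n) < 2 * R (Y n)" using CR(3)[of "Y n"] by simp
      ultimately show "z \<in> W 2 (Y n)" unfolding W_def by simp
    qed
    show "a n z = 0" if "z \<notin> D n" for z
      using that a(5)[of n z] chart_cball_iff[OF CR(1) s] unfolding D_def by blast
  qed
  \<comment> \<open>\<open>P n\<close> vanishes on the cores \<open>W 1 (Y j)\<close> with
    \<open>j < n\<close> and is \<open>1\<close> outside the corresponding closed sets
    \<open>D j\<close>.\<close>
  define P where "P n z = (\<Prod>j<n. 1 - a j z)" for n z
  have P: "C1_on (P n) UNIV \<and> bilipschitz (P n) \<and> (\<forall>z. 0 \<le> P n z \<and> P n z \<le> 1)" for n
  proof (induction n)
    case 0
    have "P 0 = (\<lambda>z. 1)" unfolding P_def by auto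
    then show ?case using C1_on_const bilipschitz_const by simp
  next
    case (Suc n)
    have PS: "P (Suc n) = (\<lambda>z. P n z * (1 - a n z))" unfolding P_def by auto
    have "\<bar>P n z\<bar> \<le> 1" "\<bar>1 - a n z\<bar> \<le> 1" for z using Suc a(3)[of n z] by (auto simp: abs_le_iff)
    then have "bilipschitz (P (Suc n))" unfolding PS
      using Suc bilipschitz_one_minus[OF a(2)] by (intro bilipschitz_mult) auto
    moreover have "C1_on (P (Suc n)) UNIV" unfolding PS
      using Suc by (intro C1_on_mult C1_on_diff C1_on_const a(1)) auto
    moreover have "0 \<le> P (Suc n) z \<and> P (Suc n) z \<le> 1" for z
      unfolding PS using Suc a(3)[of n z] by (auto intro: mult_le_one)
    ultimately show ?case by blast
  qed
  define \<eta> where "\<eta> n z = e n z * P n z" for n z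
  have \<eta>: "C1_on (\<eta> n) UNIV" "bilipschitz (\<eta> n)" "\<And>z. 0 \<le> \<eta> n z \<and> \<eta> n z \<le> 1"
    "\<And>z. \<eta> n z \<noteq> 0 \<Longrightarrow> z \<in> fst (C (Y n)) \<and> snd (C (Y n)) z \<in> cball (snd (C (Y n)) (Y n)) (3 * R (Y n))" for n
  proof -
    show "C1_on (\<eta> n) UNIV" unfolding \<eta>_def using P by (intro C1_on_mult e) auto
    have "\<bar>P n z\<bar> \<le> 1" "\<bar>e n z\<bar> \<le> 1" for z using P e(3)[of n z] by (auto simp: abs_le_iff)
    then show "bilipschitz (\<eta> n)" unfolding \<eta>_def using P e(2) by (intro bilipschitz_mult) auto
    show "0 \<le> \<eta> n z \<and> \<eta> n z \<le> 1" for z unfolding \<eta>_def using P e(3) by (auto intro: mult_le_one)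
    show "z \<in> fst (C (Y n)) \<and> snd (C (Y n)) z \<in> cball (snd (C (Y n)) (Y n)) (3 * R (Y n))"
      if "\<eta> n z \<noteq> 0" for z
      using that unfolding \<eta>_def by (intro e(5)) auto
  qed
  \<comment> \<open>The error is spent geometrically: step \<open>k\<close> uses
    \<open>\<delta> k\<close>, and the partial sums \<open>E k\<close> stay at most
    \<open>\<epsilon>\<close>.\<close>
  define E where "E k = \<epsilon> * (1 - (1/2)^k)" for k :: nat
  define \<delta> where "\<delta> k = \<epsilon> * (1/2)^(Suc k)" for k :: nat
  have E: "E (Suc k) = E k + \<delta> k" "0 < \<delta> k" "0 \<le> E k" "E k \<le> \<epsilon>" for k
    unfolding E_def \<delta>_def using \<epsilon> by (auto simp: algebra_simps power_le_one mult_left_le)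
  define good where "good k g \<longleftrightarrow> (\<forall>z z'. g z' - g z \<le> (L + E k) * d z z') \<and> (\<forall>z. 0 \<le> g z \<and> g z \<le> 1) \<and>
    (\<forall>z. \<bar>g z - f z\<bar> \<le> E k) \<and> C1_on g (\<Union>j<k. W 2 (Y j))" for k :: nat and g
  have "\<exists>G. \<forall>n. good n (G n) \<and> (\<forall>z. \<eta> n z = 0 \<longrightarrow> G (Suc n) z = G n z)"
  proof (rule dependent_nat_choice)
    have "good 0 f" unfolding good_def E_def using f f01 by (simp add: C1_on_def Ck_on_1_unfold)
    then show "\<exists>g. good 0 g" by blast
  next
    fix g k assume g: "good k g"
    have r: "0 < 3 * R (Y k)" "3 * R (Y k) < 4 * R (Y k)" using CR(3)[of "Y k"] by simp_all
    have lip: "g z' - g z \<le> (L + E k) * d z z'" and g01: "0 \<le> g z \<and> g z \<le> 1" for z z'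
      using g unfolding good_def by auto
    have LE: "0 \<le> L + E k" using f(2) E(3) by simp
    obtain g' where g': "\<And>z z'. g' z' - g' z \<le> (L + E k + \<delta> k) * d z z'" "\<And>z. 0 \<le> g' z \<and> g' z \<le> 1"
      "\<And>z. \<bar>g' z - g z\<bar> \<le> \<delta> k" "\<And>z. \<eta> k z = 0 \<Longrightarrow> g' z = g z"
      "\<And>V. open V \<Longrightarrow> C1_on g V \<Longrightarrow> C1_on g' V"
      "\<And>V. open V \<Longrightarrow> (\<And>z. z \<in> V \<Longrightarrow> \<eta> k z = 1) \<Longrightarrow> C1_on g' V"
      using smoothing_step[OF lip LE g01 CR(1)[of "Y k"] r CR(4)[of "Y k"] \<eta>[of k] E(2)[of k]] by metis
    have "C1_on g' (\<Union>j<Suc k. W 2 (Y j))"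
    proof (rule C1_on_local)
      fix y assume y: "y \<in> (\<Union>j<Suc k. W 2 (Y j))"
      show "\<exists>N h. open N \<and> y \<in> N \<and> C1_on h N \<and> (\<forall>z\<in>N. g' z = h z)"
      proof (cases "y \<in> (\<Union>j<k. W 2 (Y j))")
        case True
        have "open (\<Union>j<k. W 2 (Y j))" using openW by blast
        moreover from this have "C1_on g' (\<Union>j<k. W 2 (Y j))" using g by (intro g'(5)) (auto simp: good_def)
        ultimately show ?thesis using True by blast
      next
        case False
        \<comment> \<open>A point outside the earlier \<open>W 2 (Y j)\<close> avoids the closed
          \<open>D j\<close> inside them, so on a whole neighbourhood of it both factors of
          \<open>\<eta> k\<close> are \<open>1\<close>.\<close>
        define N where "N = W 2 (Y k) - (\<Union>j<k. D j)"
        have "open N" unfolding N_def using openW D(1) by (intro open_Diff closed_UN) auto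
        moreover have "y \<in> N" unfolding N_def using y False D(2) by (auto simp: lessThan_Suc)
        moreover have "\<eta> k z = 1" if "z \<in> N" for z
        proof -
          have "a j z = 0" if "j < k" for j using \<open>z \<in> N\<close> that D(3) unfolding N_def by blast
          then have "P k z = 1" unfolding P_def by simp
          then show ?thesis using e(4) that unfolding \<eta>_def N_def by simp
        qed
        ultimately show ?thesis using g'(6) by blast
      qed
    qed
    moreover have "\<bar>g' z - f z\<bar> \<le> E (Suc k)" for z
    proof -
      have "\<bar>g z - f z\<bar> \<le> E k" using g unfolding good_def by blast
      then show ?thesis using g'(3)[of z] unfolding E(1) by linarith
    qed
    ultimately have "good (Suc k) g'" unfolding good_def E(1) using g'(1,2) by (simp add: add.assoc)
    then show "\<exists>g'. good (Suc k) g' \<and> (\<forall>z. \<eta> k z = 0 \<longrightarrow> g' z = g z)" using g'(4) by blast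
  qed
  then obtain G where G: "\<And>n. good n (G n)" "\<And>n z. \<eta> n z = 0 \<Longrightarrow> G (Suc n) z = G n z" by blast
  \<comment> \<open>Every later cut-off contains the factor \<open>1 - a j\<close>, which is zero on
    \<open>W 1 (Y j)\<close>.\<close>
  have stable: "G k z = G (Suc j) z" if "z \<in> W 1 (Y j)" "Suc j \<le> k" for z j k
    using that(2)
  proof (induction k rule: dec_induct)
    case (step k)
    have "P k z = 0" unfolding P_def using a(4)[OF that(1)] step(1) by (intro prod_zero bexI[of _ j]) auto
    then show ?case using step(3) G(2)[of k z] unfolding \<eta>_def by simp
  qed simp
  define J where "J z = (SOME j. z \<in> W 1 (Y j))" for z
  have J: "z \<in> W 1 (Y (J z))" for z
  proof -
    have "\<exists>j. z \<in> W 1 (Y j)" using Y by blast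
    then show ?thesis unfolding J_def by (rule someI_ex)
  qed
  define g where "g z = G (Suc (J z)) z" for z
  have g: "g z = G k z" if "z \<in> W 1 (Y j)" "Suc j \<le> k" for z j k
    using stable[OF that] stable[OF that(1), of "max (Suc j) (Suc (J z))"]
      stable[OF J, of z "max (Suc j) (Suc (J z))"] unfolding g_def by simp
  \<comment> \<open>Increments involve two points; an index beyond both stabilization indices
    reduces them to a single \<open>G k\<close>.\<close>
  have g2: "\<exists>k. g z = G k z \<and> g z' = G k z'" for z z'
    by (intro exI[of _ "max (Suc (J z)) (Suc (J z'))"] conjI g[OF J]) auto
  show ?thesis
  proof (rule that[of g])
    show "C1_on g UNIV"
    proof (rule C1_on_local)
      fix y
      have "C1_on (G (Suc (J y))) (W 1 (Y (J y)))"
      proof (rule C1_on_subset)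
        show "C1_on (G (Suc (J y))) (\<Union>j<Suc (J y). W 2 (Y j))" using G(1) unfolding good_def by blast
        have "W 1 (Y (J y)) \<subseteq> W 2 (Y (J y))"
        proof
          fix z assume "z \<in> W 1 (Y (J y))"
          moreover have "1 * R (Y (J y)) < 2 * R (Y (J y))" using CR(3)[of "Y (J y)"] by simp
          ultimately show "z \<in> W 2 (Y (J y))" unfolding W_def by auto
        qed
        then show "W 1 (Y (J y)) \<subseteq> (\<Union>j<Suc (J y). W 2 (Y j))" by auto
      qed
      then show "\<exists>N h. open N \<and> y \<in> N \<and> C1_on h N \<and> (\<forall>z\<in>N. g z = h z)"
        by (intro exI[of _ "W 1 (Y (J y))"] exI[of _ "G (Suc (J y))"]) (use openW J g in auto)
    qed
    show "g z' - g z \<le> (L + \<epsilon>) * d z z'" for z z'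
    proof -
      obtain k where "g z = G k z" "g z' = G k z'" using g2 by blast
      then have "g z' - g z \<le> (L + E k) * d z z'" using G(1)[of k] unfolding good_def by simp
      also have "\<dots> \<le> (L + \<epsilon>) * d z z'" using E(4) d_nonneg by (intro mult_right_mono) auto
      finally show ?thesis .
    qed
    show "0 \<le> g z \<and> g z \<le> 1" for z using G(1)[of "Suc (J z)"] unfolding g_def good_def by blast
    show "\<bar>g z - f z\<bar> \<le> \<epsilon>" for z
      using G(1)[of "Suc (J z)"] E(4)[of "Suc (J z)"] unfolding g_def good_def by (meson order_trans)
  qed
qed

text \<open>The triangle inequality bounds the increments of the distance from \<open>x\<close> by
  \<open>d z z'\<close>; truncation supplies the bound on the values.\<close>

lemma smooth_distance:
  assumes "0 < \<epsilon>"
  obtains g where "C1_on g UNIV" "\<And>z z'. g z' - g z \<le> (1 + \<epsilon>) * d z z'"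
    "\<And>z. 0 \<le> g z \<and> g z \<le> 1" "\<And>z. \<bar>g z - min (d x z) 1\<bar> \<le> \<epsilon>"
proof (rule smooth_approximation[where L = 1 and f = "\<lambda>z. min (d x z) 1"])
  show "min (d x z') 1 - min (d x z) 1 \<le> 1 * d z z'" for z z'
    using d_triangle[of x z' z] d_nonneg[of z z'] by (auto simp: min_def)
  show "0 \<le> min (d x z) 1 \<and> min (d x z) 1 \<le> 1" for z using d_nonneg by simp
qed (use assms that in auto)

end


section \<open>The algebra of a Finsler manifold\<close>

interpretation fun_space: vector_space fun_scale
  by (rule vector_space_fun_scale)

lemma le_of_le_add_mult:
  fixes a b c :: real
  assumes "\<And>e. 0 < e \<Longrightarrow> a \<le> b + e * c" "0 \<le> c" shows "a \<le> b"
proof (rule field_le_epsilon)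
  fix e :: real assume "0 < e"
  then have "a \<le> b + e / (c + 1) * c" using assms(2) by (intro assms(1)) simp
  also have "e / (c + 1) * c \<le> e" using \<open>0 < e\<close> assms(2) by (simp add: field_simps)
  finally show "a \<le> b + e" by simp
qed

context finsler begin

abbreviation SC :: "('a \<Rightarrow> real) set" where "SC \<equiv> SCb1_plus A F"

abbreviation alg :: "('a \<Rightarrow> real) set" where "alg \<equiv> finsler_algebra A F"

text \<open>The infimum of the admissible constants is itself admissible, because the defining
  inequalities are closed in \<open>L\<close>.\<close>

lemma slip_norm_le_iff:
  assumes "0 \<le> K"
  shows "slip_norm d f \<le> ereal K \<longleftrightarrow> (\<forall>x y. f y - f x \<le> K * d x y)"
proof
  assume le: "slip_norm d f \<le> ereal K"
  show "\<forall>x y. f y - f x \<le> K * d x y"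
  proof (intro allI)
    fix x y
    show "f y - f x \<le> K * d x y"
    proof (rule le_of_le_add_mult[OF _ d_nonneg])
      fix e :: real assume "0 < e"
      then have "slip_norm d f < ereal (K + e)" using le by (rule_tac le_less_trans) auto
      then obtain L where L: "\<forall>x y. f y - f x \<le> L * d x y" "L < K + e"
        unfolding slip_norm_def Inf_less_iff by auto
      have "f y - f x \<le> L * d x y" using L(1) by blast
      also have "\<dots> \<le> (K + e) * d x y" using L(2) d_nonneg by (intro mult_right_mono) auto
      finally show "f y - f x \<le> K * d x y + e * d x y" by (simp add: distrib_right)
    qed
  qed
next
  assume "\<forall>x y. f y - f x \<le> K * d x y"
  then show "slip_norm d f \<le> ereal K" unfolding slip_norm_def using assms by (intro Inf_lower) auto
qed

lemma sup_norm_le_iff: "sup_norm f \<le> ereal K \<longleftrightarrow> (\<forall>x. \<bar>f x\<bar> \<le> K)"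
  unfolding sup_norm_def by (simp add: SUP_le_iff)

lemma SC_iff:
  "f \<in> SC \<longleftrightarrow> C1_on f UNIV \<and> (\<exists>B\<ge>0. \<forall>x y. 0 \<le> f x \<and> f x \<le> B \<and> f y - f x \<le> B * d x y)"
proof
  assume f: "f \<in> SC"
  have "sup_norm f < \<infinity>" "slip_norm d f < \<infinity>" using f unfolding SCb1_plus_def by auto
  obtain L where L: "0 \<le> L" "\<forall>x y. f y - f x \<le> L * d x y"
    using \<open>slip_norm d f < \<infinity>\<close> unfolding slip_norm_def Inf_less_iff by auto
  obtain M where M: "\<forall>x. \<bar>f x\<bar> \<le> M"
  proof (cases "sup_norm f")
    case (real r)
    then show ?thesis using that[of r] sup_norm_le_iff[of f r] by simp
  next
    case PInf
    then show ?thesis using \<open>sup_norm f < \<infinity>\<close> by simp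
  next
    case MInf
    then show ?thesis using that[of 0] sup_norm_le_iff[of f 0] by simp
  qed
  have "f y - f x \<le> max L M * d x y" for x y
    using L(2) mult_right_mono[of L "max L M" "d x y"] d_nonneg by (meson max.cobounded1 order_trans)
  then show "C1_on f UNIV \<and> (\<exists>B\<ge>0. \<forall>x y. 0 \<le> f x \<and> f x \<le> B \<and> f y - f x \<le> B * d x y)"
    using f M L(1) unfolding SCb1_plus_def C1_function_iff
    by (intro conjI exI[of _ "max L M"] allI) (auto simp: abs_le_iff le_max_iff_disj)
next
  assume "C1_on f UNIV \<and> (\<exists>B\<ge>0. \<forall>x y. 0 \<le> f x \<and> f x \<le> B \<and> f y - f x \<le> B * d x y)"
  then obtain B where B: "C1_on f UNIV" "0 \<le> B" "\<forall>x y. 0 \<le> f x \<and> f x \<le> B \<and> f y - f x \<le> B * d x y"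
    by blast
  have "sup_norm f \<le> ereal B" using B(3) by (simp add: sup_norm_le_iff)
  moreover have "slip_norm d f \<le> ereal B" using B(2,3) by (simp add: slip_norm_le_iff)
  ultimately show "f \<in> SC" unfolding SCb1_plus_def C1_function_iff using B(1,3)
    by (auto intro: le_less_trans)
qed

text \<open>A finite bound forces membership in the cone, as \<open>asym_norm\<close> is infinite
  elsewhere; the maximum becomes two inequalities with a common \<open>K\<close>.\<close>

lemma asym_norm_le_iff:
  assumes "0 \<le> K"
  shows "asym_norm A F f \<le> ereal K \<longleftrightarrow> C1_on f UNIV \<and> (\<forall>x. 0 \<le> f x \<and> f x \<le> K) \<and> (\<forall>x y. f y - f x \<le> K * d x y)"
proof -
  have "asym_norm A F f \<le> ereal K \<longleftrightarrow> f \<in> SC \<and> sup_norm f \<le> ereal K \<and> slip_norm d f \<le> ereal K"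
    unfolding asym_norm_def by simp
  also have "\<dots> \<longleftrightarrow> f \<in> SC \<and> (\<forall>x. \<bar>f x\<bar> \<le> K) \<and> (\<forall>x y. f y - f x \<le> K * d x y)"
    using assms by (simp add: sup_norm_le_iff slip_norm_le_iff)
  also have "\<dots> \<longleftrightarrow> C1_on f UNIV \<and> (\<forall>x. 0 \<le> f x \<and> f x \<le> K) \<and> (\<forall>x y. f y - f x \<le> K * d x y)"
    using assms unfolding SC_iff by (fastforce simp: abs_le_iff)
  finally show ?thesis .
qed

lemma asym_norm_SC:
  assumes "f \<in> SC" obtains a where "0 \<le> a" "asym_norm A F f = ereal a"
proof -
  obtain B where B: "C1_on f UNIV" "0 \<le> B" "\<forall>x y. 0 \<le> f x \<and> f x \<le> B \<and> f y - f x \<le> B * d x y"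
    using assms unfolding SC_iff by blast
  then have "asym_norm A F f \<le> ereal B" by (simp add: asym_norm_le_iff)
  moreover have "0 \<le> sup_norm f" unfolding sup_norm_def by (rule SUP_upper2[of undefined]) auto
  then have "0 \<le> asym_norm A F f" unfolding asym_norm_def by (simp add: le_max_iff_disj)
  ultimately show ?thesis using that by (cases "asym_norm A F f") auto
qed

lemma SC_const: "0 \<le> k \<Longrightarrow> (\<lambda>x. k) \<in> SC"
  unfolding SC_iff using C1_on_const d_nonneg by (auto intro!: exI[of _ k])

lemma SC_add:
  assumes "f \<in> SC" "g \<in> SC" shows "(\<lambda>x. f x + g x) \<in> SC"
proof -
  obtain B C where B: "C1_on f UNIV" "0 \<le> B" "\<And>x y. 0 \<le> f x \<and> f x \<le> B \<and> f y - f x \<le> B * d x y"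
    and C: "C1_on g UNIV" "0 \<le> C" "\<And>x y. 0 \<le> g x \<and> g x \<le> C \<and> g y - g x \<le> C * d x y"
    using assms unfolding SC_iff by metis
  have "f y + g y - (f x + g x) \<le> (B + C) * d x y" for x y
    using B(3)[of x y] C(3)[of x y] by (simp add: algebra_simps)
  then show ?thesis unfolding SC_iff using B C C1_on_add
    by (intro conjI exI[of _ "B + C"]) (auto intro: add_mono)
qed

lemma SC_scale:
  assumes "f \<in> SC" "0 \<le> k" shows "(\<lambda>x. k * f x) \<in> SC"
proof -
  obtain B where B: "C1_on f UNIV" "0 \<le> B" "\<And>x y. 0 \<le> f x \<and> f x \<le> B \<and> f y - f x \<le> B * d x y"
    using assms unfolding SC_iff by metis
  have "k * f y - k * f x \<le> (k * B) * d x y" for x y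
    using mult_left_mono[of "f y - f x" "B * d x y" k] B(3)[of x y] assms(2) by (simp add: algebra_simps)
  then show ?thesis unfolding SC_iff using B assms(2) C1_on_mult[OF C1_on_const[of k]]
    by (intro conjI exI[of _ "k * B"]) (auto intro: mult_left_mono)
qed

text \<open>Product rule for increments with nonnegative factors. A negative increment is handled
  separately, since enlarging its factor would move the estimate in the wrong direction.\<close>

lemma SC_mult:
  assumes "f \<in> SC" "g \<in> SC" shows "(\<lambda>x. f x * g x) \<in> SC"
proof -
  obtain B C where B: "C1_on f UNIV" "0 \<le> B" "\<And>x y. 0 \<le> f x \<and> f x \<le> B \<and> f y - f x \<le> B * d x y"
    and C: "C1_on g UNIV" "0 \<le> C" "\<And>x y. 0 \<le> g x \<and> g x \<le> C \<and> g y - g x \<le> C * d x y"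
    using assms unfolding SC_iff by metis
  have lip: "f y * g y - f x * g x \<le> (2 * (B * C)) * d x y" for x y
  proof -
    have "f y * (g y - g x) \<le> B * (C * d x y)"
    proof (cases "g y - g x \<le> 0")
      case True
      then have "f y * (g y - g x) \<le> 0" using B(3) by (simp add: mult_nonneg_nonpos)
      also have "0 \<le> B * (C * d x y)" using B(2) C(2) d_nonneg by simp
      finally show ?thesis .
    qed (use B C in \<open>auto intro!: mult_mono\<close>)
    moreover have "g x * (f y - f x) \<le> C * (B * d x y)"
    proof (cases "f y - f x \<le> 0")
      case True
      then have "g x * (f y - f x) \<le> 0" using C(3) by (simp add: mult_nonneg_nonpos)
      also have "0 \<le> C * (B * d x y)" using B(2) C(2) d_nonneg by simp
      finally show ?thesis .
    qed (use B C in \<open>auto intro!: mult_mono\<close>)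
    ultimately show ?thesis by (simp add: algebra_simps)
  qed
  have "f x * g x \<le> 2 * (B * C)" for x
  proof -
    have "f x * g x \<le> B * C" using B C by (intro mult_mono) auto
    also have "\<dots> \<le> 2 * (B * C)" using B(2) C(2) by simp
    finally show ?thesis .
  qed
  then show ?thesis unfolding SC_iff using lip B C C1_on_mult[OF B(1) C(1)]
    by (intro conjI exI[of _ "2 * (B * C)"]) auto
qed

text \<open>\<open>SC\<close> is a convex cone, so its span consists of differences; a negative
  scalar exchanges the two parts.\<close>

lemma alg_iff: "f \<in> alg \<longleftrightarrow> (\<exists>u\<in>SC. \<exists>v\<in>SC. f = (\<lambda>x. u x - v x))"
proof
  let ?D = "{\<lambda>x. u x - v x | u v. u \<in> SC \<and> v \<in> SC}"
  assume "f \<in> alg"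
  have D: "f \<in> ?D" if "u \<in> SC" "v \<in> SC" "f = (\<lambda>x. u x - v x)" for f u v
    using that by (intro CollectI exI[of _ u] exI[of _ v]) auto
  have "alg \<subseteq> ?D" unfolding finsler_algebra_def
  proof (rule fun_space.span_minimal)
    show "SC \<subseteq> ?D"
    proof
      fix u assume "u \<in> SC"
      then show "u \<in> ?D" using SC_const[of 0] by (rule D) simp_all
    qed
    show "module.subspace fun_scale ?D"
    proof (rule fun_space.subspaceI)
      show "0 \<in> ?D" by (rule D[OF SC_const[of 0] SC_const[of 0]]) (simp_all add: zero_fun_def)
      fix f assume "f \<in> ?D"
      then obtain u v where f: "f = (\<lambda>x. u x - v x)" "u \<in> SC" "v \<in> SC" by blast
      show "f + g \<in> ?D" if "g \<in> ?D" for g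
      proof -
        obtain u' v' where g: "g = (\<lambda>x. u' x - v' x)" "u' \<in> SC" "v' \<in> SC" using \<open>g \<in> ?D\<close> by blast
        have "f + g = (\<lambda>x. (u x + u' x) - (v x + v' x))" using f g by (auto simp: plus_fun_def)
        then show ?thesis by (rule D[OF SC_add[OF f(2) g(2)] SC_add[OF f(3) g(3)]])
      qed
      show "fun_scale k f \<in> ?D" for k
      proof (cases "0 \<le> k")
        case True
        have "fun_scale k f = (\<lambda>x. (k * u x) - (k * v x))" using f by (auto simp: fun_scale_def algebra_simps)
        then show ?thesis by (rule D[OF SC_scale[OF f(2) True] SC_scale[OF f(3) True]])
      next
        case False
        then have k: "0 \<le> - k" by simp
        have "fun_scale k f = (\<lambda>x. (- k * v x) - (- k * u x))" using f by (auto simp: fun_scale_def algebra_simps)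
        then show ?thesis by (rule D[OF SC_scale[OF f(3) k] SC_scale[OF f(2) k]])
      qed
    qed
  qed
  then show "\<exists>u\<in>SC. \<exists>v\<in>SC. f = (\<lambda>x. u x - v x)" using \<open>f \<in> alg\<close> by blast
next
  assume "\<exists>u\<in>SC. \<exists>v\<in>SC. f = (\<lambda>x. u x - v x)"
  then obtain u v where f: "u \<in> SC" "v \<in> SC" "f = u - v" by (auto simp: fun_diff_def)
  then show "f \<in> alg" unfolding finsler_algebra_def
    by (auto intro: fun_space.span_diff fun_space.span_base)
qed

lemma SC_subset_alg: "f \<in> SC \<Longrightarrow> f \<in> alg"
  unfolding finsler_algebra_def by (rule fun_space.span_base)

lemma alg_add: "f \<in> alg \<Longrightarrow> g \<in> alg \<Longrightarrow> (\<lambda>x. f x + g x) \<in> alg"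
  unfolding finsler_algebra_def using fun_space.span_add[of f _ g] by (simp add: plus_fun_def)

lemma alg_scale: "f \<in> alg \<Longrightarrow> (\<lambda>x. k * f x) \<in> alg"
  unfolding finsler_algebra_def using fun_space.span_scale[of f _ k] by (simp add: fun_scale_def)

lemma alg_const: "(\<lambda>x. k) \<in> alg"
  using alg_scale[OF SC_subset_alg[OF SC_const[of 1]], of k] by simp

lemma alg_diff: "f \<in> alg \<Longrightarrow> g \<in> alg \<Longrightarrow> (\<lambda>x. f x - g x) \<in> alg"
  using alg_add[of f "\<lambda>x. -1 * g x"] alg_scale[of g "-1"] by simp

lemma alg_mult:
  assumes "f \<in> alg" "g \<in> alg" shows "(\<lambda>x. f x * g x) \<in> alg"
proof -
  obtain u v u' v' where f: "u \<in> SC" "v \<in> SC" "f = (\<lambda>x. u x - v x)" "u' \<in> SC" "v' \<in> SC" "g = (\<lambda>x. u' x - v' x)"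
    using assms unfolding alg_iff by blast
  have "(\<lambda>x. f x * g x) = (\<lambda>x. (u x * u' x + v x * v' x) - (u x * v' x + v x * u' x))"
    unfolding f by (auto simp: algebra_simps)
  moreover have "(\<lambda>x. u x * u' x + v x * v' x) \<in> SC" "(\<lambda>x. u x * v' x + v x * u' x) \<in> SC"
    by (intro SC_add SC_mult f)+
  ultimately show ?thesis by (simp add: alg_diff SC_subset_alg)
qed

lemma alg_C1:
  assumes "f \<in> alg" shows "C1_on f UNIV"
proof -
  obtain u v where "u \<in> SC" "v \<in> SC" "f = (\<lambda>x. u x - v x)" using assms unfolding alg_iff by blast
  then show ?thesis using C1_on_diff unfolding SC_iff by blast
qed

text \<open>Adding the bound \<open>M\<close> makes the function nonnegative and leaves its
  increments alone; constants belong to the span.\<close>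

lemma bilipschitz_imp_alg:
  assumes "C1_on f UNIV" "bilipschitz f" "\<And>x. \<bar>f x\<bar> \<le> M"
  shows "f \<in> alg"
proof -
  obtain L where L: "0 \<le> L" "\<And>z z'. \<bar>f z' - f z\<bar> \<le> L * d z z'" using assms(2) unfolding bilipschitz_def by blast
  have M: "0 \<le> M" using assms(3) abs_ge_zero order_trans by blast
  have "(\<lambda>x. f x + M) \<in> SC" unfolding SC_iff
  \<comment> \<open>One constant has to bound both the values, which reach at most
    \<open>2 * M\<close>, and the slope \<open>L\<close>.\<close>
  proof (intro conjI exI[of _ "L + 2 * M"] allI)
    show "C1_on (\<lambda>x. f x + M) UNIV" by (intro C1_on_add assms C1_on_const)
    fix x y
    show "0 \<le> f x + M" "f x + M \<le> L + 2 * M" using assms(3)[of x] L(1) by (auto simp: abs_le_iff)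
    have "f y + M - (f x + M) \<le> L * d x y" using L(2)[of y x] by simp
    also have "\<dots> \<le> (L + 2 * M) * d x y" using M d_nonneg by (intro mult_right_mono) auto
    finally show "f y + M - (f x + M) \<le> (L + 2 * M) * d x y" .
  qed (use L M in simp)
  then have "(\<lambda>x. (f x + M) - M) \<in> alg" by (intro alg_diff SC_subset_alg alg_const)
  then show ?thesis by simp
qed

text \<open>
  For \<open>f = u - v\<close> the function \<open>1 / f\<close> need not be semi-Lipschitz, but \<open>1 / f + k u\<close> is: its increments
  are \<open>(k - \<theta>) \<Delta>u + \<theta> \<Delta>v\<close> with \<open>\<theta> = 1 / (f x f y) \<in> [0, k]\<close>.
\<close>

lemma alg_inverse:
  assumes f: "f \<in> alg" and c: "0 < c" "\<And>x. c \<le> f x"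
  shows "(\<lambda>x. inverse (f x)) \<in> alg"
proof -
  obtain u v where uv: "u \<in> SC" "v \<in> SC" "f = (\<lambda>x. u x - v x)" using f unfolding alg_iff by blast
  obtain B C where B: "C1_on u UNIV" "0 \<le> B" "\<And>x y. 0 \<le> u x \<and> u x \<le> B \<and> u y - u x \<le> B * d x y"
    and C: "C1_on v UNIV" "0 \<le> C" "\<And>x y. 0 \<le> v x \<and> v x \<le> C \<and> v y - v x \<le> C * d x y"
    using uv unfolding SC_iff by metis
  define k where "k = inverse c * inverse c"
  have k: "0 < k" unfolding k_def using c by simp
  have fpos: "0 < f x" for x using c(1) c(2)[of x] by linarith
  have inv: "0 < inverse (f x)" "inverse (f x) \<le> inverse c" for x
    using fpos[of x] c(2)[of x] c(1) by (auto intro: le_imp_inverse_le)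
  define w where "w x = inverse (f x) + k * u x" for x
  define M where "M = inverse c + k * B + k * C"
  have kBC: "0 \<le> k * B" "0 \<le> k * C" "0 \<le> inverse c" using k B C c by simp_all
  have "w \<in> SC" unfolding SC_iff
  proof (intro conjI exI[of _ M] allI)
    show "C1_on w UNIV" unfolding w_def
      using fpos by (intro C1_on_add C1_on_mult C1_on_const B C1_on_inverse alg_C1 f) (metis less_irrefl)
    show "0 \<le> M" unfolding M_def using kBC by simp
    fix x y
    show "0 \<le> w x" unfolding w_def using inv[of x] B(3) k by (simp add: less_imp_le)
    have "k * u x \<le> k * B" using B(3) k by (intro mult_left_mono) auto
    then show "w x \<le> M" unfolding w_def M_def using inv[of x] kBC by linarith
    define \<theta> where "\<theta> = inverse (f x) * inverse (f y)"
    have \<theta>: "0 \<le> \<theta>" "\<theta> \<le> k" unfolding \<theta>_def k_def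
      by (intro mult_nonneg_nonneg mult_mono inv(2) kBC(3) less_imp_le[OF inv(1)])+
    have "inverse (f y) - inverse (f x) = \<theta> * (f x - f y)"
      unfolding \<theta>_def using fpos[of x] fpos[of y] by (simp add: field_simps)
    then have "w y - w x = (k - \<theta>) * (u y - u x) + \<theta> * (v y - v x)"
      unfolding w_def uv(3) by (simp add: algebra_simps)
    also have "\<dots> \<le> (k - \<theta>) * (B * d x y) + \<theta> * (C * d x y)"
      using \<theta> B(3)[of x y] C(3)[of x y] by (intro add_mono mult_left_mono) auto
    also have "\<dots> \<le> k * (B * d x y) + k * (C * d x y)"
      using \<theta> B(2) C(2) d_nonneg by (intro add_mono mult_right_mono) auto
    also have "\<dots> \<le> M * d x y"
      unfolding M_def using kBC(3) d_nonneg[of x y] by (simp add: algebra_simps)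
    finally show "w y - w x \<le> M * d x y" .
  qed
  then have "(\<lambda>x. w x - k * u x) \<in> alg" using uv(1) by (intro alg_diff alg_scale SC_subset_alg)
  then show ?thesis unfolding w_def by simp
qed

text \<open>
  Otherwise the sum of the squares of the \<open>u i - \<psi> (u i)\<close> would be bounded away from \<open>0\<close>, hence
  invertible in the algebra, although \<open>\<psi>\<close> annihilates it.
\<close>

lemma character_dense:
  assumes add: "\<And>f g. f \<in> alg \<Longrightarrow> g \<in> alg \<Longrightarrow> \<psi> (\<lambda>x. f x + g x) = \<psi> f + \<psi> g"
    and scale: "\<And>k f. f \<in> alg \<Longrightarrow> \<psi> (\<lambda>x. k * f x) = k * \<psi> f"
    and mult: "\<And>f g. f \<in> alg \<Longrightarrow> g \<in> alg \<Longrightarrow> \<psi> (\<lambda>x. f x * g x) = \<psi> f * \<psi> g"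
    and one: "\<psi> (\<lambda>x. 1) = 1"
    and I: "finite I" "\<And>i. i \<in> I \<Longrightarrow> u i \<in> alg" and e: "0 < e"
  shows "\<exists>y. \<forall>i\<in>I. \<bar>u i y - \<psi> (u i)\<bar> < e"
proof (rule ccontr)
  assume no: "\<not> ?thesis"
  have const: "\<psi> (\<lambda>x. k) = k" for k using scale[OF alg_const[of 1], of k] one by simp
  define v where "v i x = u i x + - \<psi> (u i)" for i x
  have v: "v i \<in> alg" "\<psi> (v i) = 0" if "i \<in> I" for i
    unfolding v_def using add[OF I(2)[OF that] alg_const[of "- \<psi> (u i)"]] alg_diff[OF I(2)[OF that] alg_const] const
    by simp_all
  have sq: "(\<lambda>x. \<Sum>i\<in>J. v i x * v i x) \<in> alg \<and> \<psi> (\<lambda>x. \<Sum>i\<in>J. v i x * v i x) = 0" if "J \<subseteq> I" for J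
    using finite_subset[OF that I(1)] that
  proof (induction J rule: finite_induct)
    case empty
    then show ?case using alg_const[of 0] const[of 0] by simp
  next
    case (insert i J)
    then have i: "v i \<in> alg" "\<psi> (v i) = 0" using v by auto
    have vv: "(\<lambda>x. v i x * v i x) \<in> alg" "\<psi> (\<lambda>x. v i x * v i x) = 0"
      using alg_mult[OF i(1) i(1)] mult[OF i(1) i(1)] i(2) by auto
    have J: "(\<lambda>x. \<Sum>i\<in>J. v i x * v i x) \<in> alg" "\<psi> (\<lambda>x. \<Sum>i\<in>J. v i x * v i x) = 0"
      using insert by auto
    show ?case using alg_add[OF vv(1) J(1)] add[OF vv(1) J(1)] vv(2) J(2) insert.hyps by simp
  qed
  define g where "g x = (\<Sum>i\<in>I. v i x * v i x)" for x
  have g: "g \<in> alg" "\<psi> g = 0" using sq[OF order_refl] unfolding g_def by auto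
  have ge: "e * e \<le> g x" for x
  proof -
    obtain i where i: "i \<in> I" "e \<le> \<bar>v i x\<bar>" using no unfolding v_def by (auto simp: not_less)
    have "e * e \<le> \<bar>v i x\<bar> * \<bar>v i x\<bar>" using i(2) e by (intro mult_mono) auto
    also have "\<dots> = v i x * v i x" by simp
    also have "\<dots> \<le> g x" unfolding g_def by (rule member_le_sum[OF i(1)]) (use I(1) in auto)
    finally show ?thesis .
  qed
  have "0 < e * e" using e by simp
  then have inv: "(\<lambda>x. inverse (g x)) \<in> alg" using alg_inverse[OF g(1) _ ge] by blast
  have "g x \<noteq> 0" for x using ge[of x] \<open>0 < e * e\<close> by linarith
  then have "(\<lambda>x. g x * inverse (g x)) = (\<lambda>x. 1)" by simp
  then show False using mult[OF g(1) inv] g(2) one by simp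
qed

lemma alg_separates:
  assumes "\<And>f. f \<in> alg \<Longrightarrow> f x = f y" shows "x = y"
proof (rule ccontr)
  assume "x \<noteq> y"
  then have "open (- {y})" "x \<in> - {y}" by auto
  then obtain b where b: "C1_on b UNIV" "bilipschitz b" "\<And>z. 0 \<le> b z \<and> b z \<le> 1" "b x = 1" "\<And>z. b z \<noteq> 0 \<Longrightarrow> z \<in> - {y}"
    using bump_at by metis
  then have "b \<in> alg" by (intro bilipschitz_imp_alg[where M = 1]) (auto simp: abs_le_iff)
  moreover have "b y = 0" using b(5)[of y] by auto
  ultimately show False using assms[of b] b(4) by simp
qed

lemma bump_alg:
  assumes "open N" "y \<in> N"
  obtains b where "b \<in> alg" "b y = 1" "\<And>z. b z \<noteq> 0 \<Longrightarrow> z \<in> N"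
proof -
  obtain b where b: "C1_on b UNIV" "bilipschitz b" "\<And>z. 0 \<le> b z \<and> b z \<le> 1" "b y = 1" "\<And>z. b z \<noteq> 0 \<Longrightarrow> z \<in> N"
    using bump_at[OF assms] by metis
  then have "b \<in> alg" by (intro bilipschitz_imp_alg[where M = 1]) (auto simp: abs_le_iff)
  then show ?thesis using that b by blast
qed

text \<open>Multiplication by a bump makes a linear coordinate bounded and supported in the chart
  without changing it near the centre. Such functions detect C^1 regularity of maps into the
  manifold.\<close>

lemma chart_functional:
  fixes \<phi> :: "'e \<Rightarrow> real"
  assumes c: "c \<in> A" "y \<in> fst c" and R: "0 < R" and sub: "cball (snd c y) R \<subseteq> snd c ` fst c"
    and \<phi>: "bounded_linear \<phi>"
  obtains u where "u \<in> alg" "\<And>z. z \<in> fst c \<Longrightarrow> snd c z \<in> cball (snd c y) (R / 2) \<Longrightarrow> u z = \<phi> (snd c z)"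
proof -
  let ?p = "snd c y"
  obtain e M where e: "Ck_on 1 e UNIV" "\<And>q. 0 \<le> e q \<and> e q \<le> (1::real)"
    "\<And>q. q \<in> cball ?p (R / 2) \<Longrightarrow> e q = 1" "\<And>q. q \<notin> cball ?p R \<Longrightarrow> e q = 0"
    "\<And>q q'. \<bar>e q' - e q\<bar> \<le> M * norm (q' - q)" "0 \<le> M"
    using bump_function[OF finite_dimensional, of "R / 2" R ?p] R by (metis field_sum_of_halves less_add_same_cancel1 half_gt_zero)
  interpret \<phi>: bounded_linear \<phi> by (rule \<phi>)
  obtain K where K: "0 \<le> K" "\<And>q. \<bar>\<phi> q\<bar> \<le> norm q * K" using \<phi>.nonneg_bounded by auto
  define H where "H = (norm ?p + R) * K"
  have H: "0 \<le> H" unfolding H_def using K R by simp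
  have bd: "\<bar>\<phi> q\<bar> \<le> H" if "q \<in> cball ?p R" for q
  proof -
    have "norm q \<le> norm ?p + R" using that norm_triangle_sub[of q ?p] by (simp add: dist_norm norm_minus_commute)
    then have "norm q * K \<le> H" unfolding H_def using K by (intro mult_right_mono)
    then show ?thesis using K(2)[of q] by linarith
  qed
  define g where "g q = e q * \<phi> q" for q
  have g: "Ck_on 1 g UNIV" unfolding g_def by (intro Ck_on_1_mult e Ck_on_1_bounded_linear \<phi>)
  have g0: "g q = 0" if "q \<notin> cball ?p R" for q unfolding g_def using e(4)[OF that] by simp
  \<comment> \<open>The increment is expanded so that the value of \<open>\<phi>\<close> is taken at
    \<open>q'\<close>, where \<open>H\<close> bounds it; if only \<open>q\<close> lies in the ball,
    the roles are exchanged.\<close>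
  have in_case: "\<bar>g q' - g q\<bar> \<le> (M * H + K) * norm (q' - q)" if "q' \<in> cball ?p R" for q q'
  proof -
    have "g q' - g q = (e q' - e q) * \<phi> q' + e q * \<phi> (q' - q)"
      unfolding g_def \<phi>.diff by (simp add: algebra_simps)
    then have "\<bar>g q' - g q\<bar> \<le> \<bar>e q' - e q\<bar> * \<bar>\<phi> q'\<bar> + \<bar>e q\<bar> * \<bar>\<phi> (q' - q)\<bar>"
      by (simp add: abs_triangle_ineq abs_mult[symmetric])
    also have "\<dots> \<le> (M * norm (q' - q)) * H + 1 * (norm (q' - q) * K)"
      using e(2)[of q] e(5,6) bd[OF that] K by (intro add_mono mult_mono) auto
    finally show ?thesis by (simp add: algebra_simps)
  qed
  have lip: "\<bar>g q' - g q\<bar> \<le> (M * H + K) * norm (q' - q)" for q q'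
    using in_case[of q' q] in_case[of q q'] g0[of q] g0[of q'] e(6) H K
    by (cases "q' \<in> cball ?p R"; cases "q \<in> cball ?p R") (auto simp: abs_minus_commute norm_minus_commute)
  let ?u = "extend_chart c g"
  have "\<bar>?u z\<bar> \<le> H" for z
  proof -
    have "\<bar>g q\<bar> \<le> H" for q
    proof (cases "q \<in> cball ?p R")
      case True
      have "\<bar>g q\<bar> = e q * \<bar>\<phi> q\<bar>" unfolding g_def using e(2)[of q] by (simp add: abs_mult)
      also have "\<dots> \<le> 1 * H" using e(2)[of q] bd[OF True] by (intro mult_mono) auto
      finally show ?thesis by simp
    qed (use g0 H in simp)
    then show ?thesis unfolding extend_chart_def using H by simp
  qed
  moreover have "bilipschitz ?u" using extend_chart_lipschitz[OF c(1) sub g0 lip] e(6) H K by simp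
  moreover have "C1_on ?u UNIV" by (rule extend_chart_C1[OF c(1) sub g g0])
  ultimately have "?u \<in> alg" using bilipschitz_imp_alg by blast
  moreover have "?u z = \<phi> (snd c z)" if "z \<in> fst c" "snd c z \<in> cball ?p (R / 2)" for z
    using that e(3) unfolding extend_chart_def g_def by simp
  ultimately show ?thesis by (rule that)
qed

end


section \<open>Composition with a bi-semi-Lipschitz diffeomorphism\<close>

locale two_finsler = X: finsler AX FX + Y: finsler AY FY
  for AX :: "('a::{t2_space, second_countable_topology}, 'e::real_normed_vector) chart set"
    and FX :: "'a \<Rightarrow> ('a, 'e) tangent \<Rightarrow> real"
    and AY :: "('b::{t2_space, second_countable_topology}, 'f::real_normed_vector) chart set"
    and FY :: "'b \<Rightarrow> ('b, 'f) tangent \<Rightarrow> real"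
begin

lemma C1_on_compose:
  assumes h: "C1_map AX AY h" and f: "Y.C1_on f UNIV"
  shows "X.C1_on (f \<circ> h) UNIV"
  unfolding X.C1_on_def
proof
  fix c assume c: "c \<in> AX"
  show "Ck_on 1 ((f \<circ> h) \<circ> chart_inv c) (snd c ` (fst c \<inter> UNIV))"
  proof (rule Ck_on_1_local)
    fix p assume "p \<in> snd c ` (fst c \<inter> UNIV)"
    then obtain x where x: "x \<in> fst c" "p = snd c x" by auto
    obtain c' where c': "c' \<in> AY" "h x \<in> fst c'" by (rule Y.chart_at)
    have "open (h -` fst c')"
      using h Y.open_chart[OF c'(1)] unfolding C1_map_def by (auto intro: open_vimage)
    then have op: "open (snd c ` (fst c \<inter> h -` fst c'))" by (rule X.open_chart_image_Int[OF c])
    have "Ck_on 1 (f \<circ> chart_inv c') (snd c' ` (fst c' \<inter> UNIV))" using f c' unfolding Y.C1_on_def by blast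
    moreover have "Ck_on 1 (snd c' \<circ> h \<circ> chart_inv c) (snd c ` (fst c \<inter> h -` fst c'))"
      using h c c' unfolding C1_map_def by blast
    moreover have "(snd c' \<circ> h \<circ> chart_inv c) ` snd c ` (fst c \<inter> h -` fst c') \<subseteq> snd c' ` (fst c' \<inter> UNIV)"
      using X.chart_inv_chart[OF c] by auto
    ultimately have "Ck_on 1 ((f \<circ> chart_inv c') \<circ> (snd c' \<circ> h \<circ> chart_inv c)) (snd c ` (fst c \<inter> h -` fst c'))"
      by (rule Ck_on_1_compose[OF Y.finite_dimensional])
    moreover have "((f \<circ> h) \<circ> chart_inv c) q = ((f \<circ> chart_inv c') \<circ> (snd c' \<circ> h \<circ> chart_inv c)) q"
      if "q \<in> snd c ` (fst c \<inter> h -` fst c')" for q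
      using that X.chart_inv_chart[OF c] Y.chart_inv_chart[OF c'(1)] by auto
    ultimately show "\<exists>N g. open N \<and> p \<in> N \<and> Ck_on 1 g N \<and> (\<forall>q\<in>N. ((f \<circ> h) \<circ> chart_inv c) q = g q)"
      using op x c' by (intro exI[of _ "snd c ` (fst c \<inter> h -` fst c')"]
        exI[of _ "(f \<circ> chart_inv c') \<circ> (snd c' \<circ> h \<circ> chart_inv c)"]) (simp del: One_nat_def)
  qed
qed

text \<open>Composition does not increase the supremum and multiplies the slope by at most
  \<open>L\<close>; \<open>max 1 L\<close> serves both.\<close>

lemma asym_norm_compose:
  assumes h: "C1_map AX AY h" and L: "semi_lipschitz_with X.d Y.d h L"
  shows "asym_norm AX FX (f \<circ> h) \<le> ereal (max 1 L) * asym_norm AY FY f"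
proof (cases "f \<in> Y.SC")
  case True
  obtain a where a: "0 \<le> a" "asym_norm AY FY f = ereal a" by (rule Y.asym_norm_SC[OF True])
  then have "asym_norm AY FY f \<le> ereal a" by simp
  then have f: "Y.C1_on f UNIV" "\<And>x. 0 \<le> f x \<and> f x \<le> a" "\<And>x y. f y - f x \<le> a * Y.d x y"
    using Y.asym_norm_le_iff[OF a(1)] by auto
  have La: "0 \<le> max 1 L * a" using a(1) by simp
  have "f (h y) - f (h x) \<le> max 1 L * a * X.d x y" for x y
  proof -
    have "Y.d (h x) (h y) \<le> L * X.d x y" using L unfolding semi_lipschitz_with_def by blast
    also have "\<dots> \<le> max 1 L * X.d x y" using X.d_nonneg by (intro mult_right_mono) auto
    finally have "a * Y.d (h x) (h y) \<le> a * (max 1 L * X.d x y)" using a(1) by (rule mult_left_mono)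
    then show ?thesis using f(3)[of "h y" "h x"] by (simp add: mult_ac)
  qed
  moreover have "f (h x) \<le> max 1 L * a" for x
    using f(2)[of "h x"] mult_right_mono[of 1 "max 1 L" a] a(1) by simp
  ultimately have "asym_norm AX FX (f \<circ> h) \<le> ereal (max 1 L * a)"
    unfolding X.asym_norm_le_iff[OF La] using C1_on_compose[OF h f(1)] f(2) by simp
  then show ?thesis unfolding a(2) times_ereal.simps .
next
  case False
  then have "asym_norm AY FY f = \<infinity>" unfolding asym_norm_def by simp
  \<comment> \<open>The factor is at least \<open>1\<close>; with a factor \<open>0\<close> the
    product would be \<open>0\<close>.\<close>
  then have "ereal (max 1 L) * asym_norm AY FY f = \<infinity>" by (simp only: times_ereal.simps) simp
  then show ?thesis by (simp only: ereal_less_eq)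
qed

lemma compose_alg:
  assumes h: "C1_map AX AY h" and L: "semi_lipschitz X.d Y.d h" and f: "f \<in> Y.alg"
  shows "f \<circ> h \<in> X.alg"
proof -
  obtain L where L: "semi_lipschitz_with X.d Y.d h L" using L unfolding semi_lipschitz_def by blast
  have SC: "(\<lambda>x. u (h x)) \<in> X.SC" if u: "u \<in> Y.SC" for u
  proof -
    obtain a where "asym_norm AY FY u = ereal a" using Y.asym_norm_SC[OF u] by blast
    then have "asym_norm AX FX (u \<circ> h) \<le> ereal (max 1 L * a)"
      using asym_norm_compose[OF h L, of u] by (simp only: times_ereal.simps)
    then have "asym_norm AX FX (u \<circ> h) \<noteq> \<infinity>" by auto
    then show ?thesis unfolding asym_norm_def by (auto simp: comp_def split: if_splits)
  qed
  obtain u v where "u \<in> Y.SC" "v \<in> Y.SC" "f = (\<lambda>x. u x - v x)" using f unfolding Y.alg_iff by blast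
  then show ?thesis using X.alg_diff[OF X.SC_subset_alg[OF SC] X.SC_subset_alg[OF SC], of u v]
    by (simp add: comp_def)
qed

end

lemma (in two_finsler) diffeomorphism_imp_iso:
  assumes h: "C1_diffeomorphism AX AY h" and L: "bi_semi_lipschitz X.d Y.d h"
    and T: "\<And>f. f \<in> Y.alg \<Longrightarrow> T f = f \<circ> h"
  shows "normed_algebra_iso Y.alg (asym_norm AY FY) X.alg (asym_norm AX FX) T"
proof -
  interpret sw: two_finsler AY FY AX FX ..
  have bij: "bij h" and h1: "C1_map AX AY h" "C1_map AY AX (inv h)" using h unfolding C1_diffeomorphism_def by auto
  have L1: "semi_lipschitz X.d Y.d h" "semi_lipschitz Y.d X.d (inv h)" using L unfolding bi_semi_lipschitz_def by auto
  have hinv: "h \<circ> inv h = id" "inv h \<circ> h = id" using bij by (simp_all add: bij_def surj_iff)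
  have T_in: "T f \<in> X.alg" if "f \<in> Y.alg" for f using compose_alg[OF h1(1) L1(1) that] T[OF that] by simp
  have S_in: "g \<circ> inv h \<in> Y.alg" if "g \<in> X.alg" for g by (rule sw.compose_alg[OF h1(2) L1(2) that])
  have bijT: "bij_betw T Y.alg X.alg"
  proof (rule bij_betwI[where g = "\<lambda>g. g \<circ> inv h"])
    show "T f \<circ> inv h = f" if "f \<in> Y.alg" for f using T[OF that] hinv by (simp add: comp_assoc)
    show "T (g \<circ> inv h) = g" if "g \<in> X.alg" for g using T[OF S_in[OF that]] hinv by (simp add: comp_assoc)
  qed (use T_in S_in in auto)
  have inv_T: "inv_into Y.alg T g = g \<circ> inv h" if "g \<in> X.alg" for g
  proof -
    have "g = T (g \<circ> inv h)" using T[OF S_in[OF that]] hinv by (simp add: comp_assoc)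
    then show ?thesis using inv_into_f_f[of T Y.alg "g \<circ> inv h"] bijT S_in[OF that] unfolding bij_betw_def by simp
  qed
  obtain L M where LM: "semi_lipschitz_with X.d Y.d h L" "semi_lipschitz_with Y.d X.d (inv h) M"
    using L1 unfolding semi_lipschitz_def by blast
  show ?thesis unfolding normed_algebra_iso_def
  proof (intro conjI ballI allI bijT)
    fix f g assume fg: "f \<in> Y.alg" "g \<in> Y.alg"
    have "f + g \<in> Y.alg" "f * g \<in> Y.alg"
      using Y.alg_add[OF fg] Y.alg_mult[OF fg] by (simp_all add: plus_fun_def times_fun_def)
    then show "T (f + g) = T f + T g" "T (f * g) = T f * T g"
      using T fg by (auto simp: plus_fun_def times_fun_def)
  next
    fix k f assume f: "f \<in> Y.alg"
    have "fun_scale k f \<in> Y.alg" using Y.alg_scale[OF f] by (simp add: fun_scale_def)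
    then show "T (fun_scale k f) = fun_scale k (T f)" using T f by (auto simp: fun_scale_def)
  next
    show "\<exists>K. bounded_with Y.alg (asym_norm AY FY) (asym_norm AX FX) T K"
      unfolding bounded_with_def using asym_norm_compose[OF h1(1) LM(1)] T
      by (intro exI[of _ "max 1 L"]) auto
    show "\<exists>K. bounded_with X.alg (asym_norm AX FX) (asym_norm AY FY) (inv_into Y.alg T) K"
      unfolding bounded_with_def using sw.asym_norm_compose[OF h1(2) LM(2)] inv_T
      by (intro exI[of _ "max 1 M"]) auto
  qed
qed


section \<open>Isomorphisms are compositions with diffeomorphisms\<close>

text \<open>By injectivity an element of \<open>V\<close> with the right image under
  \<open>T\<close> is the value of the inverse, so each identity for \<open>T\<close> can be read
  backwards.\<close>

lemma normed_algebra_iso_inverse: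
  assumes T: "normed_algebra_iso V p W q T"
    and closed: "\<And>f g. f \<in> V \<Longrightarrow> g \<in> V \<Longrightarrow> f + g \<in> V" "\<And>k f. f \<in> V \<Longrightarrow> fun_scale k f \<in> V"
      "\<And>f g. f \<in> V \<Longrightarrow> g \<in> V \<Longrightarrow> f * g \<in> V"
  shows "normed_algebra_iso W q V p (inv_into V T)"
proof -
  let ?S = "inv_into V T"
  have bij: "bij_betw T V W" using T unfolding normed_algebra_iso_def by blast
  have bijS: "bij_betw ?S W V" using bij by (rule bij_betw_inv_into)
  have S: "?S g \<in> V" "T (?S g) = g" if "g \<in> W" for g
    using bij bijS that by (auto simp: bij_betw_def bij_betw_inv_into_right intro: f_inv_into_f inv_into_into)
  have eq: "?S g = f" if "f \<in> V" "T f = g" for f g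
    using bij that unfolding bij_betw_def by (metis inv_into_f_f)
  \<comment> \<open>The inverse of the inverse agrees with \<open>T\<close> on \<open>V\<close>, and
    \<open>bounded_with\<close> evaluates it only there.\<close>
  have SS: "inv_into W ?S f = T f" if "f \<in> V" for f
    using bij that by (rule inv_into_inv_into_eq)
  show ?thesis unfolding normed_algebra_iso_def
  proof (intro conjI ballI allI bijS)
    fix f g assume "f \<in> W" "g \<in> W"
    then show "?S (f + g) = ?S f + ?S g" "?S (f * g) = ?S f * ?S g"
      using S closed T unfolding normed_algebra_iso_def by (intro eq; simp)+
  next
    fix k f assume "f \<in> W"
    then show "?S (fun_scale k f) = fun_scale k (?S f)"
      using S closed T unfolding normed_algebra_iso_def by (intro eq; simp)
  next
    show "\<exists>K. bounded_with W q p ?S K" using T unfolding normed_algebra_iso_def by blast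
    have "\<exists>K. bounded_with V p q T K" using T unfolding normed_algebra_iso_def by blast
    then show "\<exists>K. bounded_with V p q (inv_into W ?S) K" unfolding bounded_with_def using SS by simp
  qed
qed

locale algebra_iso = two_finsler AX FX AY FY
  for AX :: "('a::{t2_space, second_countable_topology}, 'e::real_normed_vector) chart set"
    and FX :: "'a \<Rightarrow> ('a, 'e) tangent \<Rightarrow> real"
    and AY :: "('b::{t2_space, second_countable_topology}, 'f::real_normed_vector) chart set"
    and FY :: "'b \<Rightarrow> ('b, 'f) tangent \<Rightarrow> real" +
  fixes T :: "('b \<Rightarrow> real) \<Rightarrow> 'a \<Rightarrow> real"
  assumes iso: "normed_algebra_iso Y.alg (asym_norm AY FY) X.alg (asym_norm AX FX) T"
begin

abbreviation S :: "('a \<Rightarrow> real) \<Rightarrow> 'b \<Rightarrow> real" where "S \<equiv> inv_into Y.alg T"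

text \<open>The situation is symmetric in the two manifolds, which makes every result on
  \<open>T\<close> available for \<open>S\<close>.\<close>

lemma swap: "algebra_iso AY FY AX FX S"
proof (intro algebra_iso.intro two_finsler.intro algebra_iso_axioms.intro)
  show "normed_algebra_iso X.alg (asym_norm AX FX) Y.alg (asym_norm AY FY) S"
    using iso
  proof (rule normed_algebra_iso_inverse)
    show "f + g \<in> Y.alg" "f * g \<in> Y.alg" if "f \<in> Y.alg" "g \<in> Y.alg" for f g
      using Y.alg_add[OF that] Y.alg_mult[OF that] by (simp_all add: plus_fun_def times_fun_def)
    show "fun_scale k f \<in> Y.alg" if "f \<in> Y.alg" for k f
      using Y.alg_scale[OF that] by (simp add: fun_scale_def)
  qed
qed unfold_locales

lemma bij_T: "bij_betw T Y.alg X.alg"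
  using iso unfolding normed_algebra_iso_def by blast

lemma T_in: "f \<in> Y.alg \<Longrightarrow> T f \<in> X.alg"
  using bij_T unfolding bij_betw_def by blast

lemma S_in: "g \<in> X.alg \<Longrightarrow> S g \<in> Y.alg"
  using bij_T unfolding bij_betw_def by (metis inv_into_into)

lemma T_S: "g \<in> X.alg \<Longrightarrow> T (S g) = g"
  by (rule bij_betw_inv_into_right[OF bij_T])

lemma S_T: "f \<in> Y.alg \<Longrightarrow> S (T f) = f"
  by (rule bij_betw_inv_into_left[OF bij_T])

lemma T_add: "f \<in> Y.alg \<Longrightarrow> g \<in> Y.alg \<Longrightarrow> T (\<lambda>y. f y + g y) = (\<lambda>x. T f x + T g x)"
  using iso unfolding normed_algebra_iso_def plus_fun_def by blast

lemma T_mult: "f \<in> Y.alg \<Longrightarrow> g \<in> Y.alg \<Longrightarrow> T (\<lambda>y. f y * g y) = (\<lambda>x. T f x * T g x)"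
  using iso unfolding normed_algebra_iso_def times_fun_def by blast

lemma T_scale: "f \<in> Y.alg \<Longrightarrow> T (\<lambda>y. k * f y) = (\<lambda>x. k * T f x)"
  using iso unfolding normed_algebra_iso_def fun_scale_def by blast

text \<open>Surjectivity makes \<open>T\<close> unital: \<open>S 1\<close> is mapped to
  \<open>1\<close>, and multiplicativity applied to \<open>S 1 = S 1 * 1\<close> forces
  \<open>T 1 = 1\<close>.\<close>

lemma T_one: "T (\<lambda>y. 1) = (\<lambda>x. 1)"
proof -
  have "T (\<lambda>y. 1) x = 1" for x
  proof -
    have "T (\<lambda>y. S (\<lambda>x. 1) y * 1) = (\<lambda>x. T (S (\<lambda>x. 1)) x * T (\<lambda>y. 1) x)"
      by (rule T_mult[OF S_in[OF X.alg_const] Y.alg_const])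
    then show ?thesis using T_S[OF X.alg_const, of 1] by (simp add: fun_eq_iff)
  qed
  then show ?thesis by blast
qed

lemma T_dense:
  assumes "finite I" "\<And>i. i \<in> I \<Longrightarrow> u i \<in> Y.alg" "0 < e"
  shows "\<exists>y. \<forall>i\<in>I. \<bar>u i y - T (u i) x\<bar> < e"
  by (rule Y.character_dense[where \<psi> = "\<lambda>f. T f x"]) (simp_all add: T_add T_mult T_scale T_one assms)

text \<open>The hemi-norm is a maximum, so one number \<open>a\<close> has to bound both the values
  and the slope of \<open>f\<close>.\<close>

lemma T_slip:
  assumes K: "bounded_with Y.alg (asym_norm AY FY) (asym_norm AX FX) T K"
    and f: "Y.C1_on f UNIV" "\<And>y. 0 \<le> f y \<and> f y \<le> a" "\<And>y y'. f y' - f y \<le> a * Y.d y y'"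
  shows "f \<in> Y.alg" "T f x' - T f x \<le> K * a * X.d x x'"
proof -
  have a: "0 \<le> a" using f(2) order_trans by blast
  have K0: "0 \<le> K" using K unfolding bounded_with_def by blast
  have p: "asym_norm AY FY f \<le> ereal a" unfolding Y.asym_norm_le_iff[OF a] using f by simp
  then have "f \<in> Y.SC" unfolding asym_norm_def by (auto split: if_splits)
  then show fa: "f \<in> Y.alg" by (rule Y.SC_subset_alg)
  have "asym_norm AX FX (T f) \<le> ereal K * asym_norm AY FY f" using K fa unfolding bounded_with_def by blast
  also have "\<dots> \<le> ereal K * ereal a" using p K0 by (intro ereal_mult_left_mono) auto
  finally have "asym_norm AX FX (T f) \<le> ereal (K * a)" by simp
  then show "T f x' - T f x \<le> K * a * X.d x x'" using X.asym_norm_le_iff[of "K * a"] K0 a by simp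
qed

text \<open>
  Points \<open>y n\<close> whose evaluations approach the character \<open>f \<mapsto> T f x\<close> form a forward Cauchy sequence:
  a smooth approximation of the distance from \<open>y n\<close> is small at \<open>y n\<close>, hence, as \<open>T\<close> is bounded, its image
  is small at \<open>x\<close>, hence the approximation is small at later points of the sequence.
\<close>

lemma character_is_point:
  assumes complete: "forward_complete Y.d"
  shows "\<exists>y. \<forall>f\<in>Y.alg. T f x = f y"
proof -
  interpret sw: algebra_iso AY FY AX FX S by (rule swap)
  obtain K where K: "bounded_with Y.alg (asym_norm AY FY) (asym_norm AX FX) T K"
    using iso unfolding normed_algebra_iso_def by blast
  then have K0: "0 \<le> K" unfolding bounded_with_def by blast
  define \<delta> :: "nat \<Rightarrow> real" where "\<delta> n = (1 / 2) ^ n" for n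
  have \<delta>: "0 < \<delta> n" "\<delta> n \<le> 1" for n unfolding \<delta>_def by (auto simp: power_le_one)
  have \<delta>_mono: "\<delta> m \<le> \<delta> n" if "n \<le> m" for n m unfolding \<delta>_def using that by (intro power_decreasing) auto
  have "\<exists>b. b \<in> X.alg \<and> b x = 1 \<and> (\<forall>z. b z \<noteq> 0 \<longrightarrow> X.d z x < \<delta> n)" for n
  proof -
    obtain N where N: "open N" "x \<in> N" "\<And>z. z \<in> N \<Longrightarrow> X.d x z < \<delta> n \<and> X.d z x < \<delta> n"
      using X.near_imp_d_small[OF \<delta>(1)] by blast
    obtain b where "b \<in> X.alg" "b x = 1" "\<And>z. b z \<noteq> 0 \<Longrightarrow> z \<in> N" using X.bump_alg[OF N(1,2)] by blast
    then show ?thesis using N(3) by blast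
  qed
  then obtain b where b: "\<And>n. b n \<in> X.alg" "\<And>n. b n x = 1" "\<And>n z. b n z \<noteq> 0 \<Longrightarrow> X.d z x < \<delta> n" by metis
  \<comment> \<open>The slope bound for \<open>T f\<close> is applied from \<open>x'\<close> to
    \<open>x\<close>, matching the direction in which \<open>b n\<close> controls the distance. The
    constant \<open>2\<close> is the common bound for values and slopes of the approximations
    \<open>ap\<close>.\<close>
  have key: "T f x \<le> f y + 2 * K * \<delta> n"
    if y: "S (b n) y > 1 / 2" and f: "Y.C1_on f UNIV" "\<And>y. 0 \<le> f y \<and> f y \<le> 2" "\<And>y y'. f y' - f y \<le> 2 * Y.d y y'"
    for n f y
  proof (rule field_le_epsilon)
    fix e :: real assume e: "0 < e"
    note Tf = T_slip[OF K f]
    have "\<exists>x'. \<forall>g\<in>{T f, b n}. \<bar>g x' - S g y\<bar> < min e (1 / 4)"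
      using e by (intro sw.T_dense) (use T_in[OF Tf(1)] b(1) in auto)
    then obtain x' where x': "\<bar>T f x' - S (T f) y\<bar> < min e (1 / 4)" "\<bar>b n x' - S (b n) y\<bar> < min e (1 / 4)" by auto
    have "b n x' \<noteq> 0" using x'(2) y by auto
    then have "X.d x' x \<le> \<delta> n" using b(3)[of n x'] by simp
    then have "K * 2 * X.d x' x \<le> K * 2 * \<delta> n" using K0 by (intro mult_left_mono) auto
    moreover have "\<bar>T f x' - f y\<bar> < e" using x'(1) S_T[OF Tf(1)] by simp
    moreover have "2 * K * \<delta> n = K * 2 * \<delta> n" by simp
    ultimately show "T f x \<le> f y + 2 * K * \<delta> n + e" using Tf(2)[of x x'] by linarith
  qed
  have "\<exists>g. Y.C1_on g UNIV \<and> (\<forall>z z'. g z' - g z \<le> 2 * Y.d z z') \<and> (\<forall>z. 0 \<le> g z \<and> g z \<le> 2) \<and>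
      (\<forall>z. \<bar>g z - min (Y.d y z) 1\<bar> \<le> \<delta> n)" for y n
  proof -
    obtain g where g: "Y.C1_on g UNIV" "\<And>z z'. g z' - g z \<le> (1 + \<delta> n) * Y.d z z'"
      "\<And>z. 0 \<le> g z \<and> g z \<le> 1" "\<And>z. \<bar>g z - min (Y.d y z) 1\<bar> \<le> \<delta> n"
      using Y.smooth_distance[OF \<delta>(1)] by metis
    have "g z' - g z \<le> 2 * Y.d z z'" for z z'
    proof -
      have "(1 + \<delta> n) * Y.d z z' \<le> 2 * Y.d z z'" using \<delta>(2)[of n] Y.d_nonneg by (intro mult_right_mono) auto
      then show ?thesis using g(2) order_trans by blast
    qed
    moreover have "0 \<le> g z \<and> g z \<le> 2" for z using g(3)[of z] by simp
    ultimately show ?thesis using g(1,4) by blast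
  qed
  then obtain ap where ap: "\<And>y n. Y.C1_on (ap y n) UNIV" "\<And>y n z z'. ap y n z' - ap y n z \<le> 2 * Y.d z z'"
    "\<And>y n z. 0 \<le> ap y n z \<and> ap y n z \<le> 2" "\<And>y n z. \<bar>ap y n z - min (Y.d y z) 1\<bar> \<le> \<delta> n"
    by metis
  have ap_alg: "ap y n \<in> Y.alg" for y n by (rule T_slip(1)[OF K ap(1,3,2)])
  \<comment> \<open>The \<open>n\<close>-th point has to respect the approximate distance functions
    from all earlier points, whence course-of-values recursion.\<close>
  have "\<exists>y. \<forall>n. S (b n) (y n) > 1 / 2 \<and> (\<forall>i<n. \<bar>ap (y i) i (y n) - T (ap (y i) i) x\<bar> < \<delta> n)"
  proof (rule dependent_wellorder_choice)
    fix y z :: "nat \<Rightarrow> 'b" and n r assume "\<And>i. i < n \<Longrightarrow> y i = z i"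
    then show "(S (b n) r > 1 / 2 \<and> (\<forall>i<n. \<bar>ap (y i) i r - T (ap (y i) i) x\<bar> < \<delta> n)) =
      (S (b n) r > 1 / 2 \<and> (\<forall>i<n. \<bar>ap (z i) i r - T (ap (z i) i) x\<bar> < \<delta> n))" by simp
  next
    fix n and y :: "nat \<Rightarrow> 'b"
    \<comment> \<open>Index \<open>n\<close> stands for the bump \<open>b n\<close>, the indices
      below \<open>n\<close> for the earlier distance functions.\<close>
    have "\<exists>r. \<forall>i\<in>{..n}. \<bar>(if i = n then S (b n) else ap (y i) i) r - T (if i = n then S (b n) else ap (y i) i) x\<bar>
        < min (1 / 2) (\<delta> n)"
      using \<delta>(1) S_in[OF b(1)] ap_alg by (intro T_dense) auto
    then obtain r where r: "\<forall>i\<in>{..n}. \<bar>(if i = n then S (b n) else ap (y i) i) r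
        - T (if i = n then S (b n) else ap (y i) i) x\<bar> < min (1 / 2) (\<delta> n)" ..
    have "\<bar>S (b n) r - 1\<bar> < 1 / 2" using r[rule_format, of n] T_S[OF b(1)] b(2) by simp
    then have "S (b n) r > 1 / 2" by (smt (verit) field_sum_of_halves)
    moreover have "\<bar>ap (y i) i r - T (ap (y i) i) x\<bar> < \<delta> n" if "i < n" for i
      using r[rule_format, of i] that by simp
    ultimately show "\<exists>r. S (b n) r > 1 / 2 \<and> (\<forall>i<n. \<bar>ap (y i) i r - T (ap (y i) i) x\<bar> < \<delta> n)" by blast
  qed
  then obtain y where y: "\<And>n. S (b n) (y n) > 1 / 2"
    "\<And>n i. i < n \<Longrightarrow> \<bar>ap (y i) i (y n) - T (ap (y i) i) x\<bar> < \<delta> n" by blast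
  have Tap: "T (ap (y n) n) x \<le> (1 + 2 * K) * \<delta> n" for n
  proof -
    have "T (ap (y n) n) x \<le> ap (y n) n (y n) + 2 * K * \<delta> n" by (rule key[OF y(1) ap(1,3,2)])
    moreover have "ap (y n) n (y n) \<le> \<delta> n" using ap(4)[of "y n" n "y n"] Y.d_self[of "y n"] by simp
    ultimately show ?thesis by (simp add: algebra_simps)
  qed
  \<comment> \<open>The factor collects \<open>1 + 2 * K\<close> from \<open>Tap\<close>, one
    \<open>\<delta> n\<close> from the approximation of the distance and one from the choice of
    \<open>z\<close>.\<close>
  have near: "min (Y.d (y n) z) 1 \<le> (3 + 2 * K) * \<delta> n"
    if "\<bar>ap (y n) n z - T (ap (y n) n) x\<bar> < \<delta> m" "n \<le> m" for n m z
    using that(1) \<delta>_mono[OF that(2)] Tap[of n] ap(4)[of "y n" n z] by (simp add: algebra_simps)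
  have small: "\<exists>n0. \<forall>n\<ge>n0. (3 + 2 * K) * \<delta> n < e" if "0 < e" for e
  proof -
    have "(\<lambda>n. (3 + 2 * K) * \<delta> n) \<longlonglongrightarrow> (3 + 2 * K) * 0"
      unfolding \<delta>_def by (intro tendsto_intros LIMSEQ_realpow_zero) auto
    then have "\<forall>\<^sub>F n in sequentially. (3 + 2 * K) * \<delta> n < e" using that by (auto dest: order_tendstoD)
    then show ?thesis by (simp add: eventually_sequentially)
  qed
  have "\<exists>l. limitin (forward_topology Y.d) y l sequentially"
  proof (rule complete[unfolded forward_complete_def, rule_format])
    fix e :: real assume "0 < e"
    then obtain n0 where n0: "\<And>n. n \<ge> n0 \<Longrightarrow> (3 + 2 * K) * \<delta> n < min e 1" using small[of "min e 1"] by auto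
    have "Y.d (y n) (y m) < e" if "n0 \<le> n" "n \<le> m" for n m
    proof (cases "n = m")
      case False
      then have "n < m" using that by simp
      \<comment> \<open>Comparison with \<open>min e 1\<close>, rather than with \<open>e\<close>,
        removes the truncation.\<close>
      have "min (Y.d (y n) (y m)) 1 < min e 1"
        using near[OF y(2)[OF \<open>n < m\<close>] that(2)] n0[OF that(1)] by simp
      then show ?thesis by (auto simp: min_def split: if_splits)
    qed (use Y.d_self \<open>0 < e\<close> in simp)
    then show "\<exists>n0. \<forall>n m. n0 \<le> n \<and> n \<le> m \<longrightarrow> Y.d (y n) (y m) < e" by blast
  qed
  then obtain l where l: "limitin (forward_topology Y.d) y l sequentially" ..
  have dl: "\<forall>\<^sub>F n in sequentially. Y.d l (y n) < e" if "0 < e" for e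
  proof -
    have "openin (forward_topology Y.d) {z. Y.d l z < e}" unfolding forward_topology_def
      by (rule topology_generated_by_Basis) (use that in blast)
    moreover have "l \<in> {z. Y.d l z < e}" using that Y.d_self by simp
    ultimately show ?thesis using l unfolding limitin_def by auto
  qed
  have "T f x = f l" if f: "f \<in> Y.alg" for f
  proof -
    have "\<bar>T f x - f l\<bar> \<le> 0"
    proof (rule field_le_epsilon)
      fix e :: real assume "0 < e"
      define N where "N = {z. \<bar>f z - f l\<bar> < e / 2}"
      have "open N" unfolding N_def
        using Y.C1_on_continuous[OF Y.alg_C1[OF f]] by (intro open_Collect_less continuous_intros) auto
      moreover have "l \<in> N" using \<open>0 < e\<close> unfolding N_def by simp
      ultimately obtain r where r: "0 < r" "\<And>z. Y.d l z < r \<Longrightarrow> z \<in> N" using Y.d_small_imp_near by metis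
      obtain n1 where n1: "\<And>n. n \<ge> n1 \<Longrightarrow> (3 + 2 * K) * \<delta> n < min (r / 2) 1" using small[of "min (r / 2) 1"] r(1) by auto
      obtain n2 where n2: "\<And>n. n \<ge> n2 \<Longrightarrow> Y.d l (y n) < r / 2"
        using dl[of "r / 2"] r(1) unfolding eventually_sequentially by auto
      define n where "n = max n1 n2"
      \<comment> \<open>The sequence was chosen without reference to \<open>f\<close>, so a further
        point \<open>z\<close> represents the character on \<open>f\<close> and on the distance from
        \<open>y n\<close> at once; nearness to \<open>y n\<close> puts it near
        \<open>l\<close>.\<close>
      have "\<exists>z. \<forall>g\<in>{f, ap (y n) n}. \<bar>g z - T g x\<bar> < min (e / 2) (\<delta> n)"
        using \<open>0 < e\<close> \<delta>(1) f ap_alg by (intro T_dense) auto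
      then obtain z where z: "\<bar>f z - T f x\<bar> < e / 2" "\<bar>ap (y n) n z - T (ap (y n) n) x\<bar> < \<delta> n" by auto
      have "min (Y.d (y n) z) 1 < min (r / 2) 1"
        using near[OF z(2) order_refl] n1[of n] unfolding n_def by simp
      then have "Y.d (y n) z < r / 2" by (auto simp: min_def split: if_splits)
      then have "Y.d l z < r" using Y.d_triangle[of l z "y n"] n2[of n] unfolding n_def by simp
      then have "\<bar>f z - f l\<bar> < e / 2" using r(2) unfolding N_def by blast
      then show "\<bar>T f x - f l\<bar> \<le> 0 + e" using z(1) by linarith
    qed
    then show ?thesis by simp
  qed
  then show ?thesis by blast
qed

section \<open>Regularity of the underlying map of points\<close>

text \<open>Bumps of the algebra determine the topology: if \<open>b\<close> is \<open>1\<close> at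
  \<open>h x\<close> and vanishes off \<open>N\<close>, then positivity of \<open>T b\<close> cuts
  out a neighbourhood of \<open>x\<close> that \<open>h\<close> sends into \<open>N\<close>.\<close>

lemma T_compose_continuous:
  assumes h: "\<And>f x. f \<in> Y.alg \<Longrightarrow> T f x = f (h x)"
  shows "continuous_on UNIV h"
proof -
  have "open (h -` N)" if N: "open N" for N
    unfolding open_subopen[of "h -` N"]
  proof
    fix x assume "x \<in> h -` N"
    then obtain b where b: "b \<in> Y.alg" "b (h x) = 1" "\<And>z. b z \<noteq> 0 \<Longrightarrow> z \<in> N" using Y.bump_alg[OF N] by blast
    have "open {z. 0 < T b z}"
      using X.C1_on_continuous[OF X.alg_C1[OF T_in[OF b(1)]]] by (intro open_Collect_less continuous_intros) auto
    moreover have "x \<in> {z. 0 < T b z}" using h[OF b(1)] b(2) by simp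
    moreover have "{z. 0 < T b z} \<subseteq> h -` N" using h[OF b(1)] b(3) by fastforce
    ultimately show "\<exists>U. open U \<and> x \<in> U \<and> U \<subseteq> h -` N" by blast
  qed
  then show ?thesis by (simp add: continuous_on_open_vimage)
qed

lemma T_compose_C1_map:
  assumes h: "\<And>f x. f \<in> Y.alg \<Longrightarrow> T f x = f (h x)"
  shows "C1_map AX AY h"
  unfolding C1_map_def
proof (intro conjI ballI)
  show cont: "continuous_on UNIV h" using h by (rule T_compose_continuous)
  fix c c' assume c: "c \<in> AX" and c': "c' \<in> AY"
  obtain B :: "'f set" where B: "finite B" "independent B" "span B = UNIV"
    using Y.finite_dimensional by (rule finite_spanning_basis)
  show "Ck_on 1 (snd c' \<circ> h \<circ> chart_inv c) (snd c ` (fst c \<inter> h -` fst c'))"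
  proof (rule Ck_on_1_local)
    fix p assume "p \<in> snd c ` (fst c \<inter> h -` fst c')"
    then obtain x where x: "x \<in> fst c" "h x \<in> fst c'" "p = snd c x" by blast
    obtain R where R: "0 < R" "cball (snd c' (h x)) R \<subseteq> snd c' ` (fst c' \<inter> UNIV)"
      using Y.chart_cball[OF c' x(2) open_UNIV] by blast
    then have sub: "cball (snd c' (h x)) R \<subseteq> snd c' ` fst c'" by simp
    have "\<exists>u. u \<in> Y.alg \<and> (\<forall>z\<in>fst c'. snd c' z \<in> cball (snd c' (h x)) (R / 2) \<longrightarrow> u z = representation B (snd c' z) a)"
      if "a \<in> B" for a
      using Y.chart_functional[OF c' x(2) R(1) sub bounded_linear_representation[OF B that]] by metis
    then obtain u where u: "\<And>a. a \<in> B \<Longrightarrow> u a \<in> Y.alg"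
      "\<And>a z. a \<in> B \<Longrightarrow> z \<in> fst c' \<Longrightarrow> snd c' z \<in> cball (snd c' (h x)) (R / 2) \<Longrightarrow> u a z = representation B (snd c' z) a"
      by metis
    define W where "W = {z \<in> fst c'. snd c' z \<in> ball (snd c' (h x)) (R / 2)}"
    define N where "N = snd c ` (fst c \<inter> h -` W)"
    \<comment> \<open>\<open>g\<close> reassembles the coordinates of \<open>h\<close> from the
      functions \<open>T (u a)\<close>, which are C^1 as elements of the algebra.\<close>
    define g where "g q = (\<Sum>a\<in>B. (T (u a) \<circ> chart_inv c) q *\<^sub>R a)" for q
    have "open W" unfolding W_def by (rule Y.open_chart_preimage[OF c' open_ball])
    then have "open (h -` W)" using cont by (simp add: open_vimage)
    then have "open N" unfolding N_def by (rule X.open_chart_image_Int[OF c])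
    moreover have "p \<in> N" unfolding N_def W_def using x R(1) by auto
    moreover have "Ck_on 1 g N" unfolding g_def
    proof (intro Ck_on_1_sum[OF B(1)] Ck_on_1_scaleR)
      fix a assume "a \<in> B"
      then have "Ck_on 1 (T (u a) \<circ> chart_inv c) (snd c ` (fst c \<inter> UNIV))"
        using X.alg_C1[OF T_in[OF u(1)]] c unfolding X.C1_on_def by blast
      then show "Ck_on 1 (T (u a) \<circ> chart_inv c) N" by (rule Ck_on_1_subset) (auto simp: N_def)
    qed
    moreover have "(snd c' \<circ> h \<circ> chart_inv c) q = g q" if q: "q \<in> N" for q
    proof -
      obtain z where z: "z \<in> fst c" "h z \<in> W" "q = snd c z" using q unfolding N_def by blast
      have "(T (u a) \<circ> chart_inv c) q = representation B (snd c' (h z)) a" if "a \<in> B" for a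
        using h[OF u(1)[OF that]] u(2)[OF that, of "h z"] z X.chart_inv_chart[OF c z(1)] unfolding W_def by simp
      then have "g q = (\<Sum>a\<in>B. representation B (snd c' (h z)) a *\<^sub>R a)" unfolding g_def by (intro sum.cong) simp_all
      also have "\<dots> = snd c' (h z)" using B by (simp add: sum_representation_eq)
      finally show ?thesis using z X.chart_inv_chart[OF c z(1)] by simp
    qed
    ultimately show "\<exists>N g. open N \<and> p \<in> N \<and> Ck_on 1 g N \<and> (\<forall>q\<in>N. (snd c' \<circ> h \<circ> chart_inv c) q = g q)" by blast
  qed
qed

lemma T_compose_semi_lipschitz:
  assumes h: "\<And>f x. f \<in> Y.alg \<Longrightarrow> T f x = f (h x)"
    and K: "bounded_with Y.alg (asym_norm AY FY) (asym_norm AX FX) T K"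
  shows "semi_lipschitz_with X.d Y.d h K"
proof -
  have K0: "0 \<le> K" using K unfolding bounded_with_def by blast
  \<comment> \<open>The image of a smoothed distance from \<open>h x\<close> is its composition with
    \<open>h\<close> and has slope at most \<open>K * (1 + e)\<close>; letting \<open>e\<close> tend
    to zero gives the exact \<open>K\<close>, up to truncation.\<close>
  have min: "min (Y.d (h x) (h x')) 1 \<le> K * X.d x x'" for x x'
  proof (rule le_of_le_add_mult)
    show "0 \<le> K * X.d x x' + 2" using K0 X.d_nonneg by simp
    fix e :: real assume e: "0 < e"
    obtain g where g: "Y.C1_on g UNIV" "\<And>z z'. g z' - g z \<le> (1 + e) * Y.d z z'"
      "\<And>z. 0 \<le> g z \<and> g z \<le> 1" "\<And>z. \<bar>g z - min (Y.d (h x) z) 1\<bar> \<le> e"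
      using Y.smooth_distance[OF e] by metis
    have g': "0 \<le> g z \<and> g z \<le> 1 + e" for z using g(3)[of z] e by simp
    have "g (h x') - g (h x) \<le> K * (1 + e) * X.d x x'"
      using T_slip[OF K g(1) g' g(2)] h by simp
    moreover have "g (h x) \<le> e" using g(4)[of "h x"] Y.d_self[of "h x"] by simp
    moreover have "min (Y.d (h x) (h x')) 1 \<le> g (h x') + e" using g(4)[of "h x'"] by simp
    ultimately show "min (Y.d (h x) (h x')) 1 \<le> K * X.d x x' + e * (K * X.d x x' + 2)"
      by (simp add: algebra_simps)
  qed
  have cont: "continuous_on UNIV h" using h by (rule T_compose_continuous)
  have "Y.d (h x) (h x') \<le> K * X.d x x'" for x x'
  proof -
    \<comment> \<open>For fixed \<open>x\<close> this is an increment of the real function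
      \<open>\<lambda>z. Y.d (h x) (h z)\<close>, to which the passage from local to global bounds
      applies.\<close>
    have "Y.d (h x) (h x') - Y.d (h x) (h x) \<le> K * X.d x x'"
    proof (rule X.locally_lipschitz_imp_lipschitz[OF _ K0, where f = "\<lambda>z. Y.d (h x) (h z)"])
      fix y
      have half: "0 < (1 / 2 :: real)" by simp
      \<comment> \<open>Radius \<open>1 / 2\<close> in both directions keeps any two points of
        \<open>N\<close> at distance below \<open>1\<close>, where the truncation is
        inactive.\<close>
      obtain N where N: "open N" "h y \<in> N" "\<And>z. z \<in> N \<Longrightarrow> Y.d (h y) z < 1 / 2 \<and> Y.d z (h y) < 1 / 2"
        by (rule Y.near_imp_d_small[OF half, of "h y"]) (rule that)
      have "Y.d (h x) (h z') - Y.d (h x) (h z) \<le> K * X.d z z'" if z: "h z \<in> N" "h z' \<in> N" for z z'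
      proof -
        have "Y.d (h z) (h z') < 1" using Y.d_triangle[of "h z" "h z'" "h y"] N(3)[OF z(1)] N(3)[OF z(2)] by linarith
        then have "Y.d (h z) (h z') \<le> K * X.d z z'" using min[of z z'] by (simp add: min_def split: if_splits)
        then show ?thesis using Y.d_triangle[of "h x" "h z'" "h z"] by linarith
      qed
      moreover have "open (h -` N)" using cont N(1) by (simp add: open_vimage)
      ultimately show "\<exists>N. open N \<and> y \<in> N \<and> (\<forall>z\<in>N. \<forall>z'\<in>N. Y.d (h x) (h z') - Y.d (h x) (h z) \<le> K * X.d z z')"
        using N(2) by (intro exI[of _ "h -` N"]) auto
    qed
    then show ?thesis using Y.d_self[of "h x"] by simp
  qed
  then show ?thesis unfolding semi_lipschitz_with_def using K0 by blast
qed

text \<open>Each bound \<open>K\<close> of \<open>T\<close> is a semi-Lipschitz constant of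
  \<open>h\<close> without loss, so the infimum on the left runs over a larger set.\<close>

lemma semi_lip_const_le_op_norm:
  assumes h: "\<And>f x. f \<in> Y.alg \<Longrightarrow> T f x = f (h x)"
  shows "semi_lip_const X.d Y.d h \<le> op_norm Y.alg (asym_norm AY FY) (asym_norm AX FX) T"
  unfolding semi_lip_const_def op_norm_def
proof (rule Inf_superset_mono)
  show "{ereal K |K. bounded_with Y.alg (asym_norm AY FY) (asym_norm AX FX) T K} \<subseteq>
      {ereal L |L. semi_lipschitz_with X.d Y.d h L}"
    using T_compose_semi_lipschitz[OF h] by blast
qed

lemma iso_imp_diffeomorphism:
  assumes "forward_complete X.d" "forward_complete Y.d"
  shows "\<exists>h. C1_diffeomorphism AX AY h \<and> bi_semi_lipschitz X.d Y.d h \<and> (\<forall>f\<in>Y.alg. T f = f \<circ> h) \<and>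
    semi_lip_const X.d Y.d h \<le> op_norm Y.alg (asym_norm AY FY) (asym_norm AX FX) T \<and>
    semi_lip_const Y.d X.d (inv h) \<le> op_norm X.alg (asym_norm AX FX) (asym_norm AY FY) S"
proof -
  interpret sw: algebra_iso AY FY AX FX S by (rule swap)
  obtain h where h: "\<And>f x. f \<in> Y.alg \<Longrightarrow> T f x = f (h x)"
    using character_is_point[OF assms(2)] by metis
  obtain k where k: "\<And>g y. g \<in> X.alg \<Longrightarrow> S g y = g (k y)"
    using sw.character_is_point[OF assms(1)] by metis
  \<comment> \<open>For every \<open>f\<close> in the algebra,
    \<open>f (h (k y)) = T f (k y) = S (T f) y = f y\<close>, and the algebra separates
    points.\<close>
  have hk: "h (k y) = y" for y
    by (rule Y.alg_separates) (metis h k T_in S_T)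
  have kh: "k (h x) = x" for x
    by (rule X.alg_separates) (metis h k S_in T_S)
  have bij: "bij h" using hk kh by (intro o_bij[of k]) auto
  have inv: "inv h = k" using hk kh by (intro inv_unique_comp) auto
  obtain K where "bounded_with Y.alg (asym_norm AY FY) (asym_norm AX FX) T K"
    using iso unfolding normed_algebra_iso_def by blast
  then have "semi_lipschitz X.d Y.d h"
    unfolding semi_lipschitz_def using T_compose_semi_lipschitz[OF h] by blast
  moreover obtain K' where "bounded_with X.alg (asym_norm AX FX) (asym_norm AY FY) S K'"
    using sw.iso unfolding normed_algebra_iso_def by blast
  then have "semi_lipschitz Y.d X.d k"
    unfolding semi_lipschitz_def using sw.T_compose_semi_lipschitz[OF k] by blast
  ultimately have "bi_semi_lipschitz X.d Y.d h" unfolding bi_semi_lipschitz_def inv using bij by blast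
  moreover have "C1_diffeomorphism AX AY h" unfolding C1_diffeomorphism_def inv
    using bij T_compose_C1_map[OF h] sw.T_compose_C1_map[OF k] by blast
  ultimately show ?thesis
    using h semi_lip_const_le_op_norm[OF h] sw.semi_lip_const_le_op_norm[OF k] inv
    by (intro exI[of _ h]) auto
qed

end

theorem theorem44:
  fixes AX :: "('a::{t2_space, second_countable_topology}, 'e::real_normed_vector) chart set"
    and FX :: "'a \<Rightarrow> ('a, 'e) tangent \<Rightarrow> real"
    and AY :: "('b::{t2_space, second_countable_topology}, 'f::real_normed_vector) chart set"
    and FY :: "'b \<Rightarrow> ('b, 'f) tangent \<Rightarrow> real"
    and T :: "('b \<Rightarrow> real) \<Rightarrow> ('a \<Rightarrow> real)"
  assumes "finsler_manifold AX FX" and "finsler_manifold AY FY"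
    and "connected (UNIV :: 'a set)" and "connected (UNIV :: 'b set)"
    and "forward_complete (finsler_dist AX FX)" and "forward_complete (finsler_dist AY FY)"
    and "T \<in> finsler_algebra AY FY \<rightarrow> finsler_algebra AX FX"
  shows "normed_algebra_iso (finsler_algebra AY FY) (asym_norm AY FY)
           (finsler_algebra AX FX) (asym_norm AX FX) T \<longleftrightarrow>
         (\<exists>h :: 'a \<Rightarrow> 'b.
            C1_diffeomorphism AX AY h \<and>
            bi_semi_lipschitz (finsler_dist AX FX) (finsler_dist AY FY) h \<and>
            (\<forall>f \<in> finsler_algebra AY FY. T f = f \<circ> h) \<and>
            semi_lip_const (finsler_dist AX FX) (finsler_dist AY FY) h
              \<le> op_norm (finsler_algebra AY FY) (asym_norm AY FY) (asym_norm AX FX) T \<and>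
            semi_lip_const (finsler_dist AY FY) (finsler_dist AX FX) (inv h)
              \<le> op_norm (finsler_algebra AX FX) (asym_norm AX FX) (asym_norm AY FY)
                  (inv_into (finsler_algebra AY FY) T))"
proof -
  interpret two_finsler AX FX AY FY
    using assms(1-4) by (intro two_finsler.intro finsler.intro)
  show ?thesis
  proof
    assume "normed_algebra_iso (finsler_algebra AY FY) (asym_norm AY FY)
      (finsler_algebra AX FX) (asym_norm AX FX) T"
    then interpret algebra_iso AX FX AY FY T by unfold_locales
    show "\<exists>h :: 'a \<Rightarrow> 'b.
            C1_diffeomorphism AX AY h \<and>
            bi_semi_lipschitz (finsler_dist AX FX) (finsler_dist AY FY) h \<and>
            (\<forall>f \<in> finsler_algebra AY FY. T f = f \<circ> h) \<and>
            semi_lip_const (finsler_dist AX FX) (finsler_dist AY FY) h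
              \<le> op_norm (finsler_algebra AY FY) (asym_norm AY FY) (asym_norm AX FX) T \<and>
            semi_lip_const (finsler_dist AY FY) (finsler_dist AX FX) (inv h)
              \<le> op_norm (finsler_algebra AX FX) (asym_norm AX FX) (asym_norm AY FY)
                  (inv_into (finsler_algebra AY FY) T)"
      by (rule iso_imp_diffeomorphism[OF assms(5,6)])
  qed (use diffeomorphism_imp_iso in blast)
qed


end
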